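(* Let $X$ ($m\times p$) and $S$ ($p\times p$) be independent with $X\sim \mathcal N_{m\times p}(\Theta, I_m\otimes\Sigma)$ and $S\sim\mathcal W_p(n,\Sigma)$. For positive constants $\alpha,\beta$ let $$\widehat\Theta^{G}=X-\alpha X\{I_p+\beta S^{-1}X^\top X\}^{-1}.$$ (i) Assume $p>m+1$ and $n\ge p$. If $\alpha\le 2(p-m-1)\beta/(n-p+2m+1)$, then $\widehat\Theta^G$ dominates $X$ relative to the matrix quadratic loss $L_M(\widehat\Theta,\Theta)=(\widehat\Theta-\Theta)\Sigma^{-1}(\widehat\Theta-\Theta)^\top$. (ii) Assume $|p-m|>1$ and $n\ge p$, and let $\ell=\min(m,p)$. If $\alpha\le 2(|p-m|-1)\beta/(n-p+2\ell+1)$, then $\widehat\Theta^G$ dominates $X$ relative to the scalar quadratic loss $L_Q(\widehat\Theta,\Theta)=\mathrm{tr}\{(\widehat\Theta-\Theta)\Sigma^{-1}(\widehat\Theta-\Theta)^\top\}$.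
   Context: $\mathcal N_{m\times p}(\Theta,I_m\otimes\Sigma)$ is the distribution of an $m\times p$ matrix with mean $\Theta$ and independent normal rows with covariance $\Sigma$ ($p\times p$ positive definite); $\mathcal W_p(n,\Sigma)$ is the Wishart distribution with $n$ degrees of freedom and scale $\Sigma$. Both $\Theta$ (arbitrary $m\times p$) and $\Sigma$ are unknown. The risk of an estimator is the expected loss. Under a scalar loss, $\delta_1$ dominates $\delta_2$ if the risk of $\delta_1$ is at most that of $\delta_2$ for all $(\Theta,\Sigma)$ with strict inequality for some $(\Theta,\Sigma)$. Under the matrix loss, the same is meant with respect to the positive semidefinite (Löwner) order on $m\times m$ risk matrices: the risk of $\delta_2$ minus that of $\delta_1$ is positive semidefinite for all $(\Theta,\Sigma)$ and nonzero for some $(\Theta,\Sigma)$. *)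

theory Defs
  imports "HOL-Probability.Probability"
begin

text \<open>
  Matrices are of type \<open>real^'p^'m\<close>, with rows indexed by \<open>'m\<close> and columns indexed by \<open>'p\<close>;
  thus \<open>X $ i\<close> is the \<open>i\<close>-th row of \<open>X\<close>.
\<close>

definition pos_def :: "real^'n^'n \<Rightarrow> bool" where
  "pos_def A \<longleftrightarrow> transpose A = A \<and> (\<forall>x. x \<noteq> 0 \<longrightarrow> 0 < x \<bullet> (A *v x))"

definition pos_semidef :: "real^'n^'n \<Rightarrow> bool" where
  "pos_semidef A \<longleftrightarrow> transpose A = A \<and> (\<forall>x. 0 \<le> x \<bullet> (A *v x))"

definition multi_normal :: "real^'p \<Rightarrow> real^'p^'p \<Rightarrow> (real^'p) measure" where
  "multi_normal \<mu> \<Sigma> = density lborel (\<lambda>x. ennreal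
     (exp (- ((x - \<mu>) \<bullet> (matrix_inv \<Sigma> *v (x - \<mu>))) / 2) / sqrt ((2 * pi) ^ CARD('p) * det \<Sigma>)))"

text \<open>\<open>N\<^bsub>m\<times>p\<^esub>(\<Theta>, I\<^sub>m \<otimes> \<Sigma>)\<close>: the rows are independent, row \<open>i\<close> being \<open>N\<^sub>p(\<Theta> $ i, \<Sigma>)\<close>.\<close>

definition matrix_normal :: "real^'p^'m \<Rightarrow> real^'p^'p \<Rightarrow> (real^'p^'m) measure" where
  "matrix_normal \<Theta> \<Sigma> = distr (\<Pi>\<^sub>M i\<in>UNIV. multi_normal (\<Theta> $ i) \<Sigma>) borel (\<lambda>r. \<chi> i. r i)"

text \<open>\<open>W\<^sub>p(n, \<Sigma>)\<close>: the law of \<open>z\<^sub>1 z\<^sub>1\<^sup>T + \<dots> + z\<^sub>n z\<^sub>n\<^sup>T\<close> for independent \<open>z\<^sub>k \<sim> N\<^sub>p(0, \<Sigma>)\<close>.\<close>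

definition wishart :: "nat \<Rightarrow> real^'p^'p \<Rightarrow> (real^'p^'p) measure" where
  "wishart n \<Sigma> = distr (\<Pi>\<^sub>M k\<in>{..<n}. multi_normal 0 \<Sigma>) borel
     (\<lambda>z. \<Sum>k<n. \<chi> i j. z k $ i * z k $ j)"

text \<open>The joint law of the independent observations \<open>(X, S)\<close>.\<close>

definition model :: "nat \<Rightarrow> real^'p^'m \<Rightarrow> real^'p^'p \<Rightarrow> ((real^'p^'m) \<times> (real^'p^'p)) measure" where
  "model n \<Theta> \<Sigma> = matrix_normal \<Theta> \<Sigma> \<Otimes>\<^sub>M wishart n \<Sigma>"

type_synonym ('p, 'm) estimator = "(real^'p^'m) \<times> (real^'p^'p) \<Rightarrow> real^'p^'m"

type_synonym ('p, 'm, 'r) loss = "real^'p^'m \<Rightarrow> real^'p^'m \<Rightarrow> real^'p^'p \<Rightarrow> 'r"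

definition matrix_loss :: "('p::finite, 'm::finite, real^'m^'m) loss" where
  "matrix_loss T \<Theta> \<Sigma> = (T - \<Theta>) ** matrix_inv \<Sigma> ** transpose (T - \<Theta>)"

definition scalar_loss :: "('p::finite, 'm::finite, real) loss" where
  "scalar_loss T \<Theta> \<Sigma> = trace ((T - \<Theta>) ** matrix_inv \<Sigma> ** transpose (T - \<Theta>))"

definition risk :: "('p::finite, 'm::finite, 'r::{banach, second_countable_topology}) loss \<Rightarrow> nat \<Rightarrow>
    ('p, 'm) estimator \<Rightarrow> real^'p^'m \<Rightarrow> real^'p^'p \<Rightarrow> 'r" where
  "risk L n \<delta> \<Theta> \<Sigma> = (\<integral>\<omega>. L (\<delta> \<omega>) \<Theta> \<Sigma> \<partial>model n \<Theta> \<Sigma>)"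

text \<open>
  The Bochner integral is \<open>0\<close> for a function that is not integrable, so comparing risks is
  meaningful only between estimators whose risk exists; dominance below includes this.
\<close>

definition has_risk :: "('p::finite, 'm::finite, 'r::{banach, second_countable_topology}) loss \<Rightarrow> nat \<Rightarrow>
    ('p, 'm) estimator \<Rightarrow> bool" where
  "has_risk L n \<delta> \<longleftrightarrow>
     (\<forall>\<Theta> \<Sigma>. pos_def \<Sigma> \<longrightarrow> integrable (model n \<Theta> \<Sigma>) (\<lambda>\<omega>. L (\<delta> \<omega>) \<Theta> \<Sigma>))"

definition dominates_scalar :: "('p::finite, 'm::finite, real) loss \<Rightarrow> nat \<Rightarrow>
    ('p, 'm) estimator \<Rightarrow> ('p, 'm) estimator \<Rightarrow> bool" where
  "dominates_scalar L n \<delta>\<^sub>1 \<delta>\<^sub>2 \<longleftrightarrow> has_risk L n \<delta>\<^sub>1 \<and> has_risk L n \<delta>\<^sub>2 \<and>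
     (\<forall>\<Theta> \<Sigma>. pos_def \<Sigma> \<longrightarrow> risk L n \<delta>\<^sub>1 \<Theta> \<Sigma> \<le> risk L n \<delta>\<^sub>2 \<Theta> \<Sigma>) \<and>
     (\<exists>\<Theta> \<Sigma>. pos_def \<Sigma> \<and> risk L n \<delta>\<^sub>1 \<Theta> \<Sigma> < risk L n \<delta>\<^sub>2 \<Theta> \<Sigma>)"

definition dominates_matrix :: "('p::finite, 'm::finite, real^'m^'m) loss \<Rightarrow> nat \<Rightarrow>
    ('p, 'm) estimator \<Rightarrow> ('p, 'm) estimator \<Rightarrow> bool" where
  "dominates_matrix L n \<delta>\<^sub>1 \<delta>\<^sub>2 \<longleftrightarrow> has_risk L n \<delta>\<^sub>1 \<and> has_risk L n \<delta>\<^sub>2 \<and>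
     (\<forall>\<Theta> \<Sigma>. pos_def \<Sigma> \<longrightarrow> pos_semidef (risk L n \<delta>\<^sub>2 \<Theta> \<Sigma> - risk L n \<delta>\<^sub>1 \<Theta> \<Sigma>)) \<and>
     (\<exists>\<Theta> \<Sigma>. pos_def \<Sigma> \<and> risk L n \<delta>\<^sub>2 \<Theta> \<Sigma> - risk L n \<delta>\<^sub>1 \<Theta> \<Sigma> \<noteq> 0)"

definition est_X :: "('p::finite, 'm::finite) estimator" where
  "est_X = (\<lambda>(X, S). X)"

text \<open>
  The \<open>matrix_inv\<close> of a singular matrix is an unspecified constant.  For \<open>n \<ge> p\<close> the matrix \<open>S\<close>
  is almost surely positive definite, and then both inverses below are genuine.
\<close>

definition est_G :: "real \<Rightarrow> real \<Rightarrow> ('p::finite, 'm::finite) estimator" where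
  "est_G \<alpha> \<beta> = (\<lambda>(X, S).
     X - \<alpha> *\<^sub>R (X ** matrix_inv (mat 1 + \<beta> *\<^sub>R (matrix_inv S ** transpose X ** X))))"

end

theory Submission
  imports Defs
begin

text \<open>
  Write \<open>V = (S + \<beta> X\<^sup>T X)\<^sup>-\<^sup>1\<close>, \<open>U = X V X\<^sup>T\<close> and \<open>\<Psi> = I - \<beta> U\<close>.  Then the estimator is \<open>X - \<alpha> G\<close> with
  \<open>G = \<Psi> X = X V S\<close>, and with \<open>M = \<Sigma>\<^sup>-\<^sup>1\<close> the loss saved against \<open>X\<close> is
  \<open>\<alpha> (C + C\<^sup>T) - \<alpha>\<^sup>2 G M G\<^sup>T\<close>, where \<open>C = G M (X - \<Theta>)\<^sup>T\<close>.  The unknown \<open>\<Theta>\<close> and \<open>\<Sigma>\<close> are removed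
  from its expectation by Gaussian integration by parts (\<open>stein_multi_normal\<close>).  For \<open>C\<close> one
  differentiates in the rows of \<open>X\<close>.  For the quadratic term one writes one of the two factors as
  \<open>G = X V S\<close> with \<open>S\<close> the sum of the \<open>z\<^sub>k z\<^sub>k\<^sup>T\<close>, so that \<open>M z\<^sub>k\<close> appears, and differentiates in the normal
  vectors \<open>z\<^sub>k\<close>.  The two divergences (\<open>divergence_correction_X\<close>, \<open>divergence_Z\<close>) turn the expected saving into that of
  \<open>R = 2 \<alpha> ((p - m - 1 + tr \<Psi>) \<Psi> + \<Psi>\<^sup>2) - \<alpha>\<^sup>2 ((n - p + 2 m + 1 - 2 tr \<Psi>) T - 2 \<Psi> T)\<close>,
  where \<open>T = \<Psi> U\<close>, that is, \<open>\<beta> T = \<Psi> - \<Psi>\<^sup>2\<close>.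

  For \<open>p > m + 1\<close> the bound on \<open>\<alpha>\<close> says that the only negative term is at most
  \<open>2 \<alpha> (p - m - 1) \<beta> T\<close>, which is at most \<open>2 \<alpha> (p - m - 1) \<Psi>\<close>; what is left is positive definite, so \<open>R\<close> is
  positive definite at almost every observation (\<open>R_positive\<close>).  Taking
  traces gives the scalar statement in this case.  For \<open>m > p + 1\<close> the matrix \<open>R\<close> need not be
  positive, but \<open>\<Psi>\<close> has the eigenvalue \<open>1\<close> with multiplicity at least \<open>m - p\<close>; splitting it off by
  \<open>tr \<Psi> = m - p + tr (V S)\<close> yields for \<open>tr R\<close> an expression of the same form in \<open>V S\<close>, with \<open>m - p - 1\<close>
  in place of \<open>p - m - 1\<close> and \<open>n + p + 1\<close> in place of \<open>n - p + 2 m + 1\<close> (\<open>trace_R_positive\<close>).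

  The single partial derivatives are not obviously integrable, because \<open>V\<close> is unbounded.  Therefore
  \<open>V\<close> is replaced by \<open>(S + \<beta> X\<^sup>T X + e I)\<^sup>-\<^sup>1\<close> with \<open>e > 0\<close>.  All functions are
  then smooth with derivatives of polynomial growth, and the identities \<open>stein_X\<close> and \<open>stein_Z\<close> keep their form.  The
  quantities that occur in them, \<open>U\<close>, \<open>X V z\<^sub>k\<close> and \<open>tr (V S)\<close>, are bounded independently of \<open>e\<close>, so
  dominated convergence gives the identities at \<open>e = 0\<close> (\<open>stein_0\<close>); there \<open>S\<close> is invertible
  almost surely because \<open>n \<ge> p\<close> (\<open>AE_det_add_sum_outer\<close>).
\<close>

section \<open>Matrix algebra\<close>

text \<open>Products with a transpose are not to be turned into \<open>v*\<close>, so that the laws for \<open>transpose\<close> apply.\<close>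

declare transpose_matrix_vector [simp del]

lemma transpose_add: "transpose (A + B :: 'a::plus^'n^'m) = transpose A + transpose B"
  by (simp add: vec_eq_iff transpose_def)

lemma matrix_scaleR_left: "(k *\<^sub>R A) ** B = k *\<^sub>R (A ** (B :: real^'n^'m))"
  by (simp add: scalar_matrix_assoc)

lemma matrix_scaleR_right: "A ** (k *\<^sub>R B) = k *\<^sub>R (A ** (B :: real^'n^'m))"
  by (simp add: matrix_scalar_ac scalar_matrix_assoc)

lemma matrix_add_rdistrib: "(A + B) ** C = A ** C + B ** (C :: real^'n^'m)"
  by (simp add: vec_eq_iff matrix_matrix_mult_def ring_distribs sum.distrib)

lemma matrix_diff_ldistrib: "A ** (B - C) = A ** B - A ** (C :: real^'n^'m)"
  by (simp add: vec_eq_iff matrix_matrix_mult_def right_diff_distrib sum_subtractf)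

lemma matrix_diff_rdistrib: "(A - B) ** C = A ** C - B ** (C :: real^'n^'m)"
  by (simp add: vec_eq_iff matrix_matrix_mult_def left_diff_distrib sum_subtractf)

lemma matrix_minus_left: "(- A) ** B = - (A ** (B :: real^'n^'m))"
  by (simp add: vec_eq_iff matrix_matrix_mult_def sum_negf)

lemma matrix_minus_right: "A ** (- B) = - (A ** (B :: real^'n^'m))"
  by (simp add: vec_eq_iff matrix_matrix_mult_def sum_negf)

lemma transpose_diff: "transpose (A - B :: real^'n^'m) = transpose A - transpose B"
  by (simp add: vec_eq_iff transpose_def)

lemma transpose_scaleR: "transpose (k *\<^sub>R A :: real^'n^'m) = k *\<^sub>R transpose A"
  by (simp add: vec_eq_iff transpose_def)

lemma trace_scaleR: "trace (k *\<^sub>R A :: real^'n^'n) = k * trace A"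
  by (simp add: trace_def sum_distrib_left)

lemmas matrix_ring = matrix_add_ldistrib matrix_add_rdistrib matrix_diff_ldistrib matrix_diff_rdistrib
  matrix_scaleR_left matrix_scaleR_right matrix_minus_left matrix_minus_right

lemma matrix_vector_mul_axis: "(A :: real^'n^'m) *v axis k 1 = column k A"
  by (rule matrix_vector_mult_basis)

lemma diag_nth: "A $ i $ i = axis i 1 \<bullet> ((A :: real^'n^'n) *v axis i 1)"
  by (simp add: inner_axis' matrix_vector_mul_axis column_def)

lemma inner_transpose_mult: "x \<bullet> (transpose A *v y) = (A *v x) \<bullet> (y :: real^'n)"
  by (metis dot_lmul_matrix transpose_matrix_vector transpose_transpose)

lemma sum_matrix_vector_mult: "(\<Sum>k\<in>I. A k) *v v = (\<Sum>k\<in>I. A k *v (v :: real^'n))"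
  by (induction I rule: infinite_finite_induct) (auto simp: matrix_vector_mult_add_rdistrib)

lemma sum_matrix_mult_left: "A ** (\<Sum>k\<in>I. B k) = (\<Sum>k\<in>I. A ** (B k :: real^'n^'m))"
  by (induction I rule: infinite_finite_induct) (auto simp: matrix_add_ldistrib)

lemma sum_matrix_mult_right: "(\<Sum>k\<in>I. B k) ** A = (\<Sum>k\<in>I. B k ** (A :: real^'n^'m))"
  by (induction I rule: infinite_finite_induct) (auto simp: matrix_add_rdistrib)

lemma trace_sum: "trace (\<Sum>k\<in>I. B k :: real^'n^'n) = (\<Sum>k\<in>I. trace (B k))"
  by (induction I rule: infinite_finite_induct) (auto simp: trace_add trace_0[unfolded mat_0])

lemma transpose_sum: "transpose (\<Sum>k\<in>I. A k :: real^'n^'m) = (\<Sum>k\<in>I. transpose (A k))"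
  by (induction I rule: infinite_finite_induct) (auto simp: transpose_add, auto simp: transpose_def vec_eq_iff)

lemma bounded_linear_transpose: "bounded_linear (transpose :: real^'n^'m \<Rightarrow> real^'m^'n)"
  unfolding linear_conv_bounded_linear[symmetric]
  by (auto intro!: linearI simp: transpose_add transpose_scaleR)

lemma bounded_linear_trace: "bounded_linear (trace :: real^'n^'n \<Rightarrow> real)"
  unfolding linear_conv_bounded_linear[symmetric]
  by (auto intro!: linearI simp: trace_add trace_scaleR)

definition outer :: "real^'n \<Rightarrow> real^'m \<Rightarrow> real^'m^'n" where
  "outer x y = (\<chi> i j. x $ i * y $ j)"

lemma outer_nth [simp]: "outer x y $ i $ j = x $ i * y $ j"
  by (simp add: outer_def)

lemma outer_mult_vector: "outer x y *v v = (y \<bullet> v) *\<^sub>R x"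
  by (simp add: vec_eq_iff matrix_vector_mult_def inner_vec_def sum_distrib_left mult_ac)

lemma transpose_outer: "transpose (outer x y) = outer y x"
  by (simp add: vec_eq_iff transpose_def mult.commute)

lemma matrix_mul_outer: "A ** outer x y = outer (A *v x) y"
  by (simp add: vec_eq_iff matrix_matrix_mult_def matrix_vector_mult_def sum_distrib_left sum_distrib_right mult_ac)

lemma outer_mul_matrix: "outer x y ** A = outer x (transpose A *v y)"
  by (simp add: vec_eq_iff matrix_matrix_mult_def matrix_vector_mult_def transpose_def sum_distrib_left sum_distrib_right mult_ac)

section \<open>Positive definite matrices and matrix inverses\<close>

lemma matrix_inv_mult:
  fixes A :: "real^'n^'n"
  assumes "invertible A"
  shows "A ** matrix_inv A = mat 1" "matrix_inv A ** A = mat 1"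
proof -
  have "A ** matrix_inv A = mat 1 \<and> matrix_inv A ** A = mat 1"
    using assms unfolding invertible_def matrix_inv_def by (rule someI_ex)
  then show "A ** matrix_inv A = mat 1" "matrix_inv A ** A = mat 1" by auto
qed

lemma matrix_inv_unique:
  fixes A B :: "real^'n^'n"
  assumes "A ** B = mat 1"
  shows "matrix_inv A = B"
proof -
  have "invertible A"
    using assms by (auto simp: invertible_right_inverse)
  then have "matrix_inv A ** (A ** B) = B"
    by (simp add: matrix_mul_assoc matrix_inv_mult)
  then show ?thesis
    using assms by simp
qed

lemma transpose_matrix_inv:
  fixes A :: "real^'n^'n"
  assumes "invertible A" "transpose A = A"
  shows "transpose (matrix_inv A) = matrix_inv A"
proof -
  have "transpose (matrix_inv A ** A) = mat 1"
    using assms by (simp add: matrix_inv_mult transpose_mat)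
  then have "A ** transpose (matrix_inv A) = mat 1"
    using assms by (simp add: matrix_transpose_mul)
  then show ?thesis
    using matrix_inv_unique by metis
qed

lemma pos_def_invertible:
  assumes "pos_def A"
  shows "invertible A"
proof -
  have "x = 0" if "A *v x = 0" for x
    using assms that unfolding pos_def_def by (metis inner_zero_right less_irrefl)
  then show ?thesis
    by (simp add: invertible_left_inverse matrix_left_invertible_ker)
qed

lemma pos_def_matrix_inv:
  assumes "pos_def A"
  shows "pos_def (matrix_inv A)"
proof -
  note inv = pos_def_invertible[OF assms]
  have "0 < x \<bullet> (matrix_inv A *v x)" if "x \<noteq> 0" for x
  proof -
    define y where "y = matrix_inv A *v x"
    have x: "x = A *v y"
      by (simp add: y_def matrix_vector_mul_assoc matrix_inv_mult[OF inv])
    with that have "y \<noteq> 0" by auto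
    then have "0 < y \<bullet> (A *v y)"
      using assms by (auto simp: pos_def_def)
    then show ?thesis
      by (simp add: x[symmetric] y_def[symmetric] inner_commute)
  qed
  then show ?thesis
    using assms inv by (simp add: pos_def_def transpose_matrix_inv)
qed

lemma inner_matrix_symmetric:
  fixes A :: "real^'n^'n"
  assumes "transpose A = A"
  shows "x \<bullet> (A *v y) = y \<bullet> (A *v x)"
  using assms dot_lmul_matrix[of x A y] by (metis inner_commute transpose_matrix_vector)

text \<open>The unit sphere is compact, so the quadratic form attains a positive minimum on it.\<close>

lemma pos_def_coercive:
  assumes "pos_def (A :: real^'n^'n)"
  obtains c where "c > 0" "\<And>x. c * (norm x)\<^sup>2 \<le> x \<bullet> (A *v x)"
proof -
  have "continuous_on (sphere 0 1) (\<lambda>x. x \<bullet> (A *v x))"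
    by (intro continuous_on_inner continuous_on_id linear_continuous_on) simp
  moreover have "compact (sphere (0::real^'n) 1)" "sphere (0::real^'n) 1 \<noteq> {}"
    by auto
  ultimately obtain u where u: "norm u = 1" "\<And>x. norm x = 1 \<Longrightarrow> u \<bullet> (A *v u) \<le> x \<bullet> (A *v x)"
    using continuous_attains_inf[of "sphere (0::real^'n) 1" "\<lambda>x. x \<bullet> (A *v x)"] by (auto simp: dist_norm)
  show ?thesis
  proof (rule that)
    show "u \<bullet> (A *v u) > 0"
      using assms u(1) by (metis norm_zero pos_def_def zero_neq_one)
    show "u \<bullet> (A *v u) * (norm x)\<^sup>2 \<le> x \<bullet> (A *v x)" for x
    proof (cases "x = 0")
      case False
      define y where "y = (1 / norm x) *\<^sub>R x"
      have "norm y = 1" and x: "x = norm x *\<^sub>R y"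
        using False by (auto simp: y_def)
      from this(1) have "u \<bullet> (A *v u) * (norm x)\<^sup>2 \<le> (y \<bullet> (A *v y)) * (norm x)\<^sup>2"
        by (intro mult_right_mono u) auto
      also have "\<dots> = (norm x *\<^sub>R y) \<bullet> (A *v (norm x *\<^sub>R y))"
        by (simp add: matrix_vector_mult_scaleR power2_eq_square)
      also have "\<dots> = x \<bullet> (A *v x)"
        by (simp only: x[symmetric])
      finally show ?thesis .
    qed auto
  qed
qed

lemma pos_semidef_outer: "pos_semidef (outer z z)"
  by (simp add: pos_semidef_def transpose_outer outer_mult_vector inner_commute)

lemma pos_semidef_add: "pos_semidef A \<Longrightarrow> pos_semidef B \<Longrightarrow> pos_semidef (A + B)"
  by (auto simp: pos_semidef_def transpose_add matrix_vector_mult_add_rdistrib inner_add_right)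

text \<open>Moving from \<open>x\<close> a short way against \<open>A x\<close> changes the quadratic form to first order by
  a negative multiple of \<open>|A x|\<^sup>2\<close>, while its least value \<open>0\<close> is attained at \<open>x\<close>.\<close>

lemma pos_semidef_kernel:
  assumes A: "pos_semidef A" and "x \<bullet> (A *v x) = 0"
  shows "A *v x = 0"
proof -
  define y where "y = A *v x"
  define c where "c = y \<bullet> (A *v y)"
  have c: "c \<ge> 0" using A by (simp add: c_def pos_semidef_def)
  have sym: "transpose A = A" using A by (simp add: pos_semidef_def)
  have "0 \<le> (x - t *\<^sub>R y) \<bullet> (A *v (x - t *\<^sub>R y))" for t
    using A by (simp add: pos_semidef_def)
  moreover have "(x - t *\<^sub>R y) \<bullet> (A *v (x - t *\<^sub>R y)) = t * (t * c - 2 * (y \<bullet> y))" for t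
    using assms(2) inner_matrix_symmetric[OF sym, of x y]
    by (simp add: matrix_vector_mult_diff_distrib matrix_vector_mult_scaleR inner_diff_left inner_diff_right
        c_def y_def[symmetric] algebra_simps)
  ultimately have *: "0 \<le> t * (t * c - 2 * (y \<bullet> y))" for t by metis
  have "y \<bullet> y = 0"
  proof (rule ccontr)
    assume "y \<bullet> y \<noteq> 0"
    then have yy: "y \<bullet> y > 0" by (simp add: less_le)
    \<comment> \<open>This step is so short that the term linear in \<open>t\<close> outweighs the quadratic one.\<close>
    define t where "t = (y \<bullet> y) / (c + 1)"
    have "t > 0" using yy c by (simp add: t_def)
    moreover have "t * c \<le> y \<bullet> y"
      using yy c by (simp add: t_def field_simps)
    then have "t * c - 2 * (y \<bullet> y) < 0"
      using yy by linarith
    ultimately have "t * (t * c - 2 * (y \<bullet> y)) < 0"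
      by (rule mult_pos_neg)
    with *[of t] show False by simp
  qed
  then show ?thesis by (simp add: y_def)
qed

lemma pos_semidef_gram: "pos_semidef (transpose X ** X :: real^'n^'n)"
proof -
  have "x \<bullet> ((transpose X ** X) *v x) = (X *v x) \<bullet> (X *v x)" for x
    using dot_lmul_matrix[of x "transpose X" "X *v x"]
    by (simp add: matrix_vector_mul_assoc[symmetric])
  then show ?thesis
    by (simp add: pos_semidef_def matrix_transpose_mul)
qed

lemma pos_semidef_scaleR: "pos_semidef A \<Longrightarrow> 0 \<le> c \<Longrightarrow> pos_semidef (c *\<^sub>R A)"
  by (simp add: pos_semidef_def transpose_scaleR scaleR_matrix_vector_assoc[symmetric])

lemma pos_def_add_pos_semidef: "pos_def A \<Longrightarrow> pos_semidef B \<Longrightarrow> pos_def (A + B)"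
  by (auto simp: pos_def_def pos_semidef_def transpose_add matrix_vector_mult_add_rdistrib inner_add_right
      intro: add_pos_nonneg)

lemma pos_def_mat: "0 < e \<Longrightarrow> pos_def (e *\<^sub>R mat 1 :: real^'n^'n)"
  by (simp add: pos_def_def transpose_scaleR transpose_mat scaleR_matrix_vector_assoc[symmetric] inner_gt_zero_iff)

lemma pos_def_mat_1: "pos_def (mat 1 :: real^'n^'n)"
  using pos_def_mat[of 1] by simp

section \<open>Measurability and limits of matrix expressions\<close>

lemma measurable_vec_nth [measurable (raw)]:
  fixes f :: "'a \<Rightarrow> 'b::euclidean_space^'n"
  assumes "f \<in> borel_measurable M"
  shows "(\<lambda>x. f x $ i) \<in> borel_measurable M"
proof -
  have "(\<lambda>x::'b^'n. x $ i) \<in> borel_measurable borel"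
    by (intro borel_measurable_continuous_onI continuous_on_component continuous_on_id)
  from measurable_compose[OF assms this] show ?thesis .
qed

lemma measurable_vec_lambda [measurable (raw)]:
  fixes f :: "'a \<Rightarrow> 'i::finite \<Rightarrow> 'b::euclidean_space"
  assumes "\<And>i. (\<lambda>x. f x i) \<in> borel_measurable M"
  shows "(\<lambda>x. \<chi> i. f x i) \<in> borel_measurable M"
proof (rule borel_measurable_euclidean_space[THEN iffD2], intro ballI)
  fix b :: "'b^'i" assume "b \<in> Basis"
  then obtain i c where b: "b = axis i c" by (auto simp: Basis_vec_def)
  have "(\<lambda>x. f x i \<bullet> c) \<in> borel_measurable M"
    using assms by (intro borel_measurable_inner) auto
  then show "(\<lambda>x. (\<chi> i. f x i) \<bullet> b) \<in> borel_measurable M"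
    by (simp add: b inner_axis)
qed

lemma measurable_matrix_vector_mult [measurable (raw)]:
  fixes f :: "'a \<Rightarrow> real^'n^'m" and g :: "'a \<Rightarrow> real^'n"
  assumes [measurable]: "f \<in> borel_measurable M" "g \<in> borel_measurable M"
  shows "(\<lambda>x. f x *v g x) \<in> borel_measurable M"
  unfolding matrix_vector_mult_def by measurable

lemma measurable_matrix_mult [measurable (raw)]:
  fixes f :: "'a \<Rightarrow> real^'n^'m" and g :: "'a \<Rightarrow> real^'p^'n"
  assumes [measurable]: "f \<in> borel_measurable M" "g \<in> borel_measurable M"
  shows "(\<lambda>x. f x ** g x) \<in> borel_measurable M"
  unfolding matrix_matrix_mult_def by measurable

lemma measurable_transpose [measurable (raw)]:
  fixes f :: "'a \<Rightarrow> real^'n^'m"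
  assumes [measurable]: "f \<in> borel_measurable M"
  shows "(\<lambda>x. transpose (f x)) \<in> borel_measurable M"
  unfolding transpose_def by measurable

lemma measurable_trace [measurable (raw)]:
  fixes f :: "'a \<Rightarrow> real^'n^'n"
  assumes [measurable]: "f \<in> borel_measurable M"
  shows "(\<lambda>x. trace (f x)) \<in> borel_measurable M"
  unfolding trace_def by measurable

lemma measurable_det [measurable (raw)]:
  fixes f :: "'a \<Rightarrow> real^'n^'n"
  assumes [measurable]: "f \<in> borel_measurable M"
  shows "(\<lambda>x. det (f x)) \<in> borel_measurable M"
  unfolding det_def by measurable

lemma measurable_outer [measurable (raw)]:
  assumes [measurable]: "f \<in> borel_measurable M" "g \<in> borel_measurable M"
  shows "(\<lambda>x. outer (f x) (g x)) \<in> borel_measurable M"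
  unfolding outer_def by measurable

lemma bounded_bilinear_matrix_mult:
  "bounded_bilinear ((**) :: real^'n^'m \<Rightarrow> real^'p^'n \<Rightarrow> real^'p^'m)"
  unfolding bilinear_conv_bounded_bilinear[symmetric] bilinear_def
  by (auto intro!: linearI simp: matrix_ring)

lemma tendsto_matrix_mult [tendsto_intros]:
  fixes f :: "'a \<Rightarrow> real^'n^'m" and g :: "'a \<Rightarrow> real^'p^'n"
  shows "(f \<longlongrightarrow> A) F \<Longrightarrow> (g \<longlongrightarrow> B) F \<Longrightarrow> ((\<lambda>x. f x ** g x) \<longlongrightarrow> A ** B) F"
  by (rule bounded_bilinear.tendsto[OF bounded_bilinear_matrix_mult])

lemma tendsto_transpose [tendsto_intros]:
  fixes f :: "'a \<Rightarrow> real^'n^'k"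
  shows "(f \<longlongrightarrow> A) F \<Longrightarrow> ((\<lambda>x. transpose (f x)) \<longlongrightarrow> transpose A) F"
  unfolding transpose_def by (intro tendsto_intros)

lemma tendsto_trace [tendsto_intros]:
  fixes f :: "'a \<Rightarrow> real^'n^'n"
  shows "(f \<longlongrightarrow> A) F \<Longrightarrow> ((\<lambda>x. trace (f x)) \<longlongrightarrow> trace A) F"
  unfolding trace_def by (intro tendsto_intros)

lemma tendsto_det:
  fixes f :: "'a \<Rightarrow> real^'n^'n"
  assumes "(f \<longlongrightarrow> A) F"
  shows "((\<lambda>x. det (f x)) \<longlongrightarrow> det A) F"
  unfolding det_def by (intro tendsto_intros assms)

text \<open>Cramer's rule; it makes the inverse continuous and measurable.\<close>

lemma matrix_inv_nth:
  fixes A :: "real^'n^'n"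
  assumes "det A \<noteq> 0"
  shows "matrix_inv A $ i $ j = det (\<chi> k l. if l = i then axis j 1 $ k else A $ k $ l) / det A"
proof -
  have "A *v (matrix_inv A *v axis j 1) = axis j 1"
    using assms by (simp add: matrix_vector_mul_assoc matrix_inv_mult invertible_det_nz)
  then have "matrix_inv A *v axis j 1 = (\<chi> k. det (\<chi> i l. if l = k then axis j 1 $ i else A $ i $ l) / det A)"
    using cramer[OF assms] by blast
  then have "(matrix_inv A *v axis j 1) $ i = det (\<chi> k l. if l = i then axis j 1 $ k else A $ k $ l) / det A"
    by simp
  then show ?thesis
    by (simp add: matrix_vector_mul_axis column_def)
qed

lemma tendsto_matrix_inv:
  fixes f :: "'a \<Rightarrow> real^'n^'n"
  assumes f: "(f \<longlongrightarrow> A) F" and A: "invertible A"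
  shows "((\<lambda>x. matrix_inv (f x)) \<longlongrightarrow> matrix_inv A) F"
proof (intro vec_tendstoI)
  fix i j
  have d: "det A \<noteq> 0"
    using A by (simp add: invertible_det_nz)
  have "((\<lambda>x. det (\<chi> k l. if l = i then axis j 1 $ k else f x $ k $ l) / det (f x))
      \<longlongrightarrow> det (\<chi> k l. if l = i then axis j 1 $ k else A $ k $ l) / det A) F"
  proof (intro tendsto_divide tendsto_det tendsto_vec_lambda f d)
    show "((\<lambda>x. if l = i then axis j 1 $ k else f x $ k $ l) \<longlongrightarrow> (if l = i then axis j 1 $ k else A $ k $ l)) F" for k l
      using f by (auto intro!: tendsto_intros)
  qed
  then show "((\<lambda>x. matrix_inv (f x) $ i $ j) \<longlongrightarrow> matrix_inv A $ i $ j) F"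
    unfolding matrix_inv_nth[OF d]
  proof (rule Lim_transform_eventually)
    have "\<forall>\<^sub>F x in F. det (f x) \<noteq> 0"
      using tendsto_det[OF f] d by (rule tendsto_imp_eventually_ne)
    then show "\<forall>\<^sub>F x in F. det (\<chi> k l. if l = i then axis j 1 $ k else f x $ k $ l) / det (f x) = matrix_inv (f x) $ i $ j"
      by eventually_elim (simp add: matrix_inv_nth)
  qed
qed

lemma measurable_matrix_inv [measurable (raw)]:
  fixes f :: "'a \<Rightarrow> real^'n^'n"
  assumes [measurable]: "f \<in> borel_measurable M"
  shows "(\<lambda>x. matrix_inv (f x)) \<in> borel_measurable M"
proof -
  \<comment> \<open>All singular matrices have the same, unspecified, inverse.\<close>
  define N where "N = (SOME A :: real^'n^'n. False)"
  have "matrix_inv (f x) = (\<chi> i j. if det (f x) = 0 then N $ i $ j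
      else det (\<chi> k l. if l = i then axis j 1 $ k else f x $ k $ l) / det (f x))" for x
  proof (cases "det (f x) = 0")
    case True
    then have "\<not> invertible (f x)" by (simp add: invertible_det_nz)
    then have "matrix_inv (f x) = N"
      unfolding matrix_inv_def N_def invertible_def by (intro arg_cong[where f = Eps]) (auto simp: fun_eq_iff)
    with True show ?thesis by (simp add: vec_eq_iff)
  next
    case False
    then show ?thesis by (simp add: vec_eq_iff matrix_inv_nth)
  qed
  then show ?thesis by simp
qed

section \<open>Integration by parts for the normal law\<close>

lemma integrable_lborel_translate:
  fixes f :: "'a::euclidean_space \<Rightarrow> real"
  assumes "integrable lborel f"
  shows "integrable lborel (\<lambda>x. f (c + x))"
proof -
  have "integrable (distr lborel borel ((+) c)) f"
    using assms by (simp add: lborel_distr_plus)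
  then show ?thesis
    using assms by (subst (asm) integrable_distr_eq) auto
qed

lemma integral_lborel_translate:
  fixes f :: "'a::euclidean_space \<Rightarrow> real"
  assumes [measurable]: "f \<in> borel_measurable borel"
  shows "(\<integral>x. f (c + x) \<partial>lborel) = (\<integral>x. f x \<partial>lborel)"
proof -
  have "(\<integral>x. f x \<partial>distr lborel borel ((+) c)) = (\<integral>x. f (c + x) \<partial>lborel)"
    by (subst integral_distr) auto
  then show ?thesis
    by (simp add: lborel_distr_plus)
qed

text \<open>Lebesgue measure is invariant under the translation by \<open>e\<close>, so \<open>f (x + e) - f x\<close> has integral
  \<open>0\<close>.  This difference is the integral of \<open>f'\<close> over the segment from \<open>x\<close> to \<open>x + e\<close>, and by Fubini and
  translation invariance again its integral over \<open>x\<close> is that of \<open>f'\<close>.\<close>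

lemma integral_directional_derivative_eq_0:
  fixes f f' :: "'a::euclidean_space \<Rightarrow> real"
  assumes f: "integrable lborel f" and f': "integrable lborel f'"
    and deriv: "\<And>x. ((\<lambda>t. f (x + t *\<^sub>R e)) has_real_derivative f' x) (at 0)"
    and bdd: "\<And>x. \<exists>C. \<forall>s\<in>{0..1}. \<bar>f' (x + s *\<^sub>R e)\<bar> \<le> C"
  shows "(\<integral>x. f' x \<partial>lborel) = 0"
proof -
  have [measurable]: "f \<in> borel_measurable borel" "f' \<in> borel_measurable borel"
    using f f' by (auto dest: borel_measurable_integrable)
  \<comment> \<open>The law of the position on the segment.\<close>
  define U where "U = restrict_space lborel {0..1::real}"
  interpret U: finite_measure U
    by (rule finite_measureI) (auto simp: U_def space_restrict_space emeasure_restrict_space)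
  interpret P: pair_sigma_finite U "lborel :: 'a measure" ..
  have [measurable_cong]: "sets U = sets (restrict_space borel {0..1})"
    unfolding U_def by (intro sets_restrict_space_cong) simp
  have [measurable]: "(\<lambda>s. s) \<in> borel_measurable U"
    unfolding U_def by (intro measurable_restrict_space1) auto
  have UU: "measure U (space U) = 1"
    by (simp add: U_def space_restrict_space measure_restrict_space)
  have line: "((\<lambda>s. f (x + s *\<^sub>R e)) has_real_derivative f' (x + s *\<^sub>R e)) (at s within A)" for x s A
  proof -
    have "((\<lambda>t. f (x + s *\<^sub>R e + t *\<^sub>R e)) has_real_derivative f' (x + s *\<^sub>R e)) (at (s - s))"
      using deriv by simp
    then have "((\<lambda>r. f (x + s *\<^sub>R e + (r - s) *\<^sub>R e)) has_real_derivative f' (x + s *\<^sub>R e) * 1) (at s)"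
      by (rule DERIV_chain2) (auto intro!: derivative_eq_intros)
    then have "((\<lambda>r. f (x + r *\<^sub>R e)) has_real_derivative f' (x + s *\<^sub>R e)) (at s)"
      by (simp add: algebra_simps)
    then show ?thesis
      by (rule DERIV_subset) simp
  qed
  have FTC: "(\<integral>s. f' (x + s *\<^sub>R e) \<partial>U) = f (x + e) - f x" for x
  proof -
    obtain C where C: "\<And>s. s \<in> {0..1} \<Longrightarrow> \<bar>f' (x + s *\<^sub>R e)\<bar> \<le> C"
      using bdd by blast
    have si: "set_integrable lborel {0..1} (\<lambda>s. f' (x + s *\<^sub>R e))"
    proof -
      have "integrable U (\<lambda>s. f' (x + s *\<^sub>R e))"
        by (rule U.integrable_const_bound[where B = C])
          (auto simp: U_def AE_restrict_space_iff space_restrict_space intro!: C measurable_restrict_space1)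
      then show ?thesis
        unfolding U_def set_integrable_def
        by (simp add: integrable_restrict_space)
    qed
    have "((\<lambda>s. f' (x + s *\<^sub>R e)) has_integral f (x + 1 *\<^sub>R e) - f (x + 0 *\<^sub>R e)) {0..1}"
      using line
      by (intro fundamental_theorem_of_calculus) (auto simp: has_real_derivative_iff_has_vector_derivative[symmetric])
    then have "(LINT s:{0..1}|lborel. f' (x + s *\<^sub>R e)) = f (x + e) - f x"
      using set_borel_integral_eq_integral(2)[OF si] integral_unique by force
    then show ?thesis
      unfolding U_def set_lebesgue_integral_def
      by (subst integral_restrict_space) auto
  qed
  have meas: "(\<lambda>(s, x). f' (x + s *\<^sub>R e)) \<in> borel_measurable (U \<Otimes>\<^sub>M lborel)"
    by measurable
  have trans: "(\<integral>x. f' (x + s *\<^sub>R e) \<partial>lborel) = (\<integral>x. f' x \<partial>lborel)" for s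
    using integral_lborel_translate[of f' "s *\<^sub>R e"] by (simp add: add.commute)
  have transn: "(\<integral>x. norm (f' (x + s *\<^sub>R e)) \<partial>lborel) = (\<integral>x. norm (f' x) \<partial>lborel)" for s
    using integral_lborel_translate[of "\<lambda>x. norm (f' x)" "s *\<^sub>R e"] by (simp add: add.commute)
  have transi: "integrable lborel (\<lambda>x. f' (x + s *\<^sub>R e))" for s
    using integrable_lborel_translate[OF f', of "s *\<^sub>R e"] by (simp add: add.commute)
  have int: "integrable (U \<Otimes>\<^sub>M lborel) (\<lambda>(s, x). f' (x + s *\<^sub>R e))"
    by (rule P.Fubini_integrable[OF meas]) (use transn transi in auto)
  have "(\<integral>x. f' x \<partial>lborel) = (\<integral>s. \<integral>x. f' (x + s *\<^sub>R e) \<partial>lborel \<partial>U)"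
    by (simp add: trans UU)
  also have "\<dots> = (\<integral>x. \<integral>s. f' (x + s *\<^sub>R e) \<partial>U \<partial>lborel)"
    using P.Fubini_integral[OF int] by simp
  also have "\<dots> = (\<integral>x. f (x + e) - f x \<partial>lborel)"
    by (simp add: FTC)
  also have "\<dots> = 0"
    using integrable_lborel_translate[OF f, of e] integral_lborel_translate[of f e] f
    by (simp add: add.commute)
  finally show ?thesis .
qed

lemma integrable_exp_neg_norm_sq:
  assumes "c > 0"
  shows "integrable lborel (\<lambda>x::'a::euclidean_space. exp (- c * (norm x)\<^sup>2))"
proof -
  define s where "s = 1 / sqrt (2 * c)"
  have s: "s > 0" "1 / (2 * s\<^sup>2) = c"
    using assms by (auto simp: s_def power_divide)
  have "integrable lborel (\<lambda>x. sqrt (2 * pi * s\<^sup>2) * normal_density 0 s x)"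
    using s by (intro integrable_mult_right) (auto intro: integrable_normal_density)
  moreover have "sqrt (2 * pi * s\<^sup>2) * normal_density 0 s x = exp (- c * x\<^sup>2)" for x
  proof -
    have "c * x\<^sup>2 = x\<^sup>2 / (2 * s\<^sup>2)"
      unfolding s(2)[symmetric] by simp
    moreover have "sqrt (2 * pi * s\<^sup>2) > 0"
      using s by simp
    ultimately show ?thesis
      using s by (auto simp: normal_density_def)
  qed
  ultimately have one: "integrable lborel (\<lambda>x::real. exp (- c * x\<^sup>2))"
    by simp
  have prod: "exp (- c * (norm x)\<^sup>2) = (\<Prod>b\<in>Basis. exp (- c * (x \<bullet> b)\<^sup>2))" for x :: 'a
  proof -
    have "- c * (norm x)\<^sup>2 = (\<Sum>b\<in>Basis. - c * (x \<bullet> b)\<^sup>2)"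
      unfolding power2_norm_eq_inner euclidean_inner[of x x] by (simp only: sum_distrib_left power2_eq_square)
    then show ?thesis
      by (simp only: exp_sum[OF finite_Basis])
  qed
  have "(\<integral>\<^sup>+x. ennreal (exp (- c * (norm (x :: 'a))\<^sup>2)) \<partial>lborel)
      = (\<integral>\<^sup>+x. (\<Prod>b\<in>Basis. ennreal (exp (- c * ((x :: 'a) \<bullet> b)\<^sup>2))) \<partial>lborel)"
    by (simp only: prod) (simp add: prod_ennreal)
  also have "\<dots> = (\<Prod>b\<in>(Basis::'a set). (\<integral>\<^sup>+x. ennreal (exp (- c * x\<^sup>2)) \<partial>lborel))"
    by (rule nn_integral_lborel_prod) auto
  also have "\<dots> < \<infinity>"
    using one by (simp add: integrable_iff_bounded power_less_top_ennreal)
  finally show ?thesis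
    by (simp add: integrable_iff_bounded)
qed

text \<open>From \<open>1 + t \<le> exp t\<close>, and completing the square in the exponent.\<close>

lemma power_le_exp_sq:
  fixes c t :: real
  assumes "c > 0" "t \<ge> 0"
  shows "(1 + t) ^ K \<le> exp ((real K)\<^sup>2 / (2 * c)) * exp (c / 2 * t\<^sup>2)"
proof -
  have "(1 + t) ^ K \<le> exp t ^ K"
    using assms by (intro power_mono) auto
  also have "exp t ^ K = exp (real K * t)"
    by (simp add: exp_of_nat_mult)
  also have "real K * t \<le> (real K)\<^sup>2 / (2 * c) + c / 2 * t\<^sup>2"
  proof -
    have "(real K)\<^sup>2 / (2 * c) + c / 2 * t\<^sup>2 - real K * t = (c * t - real K)\<^sup>2 / (2 * c)"
      using assms by (simp add: field_simps power2_eq_square)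
    also have "\<dots> \<ge> 0"
      using assms by simp
    finally show ?thesis by simp
  qed
  then have "exp (real K * t) \<le> exp ((real K)\<^sup>2 / (2 * c) + c / 2 * t\<^sup>2)"
    by simp
  finally show ?thesis
    by (simp add: exp_add)
qed

lemma integrable_power_exp:
  assumes "c > 0"
  shows "integrable lborel (\<lambda>x::'a::euclidean_space. (1 + norm x) ^ K * exp (- c * (norm x)\<^sup>2))"
proof (rule Bochner_Integration.integrable_bound)
  show "integrable lborel (\<lambda>x::'a. exp ((real K)\<^sup>2 / (2 * c)) * exp (- (c/2) * (norm x)\<^sup>2))"
    using assms by (intro integrable_mult_right integrable_exp_neg_norm_sq) auto
  show "AE x in lborel. norm ((1 + norm (x::'a)) ^ K * exp (- c * (norm x)\<^sup>2))
      \<le> norm (exp ((real K)\<^sup>2 / (2 * c)) * exp (- (c/2) * (norm x)\<^sup>2))"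
  proof (intro AE_I2)
    fix x :: 'a
    have "(1 + norm x) ^ K * exp (- c * (norm x)\<^sup>2)
        \<le> exp ((real K)\<^sup>2 / (2 * c)) * exp (c / 2 * (norm x)\<^sup>2) * exp (- c * (norm x)\<^sup>2)"
      using power_le_exp_sq[OF assms, of "norm x" K] by (intro mult_right_mono) auto
    also have "\<dots> = exp ((real K)\<^sup>2 / (2 * c)) * exp (- (c/2) * (norm x)\<^sup>2)"
      by (simp add: mult.assoc exp_add[symmetric] algebra_simps)
    finally show "norm ((1 + norm x) ^ K * exp (- c * (norm x)\<^sup>2))
      \<le> norm (exp ((real K)\<^sup>2 / (2 * c)) * exp (- (c/2) * (norm x)\<^sup>2))"
      by (simp add: abs_mult power_abs)
  qed
qed auto

text \<open>The constant is cut off at \<open>0\<close> because \<open>ennreal\<close> cuts off the density in \<open>multi_normal\<close>.\<close>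

definition gaussian_kernel :: "real^'p \<Rightarrow> real^'p^'p \<Rightarrow> real^'p \<Rightarrow> real" where
  "gaussian_kernel \<mu> \<Sigma> x = max 0 (1 / sqrt ((2 * pi) ^ CARD('p) * det \<Sigma>))
     * exp (- ((x - \<mu>) \<bullet> (matrix_inv \<Sigma> *v (x - \<mu>))) / 2)"

lemma gaussian_kernel_nonneg [simp]: "0 \<le> gaussian_kernel \<mu> \<Sigma> x"
  by (simp add: gaussian_kernel_def)

lemma multi_normal_eq: "multi_normal \<mu> \<Sigma> = density lborel (\<lambda>x. ennreal (gaussian_kernel \<mu> \<Sigma> x))"
proof -
  have "ennreal (a / b) = ennreal (max 0 (1 / b) * a)" if "a > 0" for a b :: real
    using that by (cases "b > 0") (auto simp: max_def ennreal_neg divide_le_0_iff zero_less_divide_iff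
      intro!: arg_cong[where f = ennreal])
  then show ?thesis
    unfolding multi_normal_def gaussian_kernel_def by simp
qed

lemma gaussian_kernel_measurable [measurable]: "gaussian_kernel \<mu> \<Sigma> \<in> borel_measurable borel"
  unfolding gaussian_kernel_def[abs_def] by measurable

lemma sets_multi_normal [simp, measurable_cong]: "sets (multi_normal \<mu> \<Sigma>) = sets borel"
  and space_multi_normal [simp]: "space (multi_normal \<mu> \<Sigma>) = UNIV"
  by (simp_all add: multi_normal_def)

lemma integrable_gaussian_kernel_power:
  assumes "pos_def (\<Sigma> :: real^'p^'p)"
  shows "integrable lborel (\<lambda>x. gaussian_kernel \<mu> \<Sigma> x * (1 + norm x) ^ K)"
proof -
  obtain c where c: "c > 0" "\<And>x. c * (norm x)\<^sup>2 \<le> x \<bullet> (matrix_inv \<Sigma> *v x)"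
    using pos_def_coercive[OF pos_def_matrix_inv[OF assms]] by blast
  define k where "k = max 0 (1 / sqrt ((2 * pi) ^ CARD('p) * det \<Sigma>))"
  have "integrable lborel (\<lambda>x. (k * (1 + norm \<mu>) ^ K) * ((1 + norm (- \<mu> + x)) ^ K * exp (- (c/2) * (norm (- \<mu> + x))\<^sup>2)))"
    using c(1) by (intro integrable_mult_right integrable_lborel_translate[of "\<lambda>x. (1 + norm x) ^ K * exp (- (c/2) * (norm x)\<^sup>2)"]
       integrable_power_exp) auto
  then show ?thesis
  proof (rule Bochner_Integration.integrable_bound)
    show "AE x in lborel. norm (gaussian_kernel \<mu> \<Sigma> x * (1 + norm x) ^ K)
      \<le> norm ((k * (1 + norm \<mu>) ^ K) * ((1 + norm (- \<mu> + x)) ^ K * exp (- (c/2) * (norm (- \<mu> + x))\<^sup>2)))"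
    proof (intro AE_I2)
      fix x :: "real^'p"
      have "norm x \<le> norm \<mu> + norm (x - \<mu>)"
        using norm_triangle_ineq[of \<mu> "x - \<mu>"] by simp
      then have "1 + norm x \<le> (1 + norm \<mu>) * (1 + norm (x - \<mu>))"
        using mult_nonneg_nonneg[OF norm_ge_zero[of \<mu>] norm_ge_zero[of "x - \<mu>"]]
        by (simp only: ring_distribs mult_1_left mult_1_right)
      then have 1: "(1 + norm x) ^ K \<le> (1 + norm \<mu>) ^ K * (1 + norm (x - \<mu>)) ^ K"
        unfolding power_mult_distrib[symmetric] by (intro power_mono) auto
      have 2: "exp (- ((x - \<mu>) \<bullet> (matrix_inv \<Sigma> *v (x - \<mu>))) / 2) \<le> exp (- (c/2) * (norm (x - \<mu>))\<^sup>2)"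
        using c(2)[of "x - \<mu>"] by simp
      have "gaussian_kernel \<mu> \<Sigma> x * (1 + norm x) ^ K
         \<le> k * exp (- (c/2) * (norm (x - \<mu>))\<^sup>2) * ((1 + norm \<mu>) ^ K * (1 + norm (x - \<mu>)) ^ K)"
        unfolding gaussian_kernel_def k_def[symmetric]
        by (intro mult_mono 1 2 mult_left_mono) (auto simp: k_def)
      then show "norm (gaussian_kernel \<mu> \<Sigma> x * (1 + norm x) ^ K)
        \<le> norm ((k * (1 + norm \<mu>) ^ K) * ((1 + norm (- \<mu> + x)) ^ K * exp (- (c/2) * (norm (- \<mu> + x))\<^sup>2)))"
        by (simp add: abs_mult power_abs k_def mult_ac)
    qed
  qed measurable
qed

lemma integrable_multi_normal_power:
  assumes "pos_def (\<Sigma> :: real^'p^'p)"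
  shows "integrable (multi_normal \<mu> \<Sigma>) (\<lambda>x. (1 + norm x) ^ K)"
  unfolding multi_normal_eq
  by (subst integrable_density) (auto intro: integrable_gaussian_kernel_power[OF assms])

lemma finite_measure_multi_normal:
  assumes "pos_def (\<Sigma> :: real^'p^'p)"
  shows "finite_measure (multi_normal \<mu> \<Sigma>)"
proof
  have "integrable (multi_normal \<mu> \<Sigma>) (\<lambda>x. 1 :: real)"
    using integrable_multi_normal_power[OF assms, of \<mu> 0] by simp
  then show "emeasure (multi_normal \<mu> \<Sigma>) (space (multi_normal \<mu> \<Sigma>)) \<noteq> \<infinity>"
    by (subst (asm) integrable_iff_bounded) (simp add: less_top)
qed

lemma gaussian_kernel_derivative:
  assumes "pos_def (\<Sigma> :: real^'p^'p)"
  shows "((\<lambda>t. gaussian_kernel \<mu> \<Sigma> (z + t *\<^sub>R axis a 1)) has_real_derivative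
     - (matrix_inv \<Sigma> *v (z - \<mu>)) $ a * gaussian_kernel \<mu> \<Sigma> z) (at 0)"
proof -
  define M where "M = matrix_inv \<Sigma>"
  define e where "e = (axis a 1 :: real^'p)"
  have sym: "transpose M = M"
    using pos_def_matrix_inv[OF assms] by (simp add: pos_def_def M_def)
  have q: "(z + t *\<^sub>R e - \<mu>) \<bullet> (M *v (z + t *\<^sub>R e - \<mu>))
      = (z - \<mu>) \<bullet> (M *v (z - \<mu>)) + 2 * t * (M *v (z - \<mu>)) $ a + t\<^sup>2 * (e \<bullet> (M *v e))" for t
  proof -
    have "z + t *\<^sub>R e - \<mu> = (z - \<mu>) + t *\<^sub>R e" by simp
    moreover have "(z - \<mu>) \<bullet> (M *v e) = (M *v (z - \<mu>)) $ a"
      by (subst inner_matrix_symmetric[OF sym]) (simp add: e_def inner_axis')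
    moreover have "e \<bullet> (M *v (z - \<mu>)) = (M *v (z - \<mu>)) $ a"
      by (simp add: e_def inner_axis')
    ultimately show ?thesis
      by (simp only: matrix_vector_right_distrib matrix_vector_mult_scaleR inner_add_left inner_add_right
          inner_scaleR_left inner_scaleR_right)
        (simp add: power2_eq_square algebra_simps)
  qed
  show ?thesis
    unfolding gaussian_kernel_def M_def[symmetric] e_def[symmetric] q
    by (auto intro!: derivative_eq_intros)
qed

lemma norm_matrix_vector_bound:
  fixes A :: "real^'n^'m"
  obtains B where "B \<ge> 0" "\<And>x. norm (A *v x) \<le> B * norm x"
proof -
  have "bounded_linear ((*v) A)" by simp
  then show ?thesis
    using bounded_linear.nonneg_bounded[of "(*v) A"] that by (auto simp: mult.commute)
qed

text \<open>Integration by parts against the Gaussian density \<open>g\<close>: its derivative in direction \<open>a\<close> is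
  \<open>- (\<Sigma>\<^sup>-\<^sup>1 (z - \<mu>))\<^sub>a g z\<close>, and the integral of the derivative of \<open>u g\<close> vanishes.\<close>

lemma stein_multi_normal:
  fixes u u' :: "real^'p \<Rightarrow> real"
  assumes pd: "pos_def (\<Sigma> :: real^'p^'p)"
    and [measurable]: "u \<in> borel_measurable borel" "u' \<in> borel_measurable borel"
    and deriv: "\<And>z. ((\<lambda>t. u (z + t *\<^sub>R axis a 1)) has_real_derivative u' z) (at 0)"
    and bu: "\<And>z. \<bar>u z\<bar> \<le> C * (1 + norm z) ^ K" and bu': "\<And>z. \<bar>u' z\<bar> \<le> C * (1 + norm z) ^ K"
  shows "(\<integral>z. (matrix_inv \<Sigma> *v (z - \<mu>)) $ a * u z \<partial>multi_normal \<mu> \<Sigma>) = (\<integral>z. u' z \<partial>multi_normal \<mu> \<Sigma>)"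
proof -
  define M where "M = matrix_inv \<Sigma>"
  let ?g = "gaussian_kernel \<mu> \<Sigma>"
  let ?s = "\<lambda>z. (M *v (z - \<mu>)) $ a"
  obtain B where B: "B \<ge> 0" "\<And>x. norm (M *v x) \<le> B * norm x"
    using norm_matrix_vector_bound by blast
  have C: "C \<ge> 0"
    using bu[of 0] by simp
  have bs: "\<bar>?s z\<bar> \<le> B * (1 + norm \<mu>) * (1 + norm z)" for z
  proof -
    have "\<bar>?s z\<bar> \<le> norm (M *v (z - \<mu>))"
      by (rule component_le_norm_cart)
    also have "\<dots> \<le> B * norm (z - \<mu>)" by (rule B)
    also have "norm (z - \<mu>) \<le> norm z + norm \<mu>" by (rule norm_triangle_ineq4)
    also have "\<dots> \<le> (1 + norm \<mu>) * (1 + norm z)"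
      using mult_nonneg_nonneg[of "norm \<mu>" "norm z"] by (simp add: algebra_simps)
    finally show ?thesis
      using B(1) by (simp add: mult.assoc mult_left_mono)
  qed
  have i: "integrable lborel (\<lambda>z. ?g z * f z)"
    if [measurable]: "f \<in> borel_measurable borel" and "\<And>z. \<bar>f z\<bar> \<le> D * (1 + norm z) ^ L" for f :: "real^'p \<Rightarrow> real" and D L
  proof (rule Bochner_Integration.integrable_bound)
    show "integrable lborel (\<lambda>z. D * (?g z * (1 + norm z) ^ L))"
      by (intro integrable_mult_right integrable_gaussian_kernel_power[OF pd])
    have "D \<ge> 0" using that(2)[of 0] by simp
    then show "AE z in lborel. norm (?g z * f z) \<le> norm (D * (?g z * (1 + norm z) ^ L))"
      using mult_left_mono[OF that(2) gaussian_kernel_nonneg[of \<mu> \<Sigma>]]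
      by (intro AE_I2) (simp add: abs_mult power_abs mult_ac)
  qed auto
  have b2: "\<bar>?s z * u z\<bar> \<le> (B * (1 + norm \<mu>) * C) * (1 + norm z) ^ Suc K" for z
  proof -
    have "\<bar>?s z\<bar> * \<bar>u z\<bar> \<le> (B * (1 + norm \<mu>) * (1 + norm z)) * (C * (1 + norm z) ^ K)"
      by (intro mult_mono bs bu) (use B(1) in auto)
    then show ?thesis
      by (simp add: abs_mult mult_ac)
  qed
  have iu: "integrable lborel (\<lambda>z. ?g z * u z)"
    by (rule i[OF _ bu]) simp
  have iu': "integrable lborel (\<lambda>z. ?g z * u' z)"
    by (rule i[OF _ bu']) simp
  have isu: "integrable lborel (\<lambda>z. ?g z * (?s z * u z))"
    by (rule i[OF _ b2]) simp
  have "(\<integral>z. ?g z * u' z - ?g z * (?s z * u z) \<partial>lborel) = 0"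
  proof (rule integral_directional_derivative_eq_0[OF iu, where e = "axis a 1"])
    show "integrable lborel (\<lambda>z. ?g z * u' z - ?g z * (?s z * u z))"
      using iu' isu by simp
    show "((\<lambda>t. ?g (x + t *\<^sub>R axis a 1) * u (x + t *\<^sub>R axis a 1)) has_real_derivative
        ?g x * u' x - ?g x * (?s x * u x)) (at 0)" for x
      using DERIV_mult[OF gaussian_kernel_derivative[OF pd, of \<mu> x a] deriv[of x]]
      by (simp add: M_def algebra_simps)
    fix x
    have "bounded ((\<lambda>s. x + s *\<^sub>R axis a 1 :: real^'p) ` {0..1})"
      by (intro compact_imp_bounded compact_continuous_image continuous_intros) auto
    then obtain R where R: "\<And>s. s \<in> {0..1} \<Longrightarrow> norm (x + s *\<^sub>R axis a 1) \<le> R"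
      by (metis (no_types, lifting) bounded_iff imageI)
    define k where "k = max 0 (1 / sqrt ((2 * pi) ^ CARD('p) * det \<Sigma>))"
    have g: "?g z \<le> k" for z
    proof -
      obtain c where c: "c > 0" "\<And>x. c * (norm x)\<^sup>2 \<le> x \<bullet> (M *v x)"
        using pos_def_coercive[OF pos_def_matrix_inv[OF pd]] unfolding M_def by blast
      have "0 \<le> (z - \<mu>) \<bullet> (M *v (z - \<mu>))"
        using c(2)[of "z - \<mu>"] c(1) by (meson less_imp_le mult_nonneg_nonneg order_trans zero_le_power2)
      then show ?thesis
        unfolding gaussian_kernel_def k_def[symmetric] M_def[symmetric]
        by (intro mult_left_le) (auto simp: k_def)
    qed
    have "\<bar>?g z * u' z - ?g z * (?s z * u z)\<bar> \<le> k * (C * (1 + R) ^ K + (B * (1 + norm \<mu>) * C) * (1 + R) ^ Suc K)"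
      if "norm z \<le> R" for z
    proof -
      have "\<bar>?g z * u' z - ?g z * (?s z * u z)\<bar> = ?g z * \<bar>u' z - ?s z * u z\<bar>"
        by (simp add: abs_mult flip: right_diff_distrib)
      also have "\<dots> \<le> k * (\<bar>u' z\<bar> + \<bar>?s z * u z\<bar>)"
        by (intro mult_mono g) (auto simp: k_def)
      also have "\<dots> \<le> k * (C * (1 + norm z) ^ K + (B * (1 + norm \<mu>) * C) * (1 + norm z) ^ Suc K)"
        by (intro mult_left_mono add_mono bu' b2) (auto simp: k_def)
      also have "\<dots> \<le> k * (C * (1 + R) ^ K + (B * (1 + norm \<mu>) * C) * (1 + R) ^ Suc K)"
        using that B(1) C by (intro mult_left_mono add_mono power_mono) (auto simp: k_def)
      finally show ?thesis .
    qed
    then show "\<exists>D. \<forall>s\<in>{0..1}. \<bar>?g (x + s *\<^sub>R axis a 1) * u' (x + s *\<^sub>R axis a 1)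
        - ?g (x + s *\<^sub>R axis a 1) * (?s (x + s *\<^sub>R axis a 1) * u (x + s *\<^sub>R axis a 1))\<bar> \<le> D"
      using R by blast
  qed
  then show ?thesis
    using iu' isu unfolding multi_normal_eq M_def
    by (subst (1 2) integral_density) auto
qed

section \<open>Products of normal laws\<close>

text \<open>A product over the coordinates, so that its powers are integrated factor by factor.\<close>

definition growth :: "'i set \<Rightarrow> ('i \<Rightarrow> 'a::real_normed_vector) \<Rightarrow> real" where
  "growth I r = (\<Prod>i\<in>I. 1 + norm (r i))"

lemma growth_ge_1: "growth I r \<ge> 1"
  unfolding growth_def by (intro prod_ge_1) auto

lemma norm_le_growth:
  assumes "finite I" "i \<in> I"
  shows "norm (r i) \<le> growth I r"
proof -
  have "growth I r = (1 + norm (r i)) * growth (I - {i}) r"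
    unfolding growth_def using assms by (rule prod.remove)
  moreover have "(1 + norm (r i)) * 1 \<le> (1 + norm (r i)) * growth (I - {i}) r"
    by (intro mult_left_mono growth_ge_1) auto
  ultimately show ?thesis by simp
qed

lemma product_sigma_finite_multi_normal:
  assumes "pos_def \<Sigma>"
  shows "product_sigma_finite (\<lambda>i. multi_normal (\<mu> i) \<Sigma>)"
  using finite_measure_multi_normal[OF assms]
  by (simp add: product_sigma_finite_def finite_measure.axioms(1))

lemma integrable_PiM_multi_normal_growth:
  assumes "pos_def (\<Sigma> :: real^'p^'p)" "finite I"
  shows "integrable (\<Pi>\<^sub>M i\<in>I. multi_normal (\<mu> i) \<Sigma>) (\<lambda>r. growth I r ^ K)"
proof -
  interpret product_sigma_finite "\<lambda>i. multi_normal (\<mu> i) \<Sigma>"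
    by (rule product_sigma_finite_multi_normal[OF assms(1)])
  show ?thesis
    unfolding growth_def prod_power_distrib
    using assms by (intro product_integrable_prod integrable_multi_normal_power) auto
qed

lemma sets_PiM_multi_normal [measurable_cong]:
  "sets (\<Pi>\<^sub>M i\<in>I. multi_normal (\<mu> i) \<Sigma>) = sets (\<Pi>\<^sub>M i\<in>I. borel)"
  by (intro sets_PiM_cong) auto

lemma space_PiM_multi_normal:
  "space (\<Pi>\<^sub>M i\<in>I. multi_normal (\<mu> i) \<Sigma>) = space (\<Pi>\<^sub>M i\<in>I. borel)"
  by (intro sets_eq_imp_space_eq sets_PiM_multi_normal)

text \<open>The coordinate \<open>i\<close> is split off and the identity for one normal vector is applied for fixed other coordinates.\<close>

lemma stein_PiM_multi_normal:
  fixes u u' :: "('i \<Rightarrow> real^'p) \<Rightarrow> real"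
  assumes pd: "pos_def (\<Sigma> :: real^'p^'p)" and I: "finite I" "i \<in> I"
    and u[measurable]: "u \<in> borel_measurable (\<Pi>\<^sub>M i\<in>I. borel)"
    and u'[measurable]: "u' \<in> borel_measurable (\<Pi>\<^sub>M i\<in>I. borel)"
    and deriv: "\<And>r. ((\<lambda>t. u (r(i := r i + t *\<^sub>R axis a 1))) has_real_derivative u' r) (at 0)"
    and bu: "\<And>r. \<bar>u r\<bar> \<le> C * growth I r ^ K" and bu': "\<And>r. \<bar>u' r\<bar> \<le> C * growth I r ^ K"
  shows "(\<integral>r. (matrix_inv \<Sigma> *v (r i - \<mu> i)) $ a * u r \<partial>(\<Pi>\<^sub>M i\<in>I. multi_normal (\<mu> i) \<Sigma>))
    = (\<integral>r. u' r \<partial>(\<Pi>\<^sub>M i\<in>I. multi_normal (\<mu> i) \<Sigma>))"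
proof -
  interpret product_sigma_finite "\<lambda>i. multi_normal (\<mu> i) \<Sigma>"
    by (rule product_sigma_finite_multi_normal[OF pd])
  let ?P = "\<lambda>I. \<Pi>\<^sub>M i\<in>I. multi_normal (\<mu> i) \<Sigma>"
  define J where "J = I - {i}"
  have IJ: "I = insert i J" "finite J" "i \<notin> J"
    using I by (auto simp: J_def)
  have [measurable]: "(\<lambda>r. r i) \<in> borel_measurable (\<Pi>\<^sub>M i\<in>I. (borel :: (real^'p) measure))"
    using I by measurable
  have C: "C \<ge> 0"
    using order_trans[OF abs_ge_zero bu[of "\<lambda>_. 0"]] by (simp add: growth_def)
  obtain B where B: "B \<ge> 0" "\<And>x. norm (matrix_inv \<Sigma> *v x) \<le> B * norm x"
    using norm_matrix_vector_bound by blast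
  have bs: "\<bar>(matrix_inv \<Sigma> *v (r i - \<mu> i)) $ a\<bar> \<le> B * (1 + norm (\<mu> i)) * growth I r" for r
  proof -
    have "\<bar>(matrix_inv \<Sigma> *v (r i - \<mu> i)) $ a\<bar> \<le> norm (matrix_inv \<Sigma> *v (r i - \<mu> i))"
      by (rule component_le_norm_cart)
    also have "\<dots> \<le> B * norm (r i - \<mu> i)" by (rule B)
    also have "\<dots> \<le> B * ((1 + norm (\<mu> i)) * growth I r)"
    proof (intro mult_left_mono B(1))
      have "norm (r i - \<mu> i) \<le> norm (r i) + norm (\<mu> i)" by (rule norm_triangle_ineq4)
      also have "\<dots> \<le> growth I r + norm (\<mu> i) * growth I r"
        using norm_le_growth[OF I, of r] growth_ge_1[of I r] by (intro add_mono) (auto simp: mult_le_cancel_left1)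
      finally show "norm (r i - \<mu> i) \<le> (1 + norm (\<mu> i)) * growth I r"
        by (simp add: algebra_simps)
    qed
    finally show ?thesis by (simp add: mult.assoc)
  qed
  have int: "integrable (?P I) f"
    if [measurable]: "f \<in> borel_measurable (\<Pi>\<^sub>M i\<in>I. borel)" and "\<And>r. \<bar>f r\<bar> \<le> D * growth I r ^ L" for f D L
  proof (rule Bochner_Integration.integrable_bound)
    show "integrable (?P I) (\<lambda>r. D * growth I r ^ L)"
      using integrable_PiM_multi_normal_growth[OF pd I(1)] by simp
    show "AE r in ?P I. norm (f r) \<le> norm (D * growth I r ^ L)"
      using that(2) by (intro AE_I2) (simp, smt (verit))
  qed measurable
  have "integrable (?P I) (\<lambda>r. (matrix_inv \<Sigma> *v (r i - \<mu> i)) $ a * u r)"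
  proof (rule int)
    show "\<bar>(matrix_inv \<Sigma> *v (r i - \<mu> i)) $ a * u r\<bar> \<le> (B * (1 + norm (\<mu> i)) * C) * growth I r ^ Suc K" for r
    proof -
      have "\<bar>(matrix_inv \<Sigma> *v (r i - \<mu> i)) $ a\<bar> * \<bar>u r\<bar> \<le> (B * (1 + norm (\<mu> i)) * growth I r) * (C * growth I r ^ K)"
        using B(1) growth_ge_1[of I r] by (intro mult_mono bs bu) auto
      then show ?thesis by (simp add: abs_mult mult_ac)
    qed
  qed measurable
  then have "(\<integral>r. (matrix_inv \<Sigma> *v (r i - \<mu> i)) $ a * u r \<partial>?P I)
     = (\<integral>x. (\<integral>y. (matrix_inv \<Sigma> *v (y - \<mu> i)) $ a * u (x(i := y)) \<partial>multi_normal (\<mu> i) \<Sigma>) \<partial>?P J)"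
    unfolding IJ(1) by (subst product_integral_insert[OF IJ(2,3)]) auto
  also have "\<dots> = (\<integral>x. (\<integral>y. u' (x(i := y)) \<partial>multi_normal (\<mu> i) \<Sigma>) \<partial>?P J)"
  proof (rule Bochner_Integration.integral_cong[OF refl])
    fix x assume "x \<in> space (?P J)"
    then have "(\<lambda>y. x(i := y)) \<in> measurable borel (\<Pi>\<^sub>M i\<in>I. borel)"
      using measurable_component_update[of x J "\<lambda>_. borel" i] IJ by (simp add: space_PiM_multi_normal)
    then have [measurable]: "(\<lambda>y. u (x(i := y))) \<in> borel_measurable borel" "(\<lambda>y. u' (x(i := y))) \<in> borel_measurable borel"
      using u u' by (auto intro: measurable_compose)
    have gr: "growth I (x(i := y)) = growth J x * (1 + norm y)" for y
    proof -
      have "(\<Prod>j\<in>J. 1 + norm ((x(i := y)) j)) = (\<Prod>j\<in>J. 1 + norm (x j))"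
        using IJ(3) by (intro prod.cong) auto
      then show ?thesis
        using IJ(2,3) by (simp add: growth_def IJ(1) mult.commute)
    qed
    show "(\<integral>y. (matrix_inv \<Sigma> *v (y - \<mu> i)) $ a * u (x(i := y)) \<partial>multi_normal (\<mu> i) \<Sigma>)
      = (\<integral>y. u' (x(i := y)) \<partial>multi_normal (\<mu> i) \<Sigma>)"
    proof (rule stein_multi_normal[OF pd, where C = "C * growth J x ^ K" and K = K])
      show "((\<lambda>t. u (x(i := z + t *\<^sub>R axis a 1))) has_real_derivative u' (x(i := z))) (at 0)" for z
        using deriv[of "x(i := z)"] by simp
      show "\<bar>u (x(i := z))\<bar> \<le> C * growth J x ^ K * (1 + norm z) ^ K" for z
        using bu[of "x(i := z)"] by (simp add: gr power_mult_distrib mult.assoc)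
      show "\<bar>u' (x(i := z))\<bar> \<le> C * growth J x ^ K * (1 + norm z) ^ K" for z
        using bu'[of "x(i := z)"] by (simp add: gr power_mult_distrib mult.assoc)
    qed measurable
  qed
  also have "\<dots> = (\<integral>r. u' r \<partial>?P I)"
    using int[OF u' bu'] unfolding IJ(1) by (subst product_integral_insert[OF IJ(2,3)]) auto
  finally show ?thesis .
qed

section \<open>Almost sure nonsingularity of a sum of outer products\<close>

text \<open>The new kernel is the part of the old one that is orthogonal to \<open>z\<close>, and it misses \<open>x\<close>.\<close>

lemma dim_kernel_add_outer_less:
  assumes A: "pos_semidef A" and x: "A *v x = 0" "z \<bullet> x \<noteq> 0"
  shows "dim {v. (A + outer z z) *v v = 0} < dim {v. A *v v = 0}"
proof (rule dim_psubset)
  have sub: "{v. (A + outer z z) *v v = 0} \<subseteq> {v. A *v v = 0} \<inter> {v. z \<bullet> v = 0}"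
  proof (intro subsetI)
    fix v assume "v \<in> {v. (A + outer z z) *v v = 0}"
    then have "v \<bullet> ((A + outer z z) *v v) = 0" by simp
    then have *: "v \<bullet> (A *v v) + (z \<bullet> v)\<^sup>2 = 0"
      by (simp add: matrix_vector_mult_add_rdistrib outer_mult_vector inner_add_right power2_eq_square inner_commute)
    moreover have "v \<bullet> (A *v v) \<ge> 0" using A by (simp add: pos_semidef_def)
    moreover have "(z \<bullet> v)\<^sup>2 \<ge> 0" by simp
    ultimately have "v \<bullet> (A *v v) = 0" "(z \<bullet> v)\<^sup>2 = 0" by linarith+
    then show "v \<in> {v. A *v v = 0} \<inter> {v. z \<bullet> v = 0}"
      using pos_semidef_kernel[OF A] by auto
  qed
  have s: "subspace {v. B *v v = 0}" for B :: "real^'a^'a"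
    by (intro subspaceI) (auto simp: matrix_vector_right_distrib matrix_vector_mult_scaleR)
  have "{v. (A + outer z z) *v v = 0} \<subset> {v. A *v v = 0}"
    using sub x by auto
  then show "span {v. (A + outer z z) *v v = 0} \<subset> span {v. A *v v = 0}"
    using s by (simp add: span_eq_iff[THEN iffD2])
qed

lemma AE_multi_normal_hyperplane:
  assumes "x \<noteq> 0"
  shows "AE z in multi_normal \<mu> \<Sigma>. z \<bullet> x \<noteq> 0"
proof -
  have "negligible {z. x \<bullet> z = 0}"
    using assms by (intro negligible_hyperplane) auto
  moreover have "{z. x \<bullet> z = 0} \<in> sets borel"
    by measurable
  ultimately have "{z. x \<bullet> z = 0} \<in> null_sets lborel"
    by (simp add: negligible_iff_null_sets null_sets_completion_iff)
  then have "AE z in lborel. z \<bullet> x \<noteq> 0"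
    by (auto dest!: AE_not_in simp: inner_commute)
  then show ?thesis
    unfolding multi_normal_eq by (subst AE_density) auto
qed

text \<open>Each vector lowers the dimension of the kernel by one unless it is orthogonal to all of the
  kernel, which happens with probability \<open>0\<close>.  An arbitrary positive semidefinite start \<open>A\<close> makes the
  induction on the number of vectors possible.\<close>

lemma AE_det_add_sum_outer:
  assumes pd: "pos_def (\<Sigma> :: real^'p^'p)" and "finite J"
    and "pos_semidef A" "dim {x. A *v x = 0} \<le> card J"
  shows "AE z in (\<Pi>\<^sub>M k\<in>J. multi_normal (\<mu> k) \<Sigma>). det (A + (\<Sum>k\<in>J. outer (z k) (z k))) \<noteq> 0"
  using assms(2-)
proof (induction J arbitrary: A rule: finite_induct)
  case empty
  then have "{x. A *v x = 0} \<subseteq> {0}"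
    by (metis card.empty dim_eq_0 le_zero_eq)
  then have "invertible A"
    by (auto simp: invertible_left_inverse matrix_left_invertible_ker)
  then show ?case
    by (simp add: invertible_det_nz)
next
  case (insert k J)
  interpret product_sigma_finite "\<lambda>i. multi_normal (\<mu> i) \<Sigma>"
    by (rule product_sigma_finite_multi_normal[OF pd])
  let ?P = "\<lambda>I. \<Pi>\<^sub>M i\<in>I. multi_normal (\<mu> i) \<Sigma>"
  let ?f = "\<lambda>z. indicator {0} (det (A + (\<Sum>k\<in>insert k J. outer (z k) (z k)))) :: ennreal"
  have [measurable]: "(\<lambda>z. det (A + (\<Sum>k\<in>I. outer (z k) (z k)))) \<in> borel_measurable (?P I)" for I A
  proof -
    have "(\<lambda>z. \<Sum>k\<in>I. outer (z k) (z k)) \<in> borel_measurable (?P I)"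
      by (intro borel_measurable_sum measurable_outer) auto
    then show ?thesis by measurable
  qed
  have inner0: "AE y in multi_normal (\<mu> k) \<Sigma>. (\<integral>\<^sup>+x. ?f (x(k := y)) \<partial>?P J) = 0"
  proof -
    have "AE y in multi_normal (\<mu> k) \<Sigma>. dim {x. (A + outer y y) *v x = 0} \<le> card J"
    proof (cases "\<exists>x. x \<noteq> 0 \<and> A *v x = 0")
      case True
      then obtain x where x: "x \<noteq> 0" "A *v x = 0" by auto
      show ?thesis
        using AE_multi_normal_hyperplane[OF x(1), of "\<mu> k" \<Sigma>]
      proof eventually_elim
        case (elim y)
        from dim_kernel_add_outer_less[OF insert.prems(1) x(2) elim] insert.prems(2) insert.hyps
        show ?case by simp
      qed
    next
      case False
      have "{x. (A + outer y y) *v x = 0} \<subseteq> {0}" for y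
      proof -
        have "x = 0" if "(A + outer y y) *v x = 0" for x
        proof -
          have "x \<bullet> (A *v x) + (y \<bullet> x)\<^sup>2 = x \<bullet> ((A + outer y y) *v x)"
            by (simp add: matrix_vector_mult_add_rdistrib outer_mult_vector inner_add_right power2_eq_square inner_commute)
          then have "x \<bullet> (A *v x) + (y \<bullet> x)\<^sup>2 = 0" using that by simp
          moreover have "x \<bullet> (A *v x) \<ge> 0" using insert.prems(1) by (simp add: pos_semidef_def)
          moreover have "(y \<bullet> x)\<^sup>2 \<ge> 0" by simp
          ultimately have "x \<bullet> (A *v x) = 0" by linarith
          then have "A *v x = 0" by (rule pos_semidef_kernel[OF insert.prems(1)])
          with False show ?thesis by auto
        qed
        then show ?thesis by auto
      qed
      then show ?thesis
        by (metis (no_types, lifting) AE_I2 dim_eq_0 le0)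
    qed
    then show ?thesis
    proof eventually_elim
      case (elim y)
      have "AE x in ?P J. det ((A + outer y y) + (\<Sum>k\<in>J. outer (x k) (x k))) \<noteq> 0"
        by (rule insert.IH[OF pos_semidef_add[OF insert.prems(1) pos_semidef_outer] elim])
      moreover have "(\<Sum>j\<in>insert k J. outer ((x(k := y)) j) ((x(k := y)) j)) = outer y y + (\<Sum>j\<in>J. outer (x j) (x j))" for x
      proof -
        have "(\<Sum>j\<in>J. outer ((x(k := y)) j) ((x(k := y)) j)) = (\<Sum>j\<in>J. outer (x j) (x j))"
          using insert.hyps by (intro sum.cong) auto
        then show ?thesis using insert.hyps by simp
      qed
      ultimately have "AE x in ?P J. ?f (x(k := y)) = 0"
        by (simp add: add.assoc indicator_eq_0_iff)
      then have "(\<integral>\<^sup>+x. ?f (x(k := y)) \<partial>?P J) = (\<integral>\<^sup>+x. 0 \<partial>?P J)"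
        by (intro nn_integral_cong_AE)
      then show ?case by simp
    qed
  qed
  have "(\<integral>\<^sup>+z. ?f z \<partial>?P (insert k J)) = (\<integral>\<^sup>+y. (\<integral>\<^sup>+x. ?f (x(k := y)) \<partial>?P J) \<partial>multi_normal (\<mu> k) \<Sigma>)"
    using insert.hyps by (intro product_nn_integral_insert_rev) auto
  also have "\<dots> = (\<integral>\<^sup>+y. 0 \<partial>multi_normal (\<mu> k) \<Sigma>)"
    by (intro nn_integral_cong_AE inner0)
  also have "\<dots> = 0" by simp
  finally have "AE z in ?P (insert k J). ?f z = 0"
    by (subst (asm) nn_integral_0_iff_AE) auto
  then show ?case
    by eventually_elim (auto split: split_indicator_asm)
qed

section \<open>Derivatives of matrix expressions\<close>

lemma has_vector_derivative_at_0I: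
  fixes f :: "real \<Rightarrow> 'a::real_normed_vector"
  assumes "\<And>t. f t - f 0 = t *\<^sub>R g t" "(g \<longlongrightarrow> d) (at 0)"
  shows "(f has_vector_derivative d) (at 0)"
proof -
  have "((\<lambda>t. norm (g t - d)) \<longlongrightarrow> 0) (at 0)"
    using assms(2) by (simp add: tendsto_norm_zero_iff LIM_zero)
  moreover have "\<forall>\<^sub>F t in at 0. norm (g t - d) = norm ((f t - f 0) - t *\<^sub>R d) / norm t"
    unfolding assms(1) eventually_at_filter
    by (rule always_eventually) (simp flip: scaleR_right_diff_distrib)
  ultimately have "((\<lambda>t. norm ((f t - f 0) - t *\<^sub>R d) / norm t) \<longlongrightarrow> 0) (at 0)"
    by (rule Lim_transform_eventually)
  then show ?thesis
    unfolding has_vector_derivative_def has_derivative_at by (simp add: bounded_linear_scaleR_left)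
qed

text \<open>From \<open>W\<^sub>t\<^sup>-\<^sup>1 - W\<^sub>0\<^sup>-\<^sup>1 = W\<^sub>t\<^sup>-\<^sup>1 (W\<^sub>0 - W\<^sub>t) W\<^sub>0\<^sup>-\<^sup>1\<close>.  A curve that is quadratic in \<open>t\<close> is what moving one
  entry of \<open>X\<close>, or one coordinate of a summand \<open>z z\<^sup>T\<close> of \<open>S\<close>, produces.\<close>

lemma has_vector_derivative_matrix_inv:
  fixes W0 W1 W2 :: "real^'n^'n"
  assumes inv: "\<And>t. invertible (W0 + t *\<^sub>R (W1 + t *\<^sub>R W2))"
  shows "((\<lambda>t. matrix_inv (W0 + t *\<^sub>R (W1 + t *\<^sub>R W2))) has_vector_derivative
    - (matrix_inv W0 ** W1 ** matrix_inv W0)) (at 0)"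
proof (rule has_vector_derivative_at_0I)
  let ?W = "\<lambda>t. W0 + t *\<^sub>R (W1 + t *\<^sub>R W2)"
  let ?g = "\<lambda>t. - (matrix_inv (?W t) ** (W1 + t *\<^sub>R W2) ** matrix_inv W0)"
  have inv0: "invertible W0" using inv[of 0] by simp
  show "matrix_inv (?W t) - matrix_inv (?W 0) = t *\<^sub>R ?g t" for t
  proof -
    have "matrix_inv (?W t) - matrix_inv W0
        = matrix_inv (?W t) ** (W0 - ?W t) ** matrix_inv W0"
      unfolding matrix_diff_ldistrib matrix_diff_rdistrib
      by (simp only: matrix_mul_assoc[symmetric] matrix_inv_mult[OF inv0] matrix_inv_mult[OF inv]
         matrix_mul_rid) (simp only: matrix_mul_assoc matrix_inv_mult[OF inv] matrix_mul_lid)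
    also have "W0 - ?W t = - (t *\<^sub>R (W1 + t *\<^sub>R W2))" by simp
    finally show ?thesis
      by (simp only: matrix_minus_left matrix_minus_right matrix_scaleR_left matrix_scaleR_right scaleR_minus_right) simp
  qed
  have "(?W \<longlongrightarrow> W0 + 0 *\<^sub>R (W1 + 0 *\<^sub>R W2)) (at 0)"
    by (intro tendsto_intros)
  then have "((\<lambda>t. matrix_inv (?W t)) \<longlongrightarrow> matrix_inv W0) (at 0)"
    using tendsto_matrix_inv[OF _ inv0] by simp
  then have "(?g \<longlongrightarrow> - (matrix_inv W0 ** (W1 + 0 *\<^sub>R W2) ** matrix_inv W0)) (at 0)"
    by (intro tendsto_intros)
  then show "(?g \<longlongrightarrow> - (matrix_inv W0 ** W1 ** matrix_inv W0)) (at 0)" by simp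
qed

lemma has_vector_derivative_matrix_mult:
  fixes f :: "real \<Rightarrow> real^'n^'m" and g :: "real \<Rightarrow> real^'p^'n"
  assumes "(f has_vector_derivative f') (at x)" "(g has_vector_derivative g') (at x)"
  shows "((\<lambda>t. f t ** g t) has_vector_derivative f x ** g' + f' ** g x) (at x)"
  using bounded_bilinear.has_vector_derivative[OF bounded_bilinear_matrix_mult assms] .

lemma has_vector_derivative_transpose:
  fixes f :: "real \<Rightarrow> real^'n^'m"
  assumes "(f has_vector_derivative f') (at x)"
  shows "((\<lambda>t. transpose (f t)) has_vector_derivative transpose f') (at x)"
  using bounded_linear.has_vector_derivative[OF bounded_linear_transpose assms] .

lemma has_real_derivative_nth:
  fixes f :: "real \<Rightarrow> real^'n"
  assumes "(f has_vector_derivative f') (at x)"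
  shows "((\<lambda>t. f t $ i) has_real_derivative f' $ i) (at x)"
  using bounded_linear.has_vector_derivative[OF bounded_linear_vec_nth assms]
  by (simp add: has_real_derivative_iff_has_vector_derivative)

lemma has_vector_derivative_nth:
  fixes f :: "real \<Rightarrow> 'a::real_normed_vector^'n"
  assumes "(f has_vector_derivative f') (at x)"
  shows "((\<lambda>t. f t $ i) has_vector_derivative f' $ i) (at x)"
  using bounded_linear.has_vector_derivative[OF bounded_linear_vec_nth assms] .

section \<open>The regularised estimator and its divergences\<close>

text \<open>The four functions below are \<open>W = S + \<beta> X\<^sup>T X + e I\<close>, \<open>V\<close>, \<open>U\<close> and \<open>G\<close> of the introduction, with the
  regularisation \<open>e\<close>.  Up to scaling, \<open>U\<close> is the hat matrix of a generalised ridge regression on \<open>X\<close>.\<close>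

definition ridge :: "real \<Rightarrow> real \<Rightarrow> real^'p^'m \<Rightarrow> real^'p^'p \<Rightarrow> real^'p^'p" where
  "ridge \<beta> e X S = S + \<beta> *\<^sub>R (transpose X ** X) + e *\<^sub>R mat 1"

definition ridge_inv :: "real \<Rightarrow> real \<Rightarrow> real^'p^'m \<Rightarrow> real^'p^'p \<Rightarrow> real^'p^'p" where
  "ridge_inv \<beta> e X S = matrix_inv (ridge \<beta> e X S)"

definition hat_matrix :: "real \<Rightarrow> real \<Rightarrow> real^'p^'m \<Rightarrow> real^'p^'p \<Rightarrow> real^'m^'m" where
  "hat_matrix \<beta> e X S = X ** ridge_inv \<beta> e X S ** transpose X"

definition correction :: "real \<Rightarrow> real \<Rightarrow> real^'p^'m \<Rightarrow> real^'p^'p \<Rightarrow> real^'p^'m" where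
  "correction \<beta> e X S = X - \<beta> *\<^sub>R (hat_matrix \<beta> e X S ** X)"

lemma pos_def_ridge:
  assumes "\<beta> > 0" "e > 0" "pos_semidef S"
  shows "pos_def (ridge \<beta> e X S)"
  unfolding ridge_def using assms
  by (subst add.commute) (intro pos_def_add_pos_semidef pos_def_mat pos_semidef_add pos_semidef_scaleR pos_semidef_gram; simp)

lemma pos_def_ridge_0:
  assumes "\<beta> > 0" "pos_def S"
  shows "pos_def (ridge \<beta> 0 X S)"
  unfolding ridge_def using assms
  by (simp add: pos_def_add_pos_semidef pos_semidef_scaleR pos_semidef_gram)

lemma transpose_ridge_inv:
  assumes "pos_def (ridge \<beta> e X S)"
  shows "transpose (ridge_inv \<beta> e X S) = ridge_inv \<beta> e X S"
  using pos_def_matrix_inv[OF assms] by (simp add: ridge_inv_def pos_def_def)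

definition unit_matrix :: "'m \<Rightarrow> 'p \<Rightarrow> real^'p^'m" where
  "unit_matrix i a = outer (axis i 1) (axis a 1)"

lemma transpose_unit_matrix: "transpose (unit_matrix i a) = unit_matrix a i"
  by (simp add: unit_matrix_def transpose_outer)

lemma unit_matrix_nth: "unit_matrix i a $ j $ b = (if j = i \<and> b = a then 1 else 0)"
  by (auto simp: unit_matrix_def axis_def)

lemma unit_matrix_mul_nth: "(unit_matrix i a ** B) $ j $ b = (if j = i then B $ a $ b else 0)"
  by (simp add: unit_matrix_def outer_mul_matrix matrix_vector_mul_axis column_def transpose_def)
    (simp add: axis_def)

lemma mul_unit_matrix_nth: "(A ** unit_matrix i a) $ j $ b = (if b = a then A $ j $ i else 0)"
  by (simp add: unit_matrix_def matrix_mul_outer matrix_vector_mul_axis column_def)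
    (simp add: axis_def)

lemma mul_unit_matrix_mul_nth: "(A ** unit_matrix i a ** B) $ j $ b = A $ j $ i * B $ a $ b"
  by (simp add: unit_matrix_def matrix_mul_outer outer_mul_matrix matrix_vector_mul_axis column_def transpose_def)

lemmas unit_matrix_simps = unit_matrix_nth unit_matrix_mul_nth mul_unit_matrix_nth mul_unit_matrix_mul_nth

text \<open>The derivative of \<open>G\<close> when the entry of \<open>X\<close> in row \<open>i\<close> and column \<open>a\<close> moves.\<close>

definition dcorrection_X :: "real \<Rightarrow> real \<Rightarrow> real^'p^'m \<Rightarrow> real^'p^'p \<Rightarrow> 'm \<Rightarrow> 'p \<Rightarrow> real^'p^'m" where
  "dcorrection_X \<beta> e X S i a = (let V = ridge_inv \<beta> e X S; A = transpose X ** X; E = unit_matrix i a in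
     E - \<beta> *\<^sub>R (E ** (V ** A)) - \<beta> *\<^sub>R (X ** V ** transpose E ** X) - \<beta> *\<^sub>R (hat_matrix \<beta> e X S ** E)
     + \<beta>\<^sup>2 *\<^sub>R (X ** V ** transpose E ** (X ** V ** A)) + \<beta>\<^sup>2 *\<^sub>R (hat_matrix \<beta> e X S ** E ** (V ** A)))"

lemma correction_derivative_X:
  fixes X :: "real^'p^'m"
  assumes pd: "\<And>X :: real^'p^'m. pos_def (ridge \<beta> e X S)"
  shows "((\<lambda>t. correction \<beta> e (X + t *\<^sub>R unit_matrix i a) S) has_vector_derivative dcorrection_X \<beta> e X S i a) (at 0)"
proof -
  let ?E = "unit_matrix i a :: real^'p^'m"
  define V where "V = ridge_inv \<beta> e X S"
  define W1 where "W1 = \<beta> *\<^sub>R (transpose ?E ** X + transpose X ** ?E)"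
  define W2 where "W2 = \<beta> *\<^sub>R (transpose ?E ** ?E)"
  have W: "ridge \<beta> e (X + t *\<^sub>R ?E) S = ridge \<beta> e X S + t *\<^sub>R (W1 + t *\<^sub>R W2)" for t
    by (simp add: ridge_def W1_def W2_def transpose_add transpose_scaleR matrix_ring algebra_simps)
  have inv: "invertible (ridge \<beta> e X S + t *\<^sub>R (W1 + t *\<^sub>R W2))" for t
    unfolding W[symmetric] by (rule pos_def_invertible[OF pd])
  have dX: "((\<lambda>t. X + t *\<^sub>R ?E) has_vector_derivative ?E) (at 0)"
    by (auto intro!: derivative_eq_intros)
  have dV: "((\<lambda>t. ridge_inv \<beta> e (X + t *\<^sub>R ?E) S) has_vector_derivative - (V ** W1 ** V)) (at 0)"
    using has_vector_derivative_matrix_inv[OF inv] by (simp add: ridge_inv_def W V_def)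
  have "((\<lambda>t. correction \<beta> e (X + t *\<^sub>R ?E) S) has_vector_derivative
     ?E - \<beta> *\<^sub>R (((X ** V ** transpose X) ** ?E +
       ((X ** V) ** transpose ?E + (X ** - (V ** W1 ** V) + ?E ** V) ** transpose X) ** X))) (at 0)"
    unfolding correction_def hat_matrix_def
    apply (rule has_vector_derivative_diff[OF dX])
    apply (rule bounded_linear.has_vector_derivative[OF bounded_linear_scaleR_right])
    using has_vector_derivative_matrix_mult[OF has_vector_derivative_matrix_mult[OF
          has_vector_derivative_matrix_mult[OF dX dV] has_vector_derivative_transpose[OF dX]] dX]
    by (simp add: V_def)
  then show ?thesis
    unfolding dcorrection_X_def Let_def V_def[symmetric] hat_matrix_def W1_def
    by (simp add: matrix_ring matrix_mul_assoc algebra_simps power2_eq_square)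
qed

text \<open>
  Summed over \<open>a\<close>, a term \<open>P E Q\<close> of the derivative contributes \<open>P\<close> times the trace of \<open>Q\<close>, and a term
  \<open>P E\<^sup>T Q\<close> contributes \<open>P Q\<^sup>T\<close>.  This leaves a polynomial in \<open>U\<close> alone, which stays bounded as \<open>e\<close> tends
  to \<open>0\<close>.
\<close>

lemma divergence_correction_X:
  fixes X :: "real^'p^'m" and i :: 'm
  assumes pd: "pos_def (ridge \<beta> e X S)"
  defines "U \<equiv> hat_matrix \<beta> e X S"
  shows "(\<Sum>a\<in>UNIV. dcorrection_X \<beta> e X S i a $ j $ a)
    = ((real CARD('p) - \<beta> * trace U) *\<^sub>R (mat 1 - \<beta> *\<^sub>R U) - \<beta> *\<^sub>R (U ** (mat 1 - \<beta> *\<^sub>R U))) $ j $ i"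
proof -
  define V where "V = ridge_inv \<beta> e X S"
  define A where "A = transpose X ** X"
  have tV: "transpose V = V"
    unfolding V_def by (rule transpose_ridge_inv[OF pd])
  have U: "U = X ** V ** transpose X"
    by (simp add: U_def hat_matrix_def V_def)
  have tr: "trace (V ** A) = trace U"
    using trace_mul_sym[of "V ** transpose X" X] trace_mul_sym[of X "V ** transpose X"]
    by (simp add: U A_def matrix_mul_assoc)
  have 1: "(\<Sum>a\<in>UNIV. (X ** V ** unit_matrix a i ** B) $ j $ a) = (X ** V ** transpose B) $ j $ i" for B :: "real^'p^'m"
    by (simp add: unit_matrix_simps) (simp add: matrix_matrix_mult_def transpose_def)
  have UU: "X ** V ** transpose (X ** V ** A) = U ** U"
    by (simp add: U A_def matrix_transpose_mul tV matrix_mul_assoc)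
  have UX: "X ** V ** transpose X = U"
    by (simp add: U)
  have "(\<Sum>a\<in>UNIV. dcorrection_X \<beta> e X S i a $ j $ a)
     = real CARD('p) * (mat 1 :: real^'m^'m) $ j $ i - \<beta> * ((mat 1 :: real^'m^'m) $ j $ i * trace (V ** A))
       - \<beta> * U $ j $ i - \<beta> * (real CARD('p) * U $ j $ i) + \<beta>\<^sup>2 * (U ** U) $ j $ i + \<beta>\<^sup>2 * (U $ j $ i * trace (V ** A))"
    unfolding dcorrection_X_def Let_def V_def[symmetric] A_def[symmetric] U_def[symmetric] transpose_unit_matrix
    by (simp add: sum.distrib sum_subtractf sum_distrib_left[symmetric] 1 UU UX)
      (simp add: unit_matrix_simps mat_def trace_def sum_distrib_left)
  also have "\<dots> = ((real CARD('p) - \<beta> * trace U) *\<^sub>R (mat 1 - \<beta> *\<^sub>R U) - \<beta> *\<^sub>R (U ** (mat 1 - \<beta> *\<^sub>R U))) $ j $ i"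
    unfolding tr by (simp add: matrix_ring algebra_simps power2_eq_square)
  finally show ?thesis .
qed

text \<open>The derivatives, when the coordinate \<open>a\<close> of a summand \<open>z\<close> of \<open>S\<close> moves, of \<open>V\<close> and of the product
  \<open>(X V z)\<^sub>i G\<^sub>j\<^sub>a\<close>.\<close>

definition dridge_inv_Z :: "real \<Rightarrow> real \<Rightarrow> real^'p^'m \<Rightarrow> real^'p^'p \<Rightarrow> real^'p \<Rightarrow> 'p \<Rightarrow> real^'p^'p" where
  "dridge_inv_Z \<beta> e X S z a = - (ridge_inv \<beta> e X S ** (outer (axis a 1) z + outer z (axis a 1)) ** ridge_inv \<beta> e X S)"

definition dproduct_Z :: "real \<Rightarrow> real \<Rightarrow> real^'p^'m \<Rightarrow> real^'p^'p \<Rightarrow> real^'p \<Rightarrow> 'm \<Rightarrow> 'm \<Rightarrow> 'p \<Rightarrow> real" where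
  "dproduct_Z \<beta> e X S z i j a =
     (X *v (ridge_inv \<beta> e X S *v axis a 1 + dridge_inv_Z \<beta> e X S z a *v z)) $ i * correction \<beta> e X S $ j $ a
     - (X *v (ridge_inv \<beta> e X S *v z)) $ i * (\<beta> *\<^sub>R (X ** dridge_inv_Z \<beta> e X S z a ** transpose X ** X)) $ j $ a"

lemma has_vector_derivative_matrix_vector_mult:
  fixes f :: "real \<Rightarrow> real^'n^'m" and g :: "real \<Rightarrow> real^'n"
  assumes "(f has_vector_derivative f') (at x)" "(g has_vector_derivative g') (at x)"
  shows "((\<lambda>t. f t *v g t) has_vector_derivative f x *v g' + f' *v g x) (at x)"
proof -
  have "bounded_bilinear ((*v) :: real^'n^'m \<Rightarrow> real^'n \<Rightarrow> real^'m)"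
    unfolding bilinear_conv_bounded_bilinear[symmetric] bilinear_def
    by (auto intro!: linearI simp: matrix_vector_right_distrib matrix_vector_mult_scaleR
      matrix_vector_mult_add_rdistrib scaleR_matrix_vector_assoc[symmetric])
  from bounded_bilinear.has_vector_derivative[OF this assms] show ?thesis .
qed

lemma derivative_Z:
  fixes X :: "real^'p^'m"
  assumes pd: "\<And>z. pos_def (ridge \<beta> e X (S0 + outer z z))"
  shows "((\<lambda>t. (X *v (ridge_inv \<beta> e X (S0 + outer (z + t *\<^sub>R axis a 1) (z + t *\<^sub>R axis a 1)) *v (z + t *\<^sub>R axis a 1))) $ i
      * correction \<beta> e X (S0 + outer (z + t *\<^sub>R axis a 1) (z + t *\<^sub>R axis a 1)) $ j $ a)
    has_real_derivative dproduct_Z \<beta> e X (S0 + outer z z) z i j a) (at 0)"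
proof -
  let ?e = "axis a 1 :: real^'p"
  let ?S = "\<lambda>t. S0 + outer (z + t *\<^sub>R ?e) (z + t *\<^sub>R ?e)"
  define V where "V = ridge_inv \<beta> e X (S0 + outer z z)"
  define W1 where "W1 = outer ?e z + outer z ?e"
  have W: "ridge \<beta> e X (?S t) = ridge \<beta> e X (S0 + outer z z) + t *\<^sub>R (W1 + t *\<^sub>R outer ?e ?e)" for t
    by (simp add: ridge_def W1_def vec_eq_iff algebra_simps)
  have inv: "invertible (ridge \<beta> e X (S0 + outer z z) + t *\<^sub>R (W1 + t *\<^sub>R outer ?e ?e))" for t
    unfolding W[symmetric] by (rule pos_def_invertible[OF pd])
  define dV where "dV = dridge_inv_Z \<beta> e X (S0 + outer z z) z a"
  have dV: "((\<lambda>t. ridge_inv \<beta> e X (?S t)) has_vector_derivative dV) (at 0)"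
    using has_vector_derivative_matrix_inv[OF inv] by (simp add: ridge_inv_def W dV_def dridge_inv_Z_def W1_def)
  have dz: "((\<lambda>t. z + t *\<^sub>R ?e) has_vector_derivative ?e) (at 0)"
    by (auto intro!: derivative_eq_intros)
  have c: "((\<lambda>t. C) has_vector_derivative 0) (at 0)" for C :: "real^'d^'c"
    by simp
  have "((\<lambda>t. X *v (ridge_inv \<beta> e X (?S t) *v (z + t *\<^sub>R ?e))) has_vector_derivative
      X *v (V *v ?e + dV *v z)) (at 0)"
    using has_vector_derivative_matrix_vector_mult[OF c has_vector_derivative_matrix_vector_mult[OF dV dz], of X]
    by (simp add: V_def)
  then have 1: "((\<lambda>t. (X *v (ridge_inv \<beta> e X (?S t) *v (z + t *\<^sub>R ?e))) $ i) has_real_derivative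
      (X *v (V *v ?e + dV *v z)) $ i) (at 0)"
    by (rule has_real_derivative_nth)
  have "((\<lambda>t. X ** ridge_inv \<beta> e X (?S t) ** transpose X ** X) has_vector_derivative X ** dV ** transpose X ** X) (at 0)"
    using has_vector_derivative_matrix_mult[OF has_vector_derivative_matrix_mult[OF
          has_vector_derivative_matrix_mult[OF c dV] c] c, of X "transpose X" X] by simp
  then have "((\<lambda>t. correction \<beta> e X (?S t)) has_vector_derivative 0 - \<beta> *\<^sub>R (X ** dV ** transpose X ** X)) (at 0)"
    unfolding correction_def hat_matrix_def
    by (intro has_vector_derivative_diff bounded_linear.has_vector_derivative[OF bounded_linear_scaleR_right]) auto
  then have 2: "((\<lambda>t. correction \<beta> e X (?S t) $ j $ a) has_real_derivative (- \<beta> *\<^sub>R (X ** dV ** transpose X ** X)) $ j $ a) (at 0)"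
    by (intro has_real_derivative_nth has_vector_derivative_nth) simp
  from DERIV_mult[OF 1 2] show ?thesis
    unfolding dproduct_Z_def V_def dV_def by (simp add: algebra_simps)
qed

text \<open>
  The right-hand side is affine in \<open>z z\<^sup>T\<close>, so summing it over all \<open>z\<^sub>k\<close> replaces \<open>z z\<^sup>T\<close> by \<open>S\<close> and \<open>1\<close>
  by \<open>n\<close>.
\<close>

lemma divergence_Z:
  fixes X :: "real^'p^'m" and z :: "real^'p"
  assumes pd: "pos_def (ridge \<beta> e X S)"
  defines "U \<equiv> hat_matrix \<beta> e X S" and "V \<equiv> ridge_inv \<beta> e X S" and "G \<equiv> correction \<beta> e X S"
  shows "(\<Sum>a\<in>UNIV. dproduct_Z \<beta> e X S z i j a)
    = (1 - trace (V ** outer z z)) * (G ** V ** transpose X) $ j $ i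
      - (G ** V ** outer z z ** V ** transpose X) $ j $ i
      + \<beta> * ((U ** (X ** V ** outer z z ** V ** transpose X)) $ j $ i
         + trace U * (X ** V ** outer z z ** V ** transpose X) $ j $ i)"
proof -
  define A where "A = transpose X ** X"
  have tV: "transpose V = V"
    unfolding V_def by (rule transpose_ridge_inv[OF pd])
  have U: "U = X ** V ** transpose X"
    by (simp add: U_def hat_matrix_def V_def)
  have trU: "trace (V ** A) = trace U"
    using trace_mul_sym[of "V ** transpose X" X] trace_mul_sym[of X "V ** transpose X"]
    by (simp add: U A_def matrix_mul_assoc)
  have tA: "transpose A = A"
    by (simp add: A_def matrix_transpose_mul)
  have trA: "trace (A ** V) = trace U"
    using trace_mul_sym[of A V] trU by simp
  define q where "q = z \<bullet> (V *v z)"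
  have trz: "trace (V ** outer z z) = q"
    by (simp add: q_def matrix_mul_outer trace_def inner_vec_def mult.commute)
  define x where "x = X *v (V *v z)"
  have col: "(P *v axis a 1) $ k = P $ k $ a" for P :: "real^'b^'c" and a k
    by (simp add: matrix_vector_mul_axis column_def)
  have dV: "dridge_inv_Z \<beta> e X S z a = - (outer (V *v axis a 1) (V *v z) + outer (V *v z) (V *v axis a 1))" for a
    by (simp add: dridge_inv_Z_def V_def[symmetric] matrix_ring matrix_mul_outer outer_mul_matrix tV)
  have sym: "(V *v axis a 1) \<bullet> z = (V *v z) $ a" for a
    using inner_matrix_symmetric[OF tV, of z "axis a 1"] by (simp add: inner_axis' inner_commute)
  have minus_vec: "(- B) *v v = - (B *v v)" for B :: "real^'b^'c" and v
    by (simp add: vec_eq_iff matrix_vector_mult_def sum_negf)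
  have 1: "(X *v (V *v axis a 1 + dridge_inv_Z \<beta> e X S z a *v z)) $ i = (1 - q) * (X ** V) $ i $ a - x $ i * (V *v z) $ a" for a
    using col[of "X ** V" a i]
    by (simp add: dV minus_vec matrix_vector_mult_add_rdistrib outer_mult_vector sym q_def x_def
        inner_commute[of "V *v z" z] matrix_vector_mult_diff_distrib matrix_vector_right_distrib
        matrix_vector_mult_scaleR matrix_vector_mul_assoc algebra_simps)
  have 2: "(\<beta> *\<^sub>R (X ** dridge_inv_Z \<beta> e X S z a ** transpose X ** X)) $ j $ a
      = - \<beta> * ((X ** V) $ j $ a * (A *v (V *v z)) $ a + x $ j * (A ** V) $ a $ a)" for a
  proof -
    have eq: "X ** dridge_inv_Z \<beta> e X S z a ** transpose X ** X = X ** dridge_inv_Z \<beta> e X S z a ** A"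
      by (simp add: A_def matrix_mul_assoc)
    show ?thesis
      unfolding eq using col[of "X ** V" a j] col[of "A ** V" a a]
      by (simp add: dV matrix_ring matrix_mul_outer outer_mul_matrix tA x_def matrix_vector_mul_assoc algebra_simps)
  qed
  have "(\<Sum>a\<in>UNIV. dproduct_Z \<beta> e X S z i j a) = (\<Sum>a\<in>UNIV. (1 - q) * (G $ j $ a * (X ** V) $ i $ a)
      - x $ i * (G $ j $ a * (V *v z) $ a)
      + \<beta> * (x $ i * ((X ** V) $ j $ a * (A *v (V *v z)) $ a)) + \<beta> * (x $ i * x $ j * (A ** V) $ a $ a))"
    unfolding dproduct_Z_def V_def[symmetric] G_def[symmetric] 1 2 x_def[symmetric]
    by (intro sum.cong refl) (simp add: algebra_simps)
  also have "\<dots> = (1 - q) * (G ** transpose (X ** V)) $ j $ i - x $ i * (G *v (V *v z)) $ j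
      + \<beta> * (x $ i * ((X ** V) *v (A *v (V *v z))) $ j) + \<beta> * (x $ i * x $ j * trace (A ** V))"
    by (simp add: sum.distrib sum_subtractf sum_distrib_left[symmetric])
      (simp add: matrix_matrix_mult_def matrix_vector_mult_def transpose_def trace_def)
  also have "G ** transpose (X ** V) = G ** V ** transpose X"
    by (simp add: matrix_transpose_mul tV matrix_mul_assoc)
  also have "x $ i * (G *v (V *v z)) $ j = (G ** V ** outer z z ** V ** transpose X) $ j $ i"
    by (simp add: x_def matrix_mul_outer outer_mul_matrix tV matrix_vector_mul_assoc)
  also have "x $ i * ((X ** V) *v (A *v (V *v z))) $ j = (U ** (X ** V ** outer z z ** V ** transpose X)) $ j $ i"
    by (simp add: x_def U A_def matrix_mul_outer outer_mul_matrix tV matrix_vector_mul_assoc matrix_mul_assoc)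
  also have "x $ i * x $ j = (X ** V ** outer z z ** V ** transpose X) $ j $ i"
    by (simp add: x_def matrix_mul_outer outer_mul_matrix tV matrix_vector_mul_assoc)
  finally show ?thesis
    unfolding trz trA by (simp add: algebra_simps)
qed

section \<open>Bounds that are uniform in the regularisation\<close>

lemma inner_ridge: "w \<bullet> (ridge \<beta> e X S *v w) = w \<bullet> (S *v w) + \<beta> * (norm (X *v w))\<^sup>2 + e * (norm w)\<^sup>2"
  by (simp add: ridge_def matrix_vector_mult_add_rdistrib scaleR_matrix_vector_assoc[symmetric] inner_add_right
      matrix_vector_mul_assoc[symmetric] inner_transpose_mult power2_norm_eq_inner)

lemma ridge_mult_ridge_inv:
  assumes "pos_def (ridge \<beta> e X S)"
  shows "ridge \<beta> e X S ** ridge_inv \<beta> e X S = mat 1" "ridge_inv \<beta> e X S ** ridge \<beta> e X S = mat 1"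
  using matrix_inv_mult[OF pos_def_invertible[OF assms]] by (simp_all add: ridge_inv_def)

lemma inner_ridge_inv:
  assumes "pos_def (ridge \<beta> e X S)"
  shows "v \<bullet> (ridge_inv \<beta> e X S *v v) = (ridge_inv \<beta> e X S *v v) \<bullet> (ridge \<beta> e X S *v (ridge_inv \<beta> e X S *v v))"
  using ridge_mult_ridge_inv[OF assms] by (simp add: matrix_vector_mul_assoc inner_commute)

lemma inner_ridge_inv_nonneg:
  assumes "pos_def (ridge \<beta> e X S)"
  shows "0 \<le> v \<bullet> (ridge_inv \<beta> e X S *v v)"
  using pos_def_matrix_inv[OF assms] unfolding ridge_inv_def pos_def_def by (cases "v = 0") (auto intro: less_imp_le)

lemma norm_le_of_quadratic:
  fixes u v :: "'a::real_inner"
  assumes "c > 0" "c * (norm u)\<^sup>2 \<le> v \<bullet> u"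
  shows "norm u \<le> norm v / c"
proof (cases "norm u = 0")
  case False
  then have "norm u > 0" by simp
  moreover have "c * norm u * norm u \<le> norm v * norm u"
    using assms(2) norm_cauchy_schwarz[of v u] by (simp add: power2_eq_square mult.assoc)
  ultimately have "c * norm u \<le> norm v" by simp
  then show ?thesis using assms(1) by (simp add: field_simps)
qed (use assms in auto)

lemma matrix_nth_bound:
  fixes A :: "real^'n^'m"
  assumes "\<And>v. norm (A *v v) \<le> norm v * c"
  shows "\<bar>A $ i $ j\<bar> \<le> c"
proof -
  have "A $ i $ j = (A *v axis j 1) $ i"
    by (simp add: matrix_vector_mul_axis column_def)
  also have "\<bar>\<dots>\<bar> \<le> norm (A *v axis j 1)" by (rule component_le_norm_cart)
  also have "\<dots> \<le> c" using assms[of "axis j 1"] by simp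
  finally show ?thesis .
qed

lemma ridge_inv_nth_bound:
  assumes "pos_def (ridge \<beta> e X S)" "pos_semidef S" "\<beta> > 0" "e > 0"
  shows "\<bar>ridge_inv \<beta> e X S $ i $ j\<bar> \<le> 1 / e"
proof (rule matrix_nth_bound)
  fix v
  let ?u = "ridge_inv \<beta> e X S *v v"
  have "0 \<le> ?u \<bullet> (S *v ?u)" using assms(2) by (simp add: pos_semidef_def)
  moreover have "0 \<le> \<beta> * (norm (X *v ?u))\<^sup>2" using assms(3) by simp
  ultimately have "e * (norm ?u)\<^sup>2 \<le> v \<bullet> ?u"
    unfolding inner_ridge_inv[OF assms(1)] inner_ridge by linarith
  from norm_le_of_quadratic[OF assms(4) this] show "norm ?u \<le> norm v * (1 / e)" by simp
qed

lemma inner_hat_matrix: "v \<bullet> (hat_matrix \<beta> e X S *v v) = (transpose X *v v) \<bullet> (ridge_inv \<beta> e X S *v (transpose X *v v))"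
  using inner_transpose_mult[of v "transpose X"] by (simp add: hat_matrix_def matrix_vector_mul_assoc[symmetric])

text \<open>With \<open>w = V X\<^sup>T v\<close> the right-hand side is \<open>w\<^sup>T W w\<close>, and \<open>X w = U v\<close>.\<close>

lemma hat_matrix_quadratic:
  assumes "pos_def (ridge \<beta> e X S)" "pos_semidef S" "\<beta> > 0" "e \<ge> 0"
  shows "\<beta> * (norm (hat_matrix \<beta> e X S *v v))\<^sup>2
      + (ridge_inv \<beta> e X S *v (transpose X *v v)) \<bullet> (S *v (ridge_inv \<beta> e X S *v (transpose X *v v))) \<le> v \<bullet> (hat_matrix \<beta> e X S *v v)"
proof -
  let ?u = "ridge_inv \<beta> e X S *v (transpose X *v v)"
  have "X *v ?u = hat_matrix \<beta> e X S *v v" by (simp add: hat_matrix_def matrix_vector_mul_assoc matrix_mul_assoc)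
  moreover have "0 \<le> e * (norm ?u)\<^sup>2" using assms(4) by simp
  ultimately show ?thesis
    unfolding inner_hat_matrix inner_ridge_inv[OF assms(1)] inner_ridge by simp
qed

lemma norm_hat_matrix_le:
  assumes "pos_def (ridge \<beta> e X S)" "pos_semidef S" "\<beta> > 0" "e \<ge> 0"
  shows "norm (hat_matrix \<beta> e X S *v v) \<le> norm v * (1 / \<beta>)"
proof -
  have "0 \<le> (ridge_inv \<beta> e X S *v (transpose X *v v)) \<bullet> (S *v (ridge_inv \<beta> e X S *v (transpose X *v v)))"
    using assms(2) by (simp add: pos_semidef_def)
  then have "\<beta> * (norm (hat_matrix \<beta> e X S *v v))\<^sup>2 \<le> v \<bullet> (hat_matrix \<beta> e X S *v v)"
    using hat_matrix_quadratic[OF assms, of v] by linarith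
  from norm_le_of_quadratic[OF assms(3) this] show ?thesis by simp
qed

lemma hat_matrix_nth_bound:
  assumes "pos_def (ridge \<beta> e X S)" "pos_semidef S" "\<beta> > 0" "e \<ge> 0"
  shows "\<bar>hat_matrix \<beta> e X S $ i $ j\<bar> \<le> 1 / \<beta>"
  by (rule matrix_nth_bound norm_hat_matrix_le[OF assms])+

definition gram :: "nat \<Rightarrow> (nat \<Rightarrow> real^'p) \<Rightarrow> real^'p^'p" where
  "gram n z = (\<Sum>k<n. outer (z k) (z k))"

lemma inner_gram: "v \<bullet> (gram n z *v v) = (\<Sum>k<n. (z k \<bullet> v)\<^sup>2)"
  by (simp add: gram_def sum_matrix_vector_mult outer_mult_vector inner_sum_right power2_eq_square inner_commute)

lemma pos_semidef_gram_vectors: "pos_semidef (gram n z)"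
  unfolding pos_semidef_def inner_gram by (simp add: gram_def transpose_sum transpose_outer sum_nonneg)

lemma pos_def_ridge_gram: "\<beta> > 0 \<Longrightarrow> e > 0 \<Longrightarrow> pos_def (ridge \<beta> e X (gram n z))"
  by (intro pos_def_ridge pos_semidef_gram_vectors)

text \<open>The square of this component is one term of the diagonal entry \<open>(X V S V X\<^sup>T)\<^sub>i\<^sub>i\<close>, which is at most
  \<open>U\<^sub>i\<^sub>i\<close>.\<close>

lemma XVz_bound:
  assumes "pos_def (ridge \<beta> e X (gram n z))" "\<beta> > 0" "e \<ge> 0" "k < n"
  shows "\<bar>(X *v (ridge_inv \<beta> e X (gram n z) *v z k)) $ i\<bar> \<le> 1 + 1 / \<beta>"
proof -
  let ?V = "ridge_inv \<beta> e X (gram n z)" and ?U = "hat_matrix \<beta> e X (gram n z)"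
  let ?u = "?V *v (transpose X *v axis i 1)"
  have "(X *v (?V *v z k)) $ i = z k \<bullet> ?u"
    using inner_matrix_symmetric[OF transpose_ridge_inv[OF assms(1)], of "z k" "transpose X *v axis i 1"]
      inner_transpose_mult[of "?V *v z k" X "axis i 1"]
    by (simp add: inner_axis inner_axis' inner_commute)
  then have "((X *v (?V *v z k)) $ i)\<^sup>2 \<le> (\<Sum>k<n. (z k \<bullet> ?u)\<^sup>2)"
    using assms(4) by (simp add: member_le_sum[of k "{..<n}" "\<lambda>k. (z k \<bullet> ?u)\<^sup>2"])
  also have "\<dots> = ?u \<bullet> (gram n z *v ?u)" by (simp add: inner_gram)
  also have "\<dots> \<le> axis i 1 \<bullet> (?U *v axis i 1)"
  proof -
    have "0 \<le> \<beta> * (norm (?U *v axis i 1))\<^sup>2" using assms(2) by simp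
    then show ?thesis
      using hat_matrix_quadratic[OF assms(1) pos_semidef_gram_vectors assms(2,3), of "axis i 1"] by linarith
  qed
  also have "\<dots> \<le> norm (?U *v axis i 1)"
    using norm_cauchy_schwarz[of "axis i 1" "?U *v axis i 1"] by simp
  also have "\<dots> \<le> 1 / \<beta>"
    using norm_hat_matrix_le[OF assms(1) pos_semidef_gram_vectors assms(2,3), of "axis i 1"] by simp
  finally have *: "((X *v (?V *v z k)) $ i)\<^sup>2 \<le> 1 / \<beta>" .
  \<comment> \<open>This turns the bound on the square into one on the component, and gives the constant.\<close>
  have "\<bar>y\<bar> \<le> 1 + y\<^sup>2" for y :: real
  proof -
    have "0 \<le> (\<bar>y\<bar> - 1)\<^sup>2 + 1 + y\<^sup>2" by simp
    moreover have "(\<bar>y\<bar> - 1)\<^sup>2 = y\<^sup>2 - 2 * \<bar>y\<bar> + 1" by (simp add: power2_eq_square algebra_simps)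
    ultimately show ?thesis by linarith
  qed
  from order_trans[OF this add_left_mono[OF *]] show ?thesis .
qed

lemma trace_hat_matrix: "trace (ridge_inv \<beta> e X S ** (transpose X ** X)) = trace (hat_matrix \<beta> e X S)"
  using trace_mul_sym[of "ridge_inv \<beta> e X S ** transpose X" X] by (simp add: hat_matrix_def matrix_mul_assoc)

lemma trace_V_gram: "trace (V ** gram n z) = (\<Sum>k<n. z k \<bullet> (V *v z k))"
  by (simp add: gram_def sum_matrix_mult_left trace_sum matrix_mul_outer)
    (simp add: trace_def inner_vec_def mult.commute)

text \<open>The trace of \<open>V W = I\<close>, split according to the three terms of \<open>W\<close>.\<close>

lemma trace_identity:
  assumes "pos_def (ridge \<beta> e X (S :: real^'p^'p))"
  shows "trace (ridge_inv \<beta> e X S ** S) + \<beta> * trace (hat_matrix \<beta> e X S) + e * trace (ridge_inv \<beta> e X S) = real CARD('p)"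
proof -
  have "trace (ridge_inv \<beta> e X S ** ridge \<beta> e X S) = real CARD('p)"
    by (simp add: ridge_mult_ridge_inv[OF assms] trace_I)
  then show ?thesis
    by (simp add: ridge_def matrix_ring trace_add trace_scaleR trace_hat_matrix)
qed

lemma trace_V_gram_bounds:
  fixes X :: "real^'p^'m"
  assumes "pos_def (ridge \<beta> e X (gram n z))" "\<beta> > 0" "e \<ge> 0"
  shows "0 \<le> trace (ridge_inv \<beta> e X (gram n z) ** gram n z)"
    "trace (ridge_inv \<beta> e X (gram n z) ** gram n z) \<le> real CARD('p)"
proof -
  have "0 \<le> trace (hat_matrix \<beta> e X (gram n z))"
    unfolding trace_def diag_nth inner_hat_matrix by (intro sum_nonneg inner_ridge_inv_nonneg[OF assms(1)])
  moreover have "0 \<le> trace (ridge_inv \<beta> e X (gram n z))"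
    unfolding trace_def diag_nth by (intro sum_nonneg inner_ridge_inv_nonneg[OF assms(1)])
  ultimately show "trace (ridge_inv \<beta> e X (gram n z) ** gram n z) \<le> real CARD('p)"
    using trace_identity[OF assms(1)] assms(2,3) mult_nonneg_nonneg[of \<beta> "trace (hat_matrix \<beta> e X (gram n z))"]
      mult_nonneg_nonneg[of e "trace (ridge_inv \<beta> e X (gram n z))"] by linarith
  show "0 \<le> trace (ridge_inv \<beta> e X (gram n z) ** gram n z)"
    unfolding trace_V_gram by (intro sum_nonneg inner_ridge_inv_nonneg[OF assms(1)])
qed

section \<open>Random variables of polynomial growth\<close>

text \<open>The rows of \<open>X\<close>, and the normal vectors of which \<open>S\<close> is made.\<close>

type_synonym ('p, 'm) sample = "('m \<Rightarrow> real^'p) \<times> (nat \<Rightarrow> real^'p)"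

definition sample_sets :: "nat \<Rightarrow> ('p::finite, 'm::finite) sample measure" where
  "sample_sets n = (\<Pi>\<^sub>M i\<in>UNIV. borel) \<Otimes>\<^sub>M (\<Pi>\<^sub>M k\<in>{..<n}. borel)"

text \<open>A bound by a power of the growth weights, uniform over the parameter \<open>e\<close> in \<open>E\<close>.  With \<open>E = {e}\<close> it gives
  integrability for one regularisation, with all positive \<open>e\<close> it gives the integrable majorant for the
  limit; the same closure rules serve both.\<close>

definition moderate :: "nat \<Rightarrow> real set \<Rightarrow> (real \<Rightarrow> ('p::finite, 'm::finite) sample \<Rightarrow> real) \<Rightarrow> bool" where
  "moderate n E F \<longleftrightarrow> (\<forall>e\<in>E. F e \<in> borel_measurable (sample_sets n)) \<and>
     (\<exists>C K. \<forall>e\<in>E. \<forall>r z. \<bar>F e (r, z)\<bar> \<le> C * (growth UNIV r * growth {..<n} z) ^ K)"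

abbreviation weight :: "nat \<Rightarrow> ('m::finite \<Rightarrow> real^'p) \<Rightarrow> (nat \<Rightarrow> real^'p) \<Rightarrow> real" where
  "weight n r z \<equiv> growth UNIV r * growth {..<n} z"

lemma weight_ge_1: "1 \<le> weight n r z"
  using mult_mono[OF growth_ge_1[of UNIV r] growth_ge_1[of "{..<n}" z]] growth_ge_1[of UNIV r] by simp

lemma moderateI:
  assumes "\<And>e. e \<in> E \<Longrightarrow> F e \<in> borel_measurable (sample_sets n)"
    and "\<And>e r z. e \<in> E \<Longrightarrow> \<bar>F e (r, z)\<bar> \<le> C * weight n r z ^ K"
  shows "moderate n E F"
  using assms unfolding moderate_def by blast

lemma moderateE:
  assumes "moderate n E F"
  obtains C K where "C \<ge> 0" "\<And>e r z. e \<in> E \<Longrightarrow> \<bar>F e (r, z)\<bar> \<le> C * weight n r z ^ K"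
proof -
  obtain C K where *: "\<And>e r z. e \<in> E \<Longrightarrow> \<bar>F e (r, z)\<bar> \<le> C * weight n r z ^ K"
    using assms unfolding moderate_def by blast
  show ?thesis
  proof (rule that[of "max 0 C" K])
    fix e r z assume "e \<in> E"
    then have "\<bar>F e (r, z)\<bar> \<le> C * weight n r z ^ K" by (rule *)
    also have "\<dots> \<le> max 0 C * weight n r z ^ K"
      using weight_ge_1[of r n z] by (intro mult_right_mono) auto
    finally show "\<bar>F e (r, z)\<bar> \<le> max 0 C * weight n r z ^ K" .
  qed simp
qed

lemma moderate_common_bound:
  assumes "moderate n {e} u" "moderate n {e} v"
  obtains C K where "\<And>r z. \<bar>u e (r, z)\<bar> \<le> C * weight n r z ^ K" "\<And>r z. \<bar>v e (r, z)\<bar> \<le> C * weight n r z ^ K"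
proof -
  obtain C K where C: "C \<ge> 0" "\<And>r z. \<bar>u e (r, z)\<bar> \<le> C * weight n r z ^ K"
    using moderateE[OF assms(1)] by (metis singletonI)
  obtain D L where D: "D \<ge> 0" "\<And>r z. \<bar>v e (r, z)\<bar> \<le> D * weight n r z ^ L"
    using moderateE[OF assms(2)] by (metis singletonI)
  show ?thesis
  proof
    show "\<bar>u e (r, z)\<bar> \<le> (C + D) * weight n r z ^ (K + L)" for r z
      using C(1) D(1) weight_ge_1[of r n z]
      by (intro order_trans[OF C(2)] mult_mono power_increasing) auto
    show "\<bar>v e (r, z)\<bar> \<le> (C + D) * weight n r z ^ (K + L)" for r z
      using C(1) D(1) weight_ge_1[of r n z]
      by (intro order_trans[OF D(2)] mult_mono power_increasing) auto
  qed
qed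

lemma moderate_measurable: "moderate n E F \<Longrightarrow> e \<in> E \<Longrightarrow> F e \<in> borel_measurable (sample_sets n)"
  by (simp add: moderate_def)

lemma moderate_subset: "moderate n E F \<Longrightarrow> E' \<subseteq> E \<Longrightarrow> moderate n E' F"
  unfolding moderate_def by blast

lemma moderate_const: "moderate n E (\<lambda>e \<omega>. c)"
  by (rule moderateI[where C = "\<bar>c\<bar>" and K = 0]) auto

lemma moderate_add:
  fixes F G :: "real \<Rightarrow> ('p::finite, 'm::finite) sample \<Rightarrow> real"
  assumes "moderate n E F" "moderate n E G"
  shows "moderate n E (\<lambda>e \<omega>. F e \<omega> + G e \<omega>)"
proof -
  obtain C K where F: "C \<ge> 0" "\<And>e r z. e \<in> E \<Longrightarrow> \<bar>F e (r, z)\<bar> \<le> C * weight n r z ^ K"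
    using moderateE[OF assms(1)] by metis
  obtain D L where G: "D \<ge> 0" "\<And>e r z. e \<in> E \<Longrightarrow> \<bar>G e (r, z)\<bar> \<le> D * weight n r z ^ L"
    using moderateE[OF assms(2)] by metis
  show ?thesis
  proof (rule moderateI)
    fix e and r :: "'m \<Rightarrow> real^'p" and z assume e: "e \<in> E"
    have "\<bar>F e (r, z) + G e (r, z)\<bar> \<le> C * weight n r z ^ K + D * weight n r z ^ L"
      using F(2)[OF e, of r z] G(2)[OF e, of r z] by linarith
    also have "\<dots> \<le> C * weight n r z ^ (K + L) + D * weight n r z ^ (K + L)"
      using F(1) G(1) weight_ge_1[of r n z] by (intro add_mono mult_left_mono power_increasing) auto
    finally show "\<bar>F e (r, z) + G e (r, z)\<bar> \<le> (C + D) * weight n r z ^ (K + L)"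
      by (simp add: algebra_simps)
  qed (intro borel_measurable_add moderate_measurable[OF assms(1)] moderate_measurable[OF assms(2)])
qed

lemma moderate_mult:
  fixes F G :: "real \<Rightarrow> ('p::finite, 'm::finite) sample \<Rightarrow> real"
  assumes "moderate n E F" "moderate n E G"
  shows "moderate n E (\<lambda>e \<omega>. F e \<omega> * G e \<omega>)"
proof -
  obtain C K where F: "C \<ge> 0" "\<And>e r z. e \<in> E \<Longrightarrow> \<bar>F e (r, z)\<bar> \<le> C * weight n r z ^ K"
    using moderateE[OF assms(1)] by metis
  obtain D L where G: "D \<ge> 0" "\<And>e r z. e \<in> E \<Longrightarrow> \<bar>G e (r, z)\<bar> \<le> D * weight n r z ^ L"
    using moderateE[OF assms(2)] by metis
  show ?thesis
  proof (rule moderateI)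
    fix e and r :: "'m \<Rightarrow> real^'p" and z assume e: "e \<in> E"
    have "\<bar>F e (r, z)\<bar> * \<bar>G e (r, z)\<bar> \<le> (C * weight n r z ^ K) * (D * weight n r z ^ L)"
      using F(1) weight_ge_1[of r n z] by (intro mult_mono F(2)[OF e] G(2)[OF e]) auto
    then show "\<bar>F e (r, z) * G e (r, z)\<bar> \<le> (C * D) * weight n r z ^ (K + L)"
      by (simp add: abs_mult power_add mult_ac)
  qed (intro borel_measurable_times moderate_measurable[OF assms(1)] moderate_measurable[OF assms(2)])
qed

lemma moderate_cmult: "moderate n E F \<Longrightarrow> moderate n E (\<lambda>e \<omega>. c * F e \<omega>)"
  by (rule moderate_mult[OF moderate_const])

lemma moderate_minus: "moderate n E F \<Longrightarrow> moderate n E (\<lambda>e \<omega>. - F e \<omega>)"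
  using moderate_cmult[of n E F "-1"] by simp

lemma moderate_diff: "moderate n E F \<Longrightarrow> moderate n E G \<Longrightarrow> moderate n E (\<lambda>e \<omega>. F e \<omega> - G e \<omega>)"
  using moderate_add[OF _ moderate_minus, of n E F G] by simp

lemma moderate_sum: "(\<And>k. k \<in> I \<Longrightarrow> moderate n E (F k)) \<Longrightarrow> moderate n E (\<lambda>e \<omega>. \<Sum>k\<in>I. F k e \<omega>)"
  by (induction I rule: infinite_finite_induct) (auto intro: moderate_const moderate_add)

definition moderate_vec :: "nat \<Rightarrow> real set \<Rightarrow> (real \<Rightarrow> ('p::finite, 'm::finite) sample \<Rightarrow> real^'a) \<Rightarrow> bool" where
  "moderate_vec n E F \<longleftrightarrow> (\<forall>i. moderate n E (\<lambda>e \<omega>. F e \<omega> $ i))"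

definition moderate_mat :: "nat \<Rightarrow> real set \<Rightarrow> (real \<Rightarrow> ('p::finite, 'm::finite) sample \<Rightarrow> real^'a^'b) \<Rightarrow> bool" where
  "moderate_mat n E F \<longleftrightarrow> (\<forall>i j. moderate n E (\<lambda>e \<omega>. F e \<omega> $ i $ j))"

lemma moderate_mat_nth: "moderate_mat n E F \<Longrightarrow> moderate n E (\<lambda>e \<omega>. F e \<omega> $ i $ j)"
  by (simp add: moderate_mat_def)

lemma moderate_vec_nth: "moderate_vec n E F \<Longrightarrow> moderate n E (\<lambda>e \<omega>. F e \<omega> $ i)"
  by (simp add: moderate_vec_def)

lemma moderate_mat_subset: "moderate_mat n E F \<Longrightarrow> E' \<subseteq> E \<Longrightarrow> moderate_mat n E' F"
  unfolding moderate_mat_def using moderate_subset by blast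

lemma moderate_mat_const: "moderate_mat n E (\<lambda>e \<omega>. A)"
  by (simp add: moderate_mat_def moderate_const)

lemma moderate_vec_const: "moderate_vec n E (\<lambda>e \<omega>. v)"
  by (simp add: moderate_vec_def moderate_const)

lemma moderate_mat_add: "moderate_mat n E F \<Longrightarrow> moderate_mat n E G \<Longrightarrow> moderate_mat n E (\<lambda>e \<omega>. F e \<omega> + G e \<omega>)"
  by (simp add: moderate_mat_def moderate_add)

lemma moderate_mat_diff: "moderate_mat n E F \<Longrightarrow> moderate_mat n E G \<Longrightarrow> moderate_mat n E (\<lambda>e \<omega>. F e \<omega> - G e \<omega>)"
  by (simp add: moderate_mat_def moderate_diff)

lemma moderate_mat_minus: "moderate_mat n E F \<Longrightarrow> moderate_mat n E (\<lambda>e \<omega>. - F e \<omega>)"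
  by (simp add: moderate_mat_def moderate_minus)

lemma moderate_mat_scaleR: "moderate n E f \<Longrightarrow> moderate_mat n E F \<Longrightarrow> moderate_mat n E (\<lambda>e \<omega>. f e \<omega> *\<^sub>R F e \<omega>)"
  by (simp add: moderate_mat_def moderate_mult)

lemma moderate_mat_mult: "moderate_mat n E F \<Longrightarrow> moderate_mat n E G \<Longrightarrow> moderate_mat n E (\<lambda>e \<omega>. F e \<omega> ** G e \<omega>)"
  by (simp add: moderate_mat_def matrix_matrix_mult_def moderate_sum moderate_mult)

lemma moderate_mat_transpose: "moderate_mat n E F \<Longrightarrow> moderate_mat n E (\<lambda>e \<omega>. transpose (F e \<omega>))"
  by (simp add: moderate_mat_def transpose_def)

lemma moderate_mat_outer: "moderate_vec n E F \<Longrightarrow> moderate_vec n E G \<Longrightarrow> moderate_mat n E (\<lambda>e \<omega>. outer (F e \<omega>) (G e \<omega>))"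
  by (simp add: moderate_mat_def moderate_vec_def moderate_mult)

lemma moderate_mat_sum: "(\<And>k. k \<in> I \<Longrightarrow> moderate_mat n E (F k)) \<Longrightarrow> moderate_mat n E (\<lambda>e \<omega>. \<Sum>k\<in>I. F k e \<omega>)"
  by (simp add: moderate_mat_def moderate_sum)

lemma moderate_trace: "moderate_mat n E F \<Longrightarrow> moderate n E (\<lambda>e \<omega>. trace (F e \<omega>))"
  by (simp add: moderate_mat_def trace_def moderate_sum)

lemma moderate_vec_mult: "moderate_mat n E F \<Longrightarrow> moderate_vec n E G \<Longrightarrow> moderate_vec n E (\<lambda>e \<omega>. F e \<omega> *v G e \<omega>)"
  by (simp add: moderate_mat_def moderate_vec_def matrix_vector_mult_def moderate_sum moderate_mult)

lemma moderate_vec_add: "moderate_vec n E F \<Longrightarrow> moderate_vec n E G \<Longrightarrow> moderate_vec n E (\<lambda>e \<omega>. F e \<omega> + G e \<omega>)"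
  by (simp add: moderate_vec_def moderate_add)

lemma moderate_vec_diff: "moderate_vec n E F \<Longrightarrow> moderate_vec n E G \<Longrightarrow> moderate_vec n E (\<lambda>e \<omega>. F e \<omega> - G e \<omega>)"
  by (simp add: moderate_vec_def moderate_diff)

definition rowmat :: "('m::finite \<Rightarrow> real^'p) \<Rightarrow> real^'p^'m" where
  "rowmat r = (\<chi> i. r i)"

lemma rowmat_nth [simp]: "rowmat r $ i = r i"
  by (simp add: rowmat_def)

abbreviation obs_X :: "('p::finite, 'm::finite) sample \<Rightarrow> real^'p^'m" where
  "obs_X \<omega> \<equiv> rowmat (fst \<omega>)"

abbreviation obs_S :: "nat \<Rightarrow> ('p::finite, 'm::finite) sample \<Rightarrow> real^'p^'p" where
  "obs_S n \<omega> \<equiv> gram n (snd \<omega>)"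

lemma measurable_fst_nth: "(\<lambda>\<omega>. fst \<omega> i) \<in> borel_measurable (sample_sets n)"
  unfolding sample_sets_def by measurable

lemma measurable_snd_nth: "k < n \<Longrightarrow> (\<lambda>\<omega>. snd \<omega> k) \<in> borel_measurable (sample_sets n)"
  unfolding sample_sets_def by measurable

lemma measurable_obs_X [measurable]: "obs_X \<in> borel_measurable (sample_sets n)"
  unfolding rowmat_def by (intro measurable_vec_lambda measurable_fst_nth)

lemma measurable_obs_S [measurable]: "obs_S n \<in> borel_measurable (sample_sets n)"
  unfolding gram_def by (intro borel_measurable_sum measurable_outer measurable_snd_nth) auto

lemma measurable_ridge_inv [measurable (raw)]:
  assumes [measurable]: "f \<in> borel_measurable M" "g \<in> borel_measurable M"
  shows "(\<lambda>x. ridge_inv \<beta> e (f x) (g x)) \<in> borel_measurable M"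
  unfolding ridge_inv_def ridge_def by measurable

lemma measurable_hat_matrix [measurable (raw)]:
  assumes [measurable]: "f \<in> borel_measurable M" "g \<in> borel_measurable M"
  shows "(\<lambda>x. hat_matrix \<beta> e (f x) (g x)) \<in> borel_measurable M"
  unfolding hat_matrix_def by measurable

lemma moderate_mat_obs_X: "moderate_mat n E (\<lambda>e. obs_X)"
  unfolding moderate_mat_def
proof (intro allI)
  fix i j
  show "moderate n E (\<lambda>e \<omega>. obs_X \<omega> $ i $ j)"
  proof (rule moderateI[where C = 1 and K = 1])
    show "\<bar>obs_X (r, z) $ i $ j\<bar> \<le> 1 * weight n r z ^ 1" for r z
    proof -
      have "\<bar>r i $ j\<bar> \<le> norm (r i)" by (rule component_le_norm_cart)
      also have "\<dots> \<le> growth UNIV r" by (rule norm_le_growth) auto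
      also have "\<dots> \<le> weight n r z"
        using growth_ge_1[of UNIV r] growth_ge_1[of "{..<n}" z] by (simp add: mult_le_cancel_left1)
      finally show ?thesis by simp
    qed
  qed measurable
qed

lemma moderate_vec_z: "k < n \<Longrightarrow> moderate_vec n E (\<lambda>e \<omega>. snd \<omega> k)"
  unfolding moderate_vec_def
proof (intro allI)
  fix j assume k: "k < n"
  show "moderate n E (\<lambda>e \<omega>. snd \<omega> k $ j)"
  proof (rule moderateI[where C = 1 and K = 1])
    show "(\<lambda>\<omega>. snd \<omega> k $ j) \<in> borel_measurable (sample_sets n)"
      using measurable_snd_nth[OF k] by measurable
    show "\<bar>snd (r, z) k $ j\<bar> \<le> 1 * weight n r z ^ 1" for r z
    proof -
      have "\<bar>z k $ j\<bar> \<le> norm (z k)" by (rule component_le_norm_cart)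
      also have "\<dots> \<le> growth {..<n} z" using k by (intro norm_le_growth) auto
      also have "\<dots> \<le> weight n r z"
        using growth_ge_1[of UNIV r] growth_ge_1[of "{..<n}" z] by (simp add: mult_le_cancel_right1)
      finally show ?thesis by simp
    qed
  qed
qed

lemma moderate_mat_ridge_inv:
  assumes "\<beta> > 0" "e > 0"
  shows "moderate_mat n {e} (\<lambda>e \<omega>. ridge_inv \<beta> e (obs_X \<omega>) (obs_S n \<omega>))"
  unfolding moderate_mat_def
  using ridge_inv_nth_bound[OF pos_def_ridge_gram[OF assms] pos_semidef_gram_vectors assms]
  by (intro allI moderateI[where C = "1 / e" and K = 0]) auto

lemma moderate_mat_hat_matrix:
  assumes "\<beta> > 0"
  shows "moderate_mat n {0<..} (\<lambda>e \<omega>. hat_matrix \<beta> e (obs_X \<omega>) (obs_S n \<omega>))"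
  unfolding moderate_mat_def
  using hat_matrix_nth_bound[OF pos_def_ridge_gram[OF assms] pos_semidef_gram_vectors assms]
  by (intro allI moderateI[where C = "1 / \<beta>" and K = 0]) auto

lemma moderate_XVz:
  assumes "\<beta> > 0" "k < n"
  shows "moderate_vec n {0<..} (\<lambda>e \<omega>. obs_X \<omega> *v (ridge_inv \<beta> e (obs_X \<omega>) (obs_S n \<omega>) *v snd \<omega> k))"
  unfolding moderate_vec_def
proof (intro allI moderateI[where C = "1 + 1 / \<beta>" and K = 0])
  show "(\<lambda>\<omega>. (obs_X \<omega> *v (ridge_inv \<beta> e (obs_X \<omega>) (obs_S n \<omega>) *v snd \<omega> k)) $ i) \<in> borel_measurable (sample_sets n)" for i e
    using measurable_snd_nth[OF assms(2)] by measurable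
qed (use XVz_bound[OF pos_def_ridge_gram[OF assms(1)] assms(1) _ assms(2)] in auto)

lemma moderate_trace_VS:
  assumes "\<beta> > 0"
  shows "moderate n {0<..} (\<lambda>e (\<omega> :: ('p::finite, 'm::finite) sample). trace (ridge_inv \<beta> e (obs_X \<omega>) (obs_S n \<omega>) ** obs_S n \<omega>))"
proof (rule moderateI[where C = "real CARD('p)" and K = 0])
  fix e :: real and r :: "'m \<Rightarrow> real^'p" and z :: "nat \<Rightarrow> real^'p" assume "e \<in> {0<..}"
  then show "\<bar>trace (ridge_inv \<beta> e (obs_X (r, z)) (obs_S n (r, z)) ** obs_S n (r, z))\<bar> \<le> real CARD('p) * weight n r z ^ 0"
    using trace_V_gram_bounds[OF pos_def_ridge_gram[OF assms] assms, of e "rowmat r" n z] by simp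
qed measurable

section \<open>Integration by parts over the sample\<close>

locale sampling =
  fixes n :: nat and \<Theta> :: "real^'p::finite^'m::finite" and \<Sigma> :: "real^'p^'p"
  assumes pd: "pos_def \<Sigma>"
begin

text \<open>The laws of the rows of \<open>X\<close> and of the vectors \<open>z\<^sub>k\<close>, and the joint law, of which \<open>model\<close> is an image (\<open>model_eq\<close>).\<close>

definition PX :: "('m \<Rightarrow> real^'p) measure" where
  "PX = (\<Pi>\<^sub>M i\<in>UNIV. multi_normal (\<Theta> $ i) \<Sigma>)"

definition PZ :: "(nat \<Rightarrow> real^'p) measure" where
  "PZ = (\<Pi>\<^sub>M k\<in>{..<n}. multi_normal 0 \<Sigma>)"

definition Q :: "('p, 'm) sample measure" where
  "Q = PX \<Otimes>\<^sub>M PZ"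

abbreviation "M \<equiv> matrix_inv \<Sigma>"

sublocale X: product_sigma_finite "\<lambda>i. multi_normal (\<Theta> $ i) \<Sigma>"
  by (rule product_sigma_finite_multi_normal[OF pd])

sublocale Z: product_sigma_finite "\<lambda>k::nat. multi_normal 0 \<Sigma>"
  by (rule product_sigma_finite_multi_normal[OF pd])

sublocale P: pair_sigma_finite PX PZ
  unfolding pair_sigma_finite_def PX_def PZ_def
  using X.sigma_finite[of UNIV] Z.sigma_finite[of "{..<n}"] by auto

lemma sets_PX [measurable_cong]: "sets PX = sets (\<Pi>\<^sub>M i\<in>UNIV. borel)"
  unfolding PX_def by (rule sets_PiM_multi_normal)

lemma sets_PZ [measurable_cong]: "sets PZ = sets (\<Pi>\<^sub>M k\<in>{..<n}. borel)"
  unfolding PZ_def by (rule sets_PiM_multi_normal)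

lemma sets_Q [measurable_cong]: "sets Q = sets (sample_sets n)"
  unfolding Q_def sample_sets_def by (intro sets_pair_measure_cong sets_PX sets_PZ)

lemma measurable_Q: "f \<in> borel_measurable (sample_sets n) \<Longrightarrow> f \<in> borel_measurable Q"
  by (simp add: measurable_cong_sets[OF sets_Q refl])

lemma integrable_growth_Q: "integrable Q (\<lambda>(r, z). C * weight n r z ^ K)"
proof -
  have X: "integrable PX (\<lambda>r. growth UNIV r ^ K)"
    unfolding PX_def by (intro integrable_PiM_multi_normal_growth pd) auto
  have Z: "integrable PZ (\<lambda>z. growth {..<n} z ^ K)"
    unfolding PZ_def by (intro integrable_PiM_multi_normal_growth pd) auto
  have [measurable]: "(\<lambda>r. growth UNIV r ^ K) \<in> borel_measurable PX" "(\<lambda>z. growth {..<n} z ^ K) \<in> borel_measurable PZ"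
    using X Z by auto
  have abs: "\<bar>growth I r\<bar> = growth I r" for I and r :: "'i \<Rightarrow> real^'p"
    using growth_ge_1[of I r] by simp
  have "integrable (PX \<Otimes>\<^sub>M PZ) (\<lambda>(r, z). C * (growth UNIV r ^ K * growth {..<n} z ^ K))"
    by (rule P.Fubini_integrable) (auto simp: abs_mult power_abs abs intro!: X Z)
  then show ?thesis
    by (simp add: Q_def power_mult_distrib)
qed

lemma integrable_moderate:
  assumes "moderate n E F" "e \<in> E"
  shows "integrable Q (F e)"
proof -
  obtain C K where C: "\<And>e r z. e \<in> E \<Longrightarrow> \<bar>F e (r, z)\<bar> \<le> C * weight n r z ^ K"
    using moderateE[OF assms(1)] by metis
  show ?thesis
  proof (rule Bochner_Integration.integrable_bound[OF integrable_growth_Q[of C K]])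
    show "F e \<in> borel_measurable Q"
      by (intro measurable_Q moderate_measurable[OF assms])
    show "AE \<omega> in Q. norm (F e \<omega>) \<le> norm (case \<omega> of (r, z) \<Rightarrow> C * weight n r z ^ K)"
      using C[OF assms(2)] by (intro AE_I2) (auto intro: order_trans[OF _ abs_ge_self])
  qed
qed

lemma moderate_score_X: "moderate n E (\<lambda>e \<omega>. (A *v (fst \<omega> i - \<mu>)) $ a)"
proof -
  have "moderate_vec n E (\<lambda>e \<omega>. obs_X \<omega> $ i)"
    using moderate_mat_obs_X[of n E] unfolding moderate_vec_def moderate_mat_def by blast
  then have "moderate_vec n E (\<lambda>e \<omega>. A *v (obs_X \<omega> $ i - \<mu>))"
    by (intro moderate_vec_mult moderate_vec_diff moderate_mat_const moderate_vec_const)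
  then show ?thesis
    using moderate_vec_nth by fastforce
qed

lemma moderate_score_Z: "k < n \<Longrightarrow> moderate n E (\<lambda>e \<omega>. (A *v snd \<omega> k) $ a)"
  by (intro moderate_vec_nth moderate_vec_mult moderate_mat_const moderate_vec_z)

text \<open>Fubini reduces this to the product of the laws of the rows, with the vectors \<open>z\<^sub>k\<close> fixed.\<close>

lemma stein_X_component:
  assumes u: "moderate n {e} u" and u': "moderate n {e} u'"
    and deriv: "\<And>r z. ((\<lambda>t. u e (r(i := r i + t *\<^sub>R axis a 1), z)) has_real_derivative u' e (r, z)) (at 0)"
  shows "(\<integral>\<omega>. (M *v (fst \<omega> i - \<Theta> $ i)) $ a * u e \<omega> \<partial>Q) = (\<integral>\<omega>. u' e \<omega> \<partial>Q)"
proof -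
  obtain C K where C: "\<And>r z. \<bar>u e (r, z)\<bar> \<le> C * weight n r z ^ K" "\<And>r z. \<bar>u' e (r, z)\<bar> \<le> C * weight n r z ^ K"
    using moderate_common_bound[OF u u'] by blast
  have "integrable Q (\<lambda>\<omega>. (M *v (fst \<omega> i - \<Theta> $ i)) $ a * u e \<omega>)"
    using integrable_moderate[OF moderate_mult[OF moderate_score_X[where A = M and i = i and \<mu> = "\<Theta> $ i" and a = a] u]] by simp
  then have 1: "(\<integral>\<omega>. (M *v (fst \<omega> i - \<Theta> $ i)) $ a * u e \<omega> \<partial>Q)
      = (\<integral>z. \<integral>r. (M *v (r i - \<Theta> $ i)) $ a * u e (r, z) \<partial>PX \<partial>PZ)"
    unfolding Q_def by (subst P.integral_snd) (simp_all add: case_prod_beta')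
  have "integrable Q (u' e)"
    by (rule integrable_moderate[OF u']) simp
  then have 2: "(\<integral>\<omega>. u' e \<omega> \<partial>Q) = (\<integral>z. \<integral>r. u' e (r, z) \<partial>PX \<partial>PZ)"
    unfolding Q_def by (subst P.integral_snd) (simp_all add: case_prod_beta')
  have "(\<integral>r. (M *v (r i - \<Theta> $ i)) $ a * u e (r, z) \<partial>PX) = (\<integral>r. u' e (r, z) \<partial>PX)"
    if z: "z \<in> space PZ" for z
  proof -
    have z': "z \<in> space (\<Pi>\<^sub>M k\<in>{..<n}. borel)"
      using z sets_eq_imp_space_eq[OF sets_PZ] by simp
    show ?thesis
      unfolding PX_def
    proof (rule stein_PiM_multi_normal[OF pd, where C = "C * growth {..<n} z ^ K" and K = K])
      have slice: "(\<lambda>r. (r, z)) \<in> measurable (\<Pi>\<^sub>M i\<in>UNIV. borel) (sample_sets n)"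
        unfolding sample_sets_def by (rule measurable_Pair2'[OF z'])
      show "(\<lambda>r. u e (r, z)) \<in> borel_measurable (\<Pi>\<^sub>M i\<in>UNIV. borel)"
        by (rule measurable_compose[OF slice moderate_measurable[OF u]]) simp
      show "(\<lambda>r. u' e (r, z)) \<in> borel_measurable (\<Pi>\<^sub>M i\<in>UNIV. borel)"
        by (rule measurable_compose[OF slice moderate_measurable[OF u']]) simp
      show "\<bar>u e (r, z)\<bar> \<le> C * growth {..<n} z ^ K * growth UNIV r ^ K" for r
        using C(1)[of r z] by (simp add: power_mult_distrib mult_ac)
      show "\<bar>u' e (r, z)\<bar> \<le> C * growth {..<n} z ^ K * growth UNIV r ^ K" for r
        using C(2)[of r z] by (simp add: power_mult_distrib mult_ac)
    qed (use deriv in auto)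
  qed
  then show ?thesis
    unfolding 1 2 by (rule Bochner_Integration.integral_cong[OF refl])
qed

lemma stein_Z_component:
  assumes k: "k < n" and u: "moderate n {e} u" and u': "moderate n {e} u'"
    and deriv: "\<And>r z. ((\<lambda>t. u e (r, z(k := z k + t *\<^sub>R axis a 1))) has_real_derivative u' e (r, z)) (at 0)"
  shows "(\<integral>\<omega>. (M *v snd \<omega> k) $ a * u e \<omega> \<partial>Q) = (\<integral>\<omega>. u' e \<omega> \<partial>Q)"
proof -
  obtain C K where C: "\<And>r z. \<bar>u e (r, z)\<bar> \<le> C * weight n r z ^ K" "\<And>r z. \<bar>u' e (r, z)\<bar> \<le> C * weight n r z ^ K"
    using moderate_common_bound[OF u u'] by blast
  have "integrable Q (\<lambda>\<omega>. (M *v snd \<omega> k) $ a * u e \<omega>)"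
    using integrable_moderate[OF moderate_mult[OF moderate_score_Z[OF k, where A = M and a = a] u]] by simp
  then have 1: "(\<integral>\<omega>. (M *v snd \<omega> k) $ a * u e \<omega> \<partial>Q)
      = (\<integral>r. \<integral>z. (M *v z k) $ a * u e (r, z) \<partial>PZ \<partial>PX)"
    unfolding Q_def by (subst P.integral_fst) (simp_all add: case_prod_beta')
  have "integrable Q (u' e)"
    by (rule integrable_moderate[OF u']) simp
  then have 2: "(\<integral>\<omega>. u' e \<omega> \<partial>Q) = (\<integral>r. \<integral>z. u' e (r, z) \<partial>PZ \<partial>PX)"
    unfolding Q_def by (subst P.integral_fst) (simp_all add: case_prod_beta')
  have "(\<integral>z. (M *v z k) $ a * u e (r, z) \<partial>PZ) = (\<integral>z. u' e (r, z) \<partial>PZ)"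
    if r: "r \<in> space PX" for r
  proof -
    have r': "r \<in> space (\<Pi>\<^sub>M i\<in>UNIV. borel)"
      using r sets_eq_imp_space_eq[OF sets_PX] by simp
    have "(\<integral>z. (M *v (z k - 0)) $ a * u e (r, z) \<partial>PZ) = (\<integral>z. u' e (r, z) \<partial>PZ)"
      unfolding PZ_def
    proof (rule stein_PiM_multi_normal[OF pd, where C = "C * growth UNIV r ^ K" and K = K and \<mu> = "\<lambda>_. 0"])
      have slice: "(\<lambda>z. (r, z)) \<in> measurable (\<Pi>\<^sub>M i\<in>{..<n}. borel) (sample_sets n)"
        unfolding sample_sets_def by (rule measurable_Pair1'[OF r'])
      show "(\<lambda>z. u e (r, z)) \<in> borel_measurable (\<Pi>\<^sub>M i\<in>{..<n}. borel)"
        by (rule measurable_compose[OF slice moderate_measurable[OF u]]) simp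
      show "(\<lambda>z. u' e (r, z)) \<in> borel_measurable (\<Pi>\<^sub>M i\<in>{..<n}. borel)"
        by (rule measurable_compose[OF slice moderate_measurable[OF u']]) simp
      show "\<bar>u e (r, z)\<bar> \<le> C * growth UNIV r ^ K * growth {..<n} z ^ K" for z
        using C(1)[of r z] by (simp add: power_mult_distrib mult_ac)
      show "\<bar>u' e (r, z)\<bar> \<le> C * growth UNIV r ^ K * growth {..<n} z ^ K" for z
        using C(2)[of r z] by (simp add: power_mult_distrib mult_ac)
    qed (use deriv k in auto)
    then show ?thesis by simp
  qed
  then show ?thesis
    unfolding 1 2 by (rule Bochner_Integration.integral_cong[OF refl])
qed

lemma dominated_limit:
  assumes F: "moderate n {0<..} F" and lim: "AE \<omega> in Q. ((\<lambda>N. F (inverse (real (Suc N))) \<omega>) \<longlonglongrightarrow> F 0 \<omega>)"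
    and [measurable]: "F 0 \<in> borel_measurable (sample_sets n)"
  shows "integrable Q (F 0)" "(\<lambda>N. \<integral>\<omega>. F (inverse (real (Suc N))) \<omega> \<partial>Q) \<longlonglongrightarrow> (\<integral>\<omega>. F 0 \<omega> \<partial>Q)"
proof -
  obtain C K where C: "\<And>e r z. e > 0 \<Longrightarrow> \<bar>F e (r, z)\<bar> \<le> C * weight n r z ^ K"
    using moderateE[OF F] by (metis greaterThan_iff)
  note * = measurable_Q[OF assms(3)] measurable_Q[OF moderate_measurable[OF F]] integrable_growth_Q[of C K] lim
  have b: "AE \<omega> in Q. norm (F (inverse (real (Suc N))) \<omega>) \<le> (case \<omega> of (r, z) \<Rightarrow> C * weight n r z ^ K)" for N
    using C[of "inverse (real (Suc N))"] by (intro AE_I2) auto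
  show "integrable Q (F 0)"
    by (rule integrable_dominated_convergence[OF *(1) _ *(3,4) b]) (rule *(2), simp)
  show "(\<lambda>N. \<integral>\<omega>. F (inverse (real (Suc N))) \<omega> \<partial>Q) \<longlonglongrightarrow> (\<integral>\<omega>. F 0 \<omega> \<partial>Q)"
    by (rule integral_dominated_convergence[OF *(1) _ *(3,4) b]) (rule *(2), simp)
qed

text \<open>Starting from \<open>A = 0\<close> the kernel has dimension \<open>p\<close>, and there are \<open>n \<ge> p\<close> vectors.\<close>

lemma AE_pos_def_obs_S:
  assumes "n \<ge> CARD('p)"
  shows "AE \<omega> in Q. pos_def (obs_S n \<omega>)"
proof -
  have "AE z in PZ. det (0 + (\<Sum>k\<in>{..<n}. outer (z k) (z k))) \<noteq> 0"
    unfolding PZ_def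
  proof (rule AE_det_add_sum_outer[OF pd, of "{..<n}" 0 "\<lambda>_. 0"])
    show "pos_semidef (0 :: real^'p^'p)" by (simp add: pos_semidef_def transpose_def vec_eq_iff)
    have "dim {x::real^'p. 0 *v x = 0} \<le> DIM(real^'p)" by (rule dim_subset_UNIV)
    then show "dim {x::real^'p. 0 *v x = 0} \<le> card {..<n}" using assms by simp
  qed simp
  then have z: "AE z in PZ. det (gram n z) \<noteq> 0" by (simp add: gram_def)
  have "AE \<omega> in PX \<Otimes>\<^sub>M PZ. det (obs_S n \<omega>) \<noteq> 0"
  proof (rule P.AE_pair_measure)
    have "{\<omega> \<in> space (sample_sets n). det (obs_S n \<omega>) \<noteq> 0} \<in> sets (sample_sets n)"
      by measurable
    then show "{\<omega> \<in> space (PX \<Otimes>\<^sub>M PZ). det (obs_S n \<omega>) \<noteq> 0} \<in> sets (PX \<Otimes>\<^sub>M PZ)"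
      using sets_Q sets_eq_imp_space_eq[OF sets_Q] unfolding Q_def by simp
    show "AE r in PX. AE z in PZ. det (obs_S n (r, z)) \<noteq> 0"
      using z by simp
  qed
  then have "AE \<omega> in Q. det (obs_S n \<omega>) \<noteq> 0" unfolding Q_def .
  then show ?thesis
  proof eventually_elim
    case (elim \<omega>)
    have ps: "pos_semidef (obs_S n \<omega>)" by (rule pos_semidef_gram_vectors)
    have "x = 0" if "x \<bullet> (obs_S n \<omega> *v x) = 0" for x
    proof -
      have "obs_S n \<omega> *v x = 0" by (rule pos_semidef_kernel[OF ps that])
      then show "x = 0"
        using elim by (metis invertible_det_nz invertible_left_inverse matrix_left_invertible_ker)
    qed
    then show "pos_def (obs_S n \<omega>)"
      using ps unfolding pos_def_def pos_semidef_def by (metis less_le)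
  qed
qed

end

lemma moderate_mat_cong:
  assumes "\<And>e \<omega>. e \<in> E \<Longrightarrow> F e \<omega> = G e \<omega>"
  shows "moderate_mat n E F \<longleftrightarrow> moderate_mat n E G"
proof -
  have "F e = G e" if "e \<in> E" for e using assms that by blast
  then show ?thesis by (simp add: moderate_mat_def moderate_def)
qed

lemma rowmat_upd: "rowmat (r(i := r i + t *\<^sub>R axis a 1)) = rowmat r + t *\<^sub>R unit_matrix i a"
  by (auto simp: vec_eq_iff unit_matrix_nth axis_def)

lemma gram_upd:
  assumes "k < n"
  shows "gram n (z(k := x)) = (\<Sum>l\<in>{..<n} - {k}. outer (z l) (z l)) + outer x x"
proof -
  have "gram n (z(k := x)) = outer x x + (\<Sum>l\<in>{..<n} - {k}. outer ((z(k := x)) l) ((z(k := x)) l))"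
    unfolding gram_def using assms by (subst sum.remove[of _ k]) auto
  also have "(\<Sum>l\<in>{..<n} - {k}. outer ((z(k := x)) l) ((z(k := x)) l)) = (\<Sum>l\<in>{..<n} - {k}. outer (z l) (z l))"
    by (intro sum.cong) auto
  finally show ?thesis by (simp only: add.commute)
qed

lemma mult_gram_mult: "B ** gram n z ** C = (\<Sum>k<n. outer (B *v z k) (transpose C *v z k))"
  by (simp add: gram_def sum_matrix_mult_left sum_matrix_mult_right outer_mul_matrix matrix_mul_outer)

section \<open>The two divergence identities and their limits\<close>

locale regularised = sampling n \<Theta> \<Sigma> for n and \<Theta> :: "real^'p::finite^'m::finite" and \<Sigma> +
  fixes \<beta> :: real
  assumes \<beta>: "\<beta> > 0"
begin

text \<open>In \<open>stein_lhs_Z\<close> the last three factors become \<open>G\<^sup>T\<close> at \<open>e = 0\<close>.  For \<open>e > 0\<close> it is this form, and not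
  \<open>G M G\<^sup>T\<close>, in which \<open>S\<close> provides the factors \<open>M z\<^sub>k\<close> and whose divergence is exactly \<open>stein_rhs_Z\<close>.\<close>

abbreviation U :: "real \<Rightarrow> ('p, 'm) sample \<Rightarrow> real^'m^'m" where "U e \<omega> \<equiv> hat_matrix \<beta> e (obs_X \<omega>) (obs_S n \<omega>)"
abbreviation V :: "real \<Rightarrow> ('p, 'm) sample \<Rightarrow> real^'p^'p" where "V e \<omega> \<equiv> ridge_inv \<beta> e (obs_X \<omega>) (obs_S n \<omega>)"
abbreviation G :: "real \<Rightarrow> ('p, 'm) sample \<Rightarrow> real^'p^'m" where "G e \<omega> \<equiv> correction \<beta> e (obs_X \<omega>) (obs_S n \<omega>)"
abbreviation T :: "real \<Rightarrow> ('p, 'm) sample \<Rightarrow> real^'m^'m" where "T e \<omega> \<equiv> obs_X \<omega> ** V e \<omega> ** obs_S n \<omega> ** V e \<omega> ** transpose (obs_X \<omega>)"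

definition "stein_lhs_X e \<omega> = G e \<omega> ** M ** transpose (obs_X \<omega> - \<Theta>)"
definition "stein_rhs_X e \<omega> = (real CARD('p) - \<beta> * trace (U e \<omega>)) *\<^sub>R (mat 1 - \<beta> *\<^sub>R U e \<omega>) - \<beta> *\<^sub>R (U e \<omega> ** (mat 1 - \<beta> *\<^sub>R U e \<omega>))"
definition "stein_lhs_Z e \<omega> = G e \<omega> ** M ** obs_S n \<omega> ** V e \<omega> ** transpose (obs_X \<omega>)"
definition "stein_rhs_Z e \<omega> = (real n - trace (V e \<omega> ** obs_S n \<omega>)) *\<^sub>R (G e \<omega> ** V e \<omega> ** transpose (obs_X \<omega>))
   - G e \<omega> ** V e \<omega> ** obs_S n \<omega> ** V e \<omega> ** transpose (obs_X \<omega>)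
   + \<beta> *\<^sub>R (U e \<omega> ** T e \<omega> + trace (U e \<omega>) *\<^sub>R T e \<omega>)"

lemma moderate_G: "moderate_mat n {0<..} G"
  unfolding correction_def
  by (intro moderate_mat_diff moderate_mat_scaleR moderate_mat_mult moderate_mat_obs_X moderate_mat_hat_matrix[OF \<beta>] moderate_const)

lemma moderate_stein_lhs_X: "moderate_mat n {0<..} stein_lhs_X"
  unfolding stein_lhs_X_def
  by (intro moderate_mat_diff moderate_mat_mult moderate_mat_transpose moderate_mat_obs_X moderate_G moderate_mat_const)

lemma moderate_stein_rhs_X: "moderate_mat n {0<..} stein_rhs_X"
  unfolding stein_rhs_X_def
  by (intro moderate_mat_diff moderate_mat_scaleR moderate_mat_mult moderate_mat_hat_matrix[OF \<beta>] moderate_const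
    moderate_mat_const moderate_diff moderate_cmult moderate_trace)

text \<open>Written as the sum of the \<open>z\<^sub>k (X V z\<^sub>k)\<^sup>T\<close>, this grows no faster than \<open>z\<^sub>k\<close>, uniformly in \<open>e\<close>; \<open>V\<close> itself is not so bounded.\<close>

lemma moderate_SVX: "moderate_mat n {0<..} (\<lambda>e \<omega>. obs_S n \<omega> ** V e \<omega> ** transpose (obs_X \<omega>))"
proof -
  have "obs_S n \<omega> ** V e \<omega> ** transpose (obs_X \<omega>) = (\<Sum>k<n. outer (snd \<omega> k) (obs_X \<omega> *v (V e \<omega> *v snd \<omega> k)))"
    if "e > 0" for e \<omega>
    using transpose_ridge_inv[OF pos_def_ridge_gram[OF \<beta> that], of "obs_X \<omega>" n "snd \<omega>"]
    using mult_gram_mult[of "mat 1" n "snd \<omega>" "V e \<omega> ** transpose (obs_X \<omega>)"]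
    by (simp add: matrix_transpose_mul matrix_vector_mul_assoc matrix_mul_assoc)
  moreover have "moderate_mat n {0<..} (\<lambda>e \<omega>. \<Sum>k<n. outer (snd \<omega> k) (obs_X \<omega> *v (V e \<omega> *v snd \<omega> k)))"
    by (intro moderate_mat_sum moderate_mat_outer moderate_vec_z moderate_XVz \<beta>) auto
  ultimately show ?thesis
    by (subst moderate_mat_cong) auto
qed

lemma moderate_T: "moderate_mat n {0<..} T"
proof -
  have "obs_X \<omega> ** V e \<omega> ** obs_S n \<omega> ** V e \<omega> ** transpose (obs_X \<omega>) = (\<Sum>k<n. outer (obs_X \<omega> *v (V e \<omega> *v snd \<omega> k)) (obs_X \<omega> *v (V e \<omega> *v snd \<omega> k)))"
    if "e > 0" for e \<omega>
    using transpose_ridge_inv[OF pos_def_ridge_gram[OF \<beta> that], of "obs_X \<omega>" n "snd \<omega>"]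
    using mult_gram_mult[of "obs_X \<omega> ** V e \<omega>" n "snd \<omega>" "V e \<omega> ** transpose (obs_X \<omega>)"]
    by (simp add: matrix_transpose_mul matrix_vector_mul_assoc matrix_mul_assoc)
  moreover have "moderate_mat n {0<..} (\<lambda>e \<omega>. \<Sum>k<n. outer (obs_X \<omega> *v (V e \<omega> *v snd \<omega> k)) (obs_X \<omega> *v (V e \<omega> *v snd \<omega> k)))"
    by (intro moderate_mat_sum moderate_mat_outer moderate_XVz \<beta>) auto
  ultimately show ?thesis
    by (subst moderate_mat_cong) auto
qed

lemma moderate_stein_lhs_Z: "moderate_mat n {0<..} stein_lhs_Z"
proof -
  have "moderate_mat n {0<..} (\<lambda>e \<omega>. G e \<omega> ** M ** (obs_S n \<omega> ** V e \<omega> ** transpose (obs_X \<omega>)))"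
    by (intro moderate_mat_mult moderate_SVX moderate_G moderate_mat_const)
  then show ?thesis by (simp add: stein_lhs_Z_def[abs_def] matrix_mul_assoc)
qed

lemma G_mult: "G e \<omega> ** B = obs_X \<omega> ** B - \<beta> *\<^sub>R (U e \<omega> ** (obs_X \<omega> ** B))"
  by (simp add: correction_def matrix_ring matrix_mul_assoc)

lemma moderate_stein_rhs_Z: "moderate_mat n {0<..} stein_rhs_Z"
proof -
  have "moderate_mat n {0<..} (\<lambda>e \<omega>. (real n - trace (V e \<omega> ** obs_S n \<omega>)) *\<^sub>R (U e \<omega> - \<beta> *\<^sub>R (U e \<omega> ** U e \<omega>))
     - (T e \<omega> - \<beta> *\<^sub>R (U e \<omega> ** T e \<omega>)) + \<beta> *\<^sub>R (U e \<omega> ** T e \<omega> + trace (U e \<omega>) *\<^sub>R T e \<omega>))"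
    by (intro moderate_mat_add moderate_mat_diff moderate_mat_scaleR moderate_mat_mult moderate_const
      moderate_diff moderate_trace_VS[OF \<beta>] moderate_trace moderate_mat_hat_matrix[OF \<beta>] moderate_T)
  moreover have "G e \<omega> ** V e \<omega> ** transpose (obs_X \<omega>) = U e \<omega> - \<beta> *\<^sub>R (U e \<omega> ** U e \<omega>)" for e \<omega>
    by (simp add: matrix_mul_assoc[symmetric] G_mult) (simp add: hat_matrix_def matrix_mul_assoc matrix_ring)
  moreover have "G e \<omega> ** V e \<omega> ** obs_S n \<omega> ** V e \<omega> ** transpose (obs_X \<omega>) = T e \<omega> - \<beta> *\<^sub>R (U e \<omega> ** T e \<omega>)" for e \<omega>
    by (simp add: G_mult matrix_ring matrix_mul_assoc)
  ultimately show ?thesis unfolding stein_rhs_Z_def[abs_def] by simp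
qed

lemma moderate_V: "e > 0 \<Longrightarrow> moderate_mat n {e} V"
  by (rule moderate_mat_ridge_inv[OF \<beta>])

lemma stein_X:
  assumes e: "e > 0"
  shows "(\<integral>\<omega>. stein_lhs_X e \<omega> $ j $ i \<partial>Q) = (\<integral>\<omega>. stein_rhs_X e \<omega> $ j $ i \<partial>Q)"
proof -
  have G: "moderate n {e} (\<lambda>e \<omega>. G e \<omega> $ j $ a)" for j a
    using moderate_mat_nth[OF moderate_mat_subset[OF moderate_G]] e by simp
  have pdW: "pos_def (ridge \<beta> e Y (gram n z))" for Y :: "real^'p^'m" and z
    using pos_def_ridge_gram[OF \<beta> e] .
  have U: "moderate_mat n {e} U"
    by (rule moderate_mat_subset[OF moderate_mat_hat_matrix[OF \<beta>]]) (use e in simp)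
  have dG: "moderate_mat n {e} (\<lambda>e (\<omega> :: ('p, 'm) sample). dcorrection_X \<beta> e (obs_X \<omega>) (obs_S n \<omega>) i a)" for a
    unfolding dcorrection_X_def Let_def
    by (intro moderate_mat_add moderate_mat_diff moderate_mat_scaleR moderate_mat_mult moderate_const
        moderate_mat_const moderate_mat_transpose moderate_mat_obs_X moderate_V[OF e] U)
  have stein_lhs_X: "stein_lhs_X e \<omega> $ j $ i = (\<Sum>a\<in>UNIV. (M *v (fst \<omega> i - \<Theta> $ i)) $ a * G e \<omega> $ j $ a)" for \<omega>
  proof -
    have *: "(M ** transpose (obs_X \<omega> - \<Theta>)) $ a $ i = (M *v (fst \<omega> i - \<Theta> $ i)) $ a" for a
      by (simp add: matrix_matrix_mult_def matrix_vector_mult_def transpose_def)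
    have "stein_lhs_X e \<omega> $ j $ i = (\<Sum>a\<in>UNIV. G e \<omega> $ j $ a * (M ** transpose (obs_X \<omega> - \<Theta>)) $ a $ i)"
      by (simp add: stein_lhs_X_def matrix_mul_assoc[symmetric]) (simp add: matrix_matrix_mult_def)
    then show ?thesis unfolding * by (simp add: mult.commute)
  qed
  have "(\<integral>\<omega>. stein_lhs_X e \<omega> $ j $ i \<partial>Q) = (\<Sum>a\<in>UNIV. \<integral>\<omega>. (M *v (fst \<omega> i - \<Theta> $ i)) $ a * G e \<omega> $ j $ a \<partial>Q)"
    unfolding stein_lhs_X
    by (intro Bochner_Integration.integral_sum integrable_moderate[OF moderate_mult[OF moderate_score_X G]]) simp
  also have "\<dots> = (\<Sum>a\<in>UNIV. \<integral>\<omega>. dcorrection_X \<beta> e (obs_X \<omega>) (obs_S n \<omega>) i a $ j $ a \<partial>Q)"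
  proof (intro sum.cong refl stein_X_component[where u = "\<lambda>e \<omega>. G e \<omega> $ j $ a" and u' = "\<lambda>e \<omega>. dcorrection_X \<beta> e (obs_X \<omega>) (obs_S n \<omega>) i a $ j $ a" for a])
    fix a
    show "moderate n {e} (\<lambda>e \<omega>. G e \<omega> $ j $ a)" by (rule G)
    show "moderate n {e} (\<lambda>e \<omega>. dcorrection_X \<beta> e (obs_X \<omega>) (obs_S n \<omega>) i a $ j $ a)"
      by (rule moderate_mat_nth[OF dG])
    fix r z
    show "((\<lambda>t. G e (r(i := r i + t *\<^sub>R axis a 1), z) $ j $ a) has_real_derivative dcorrection_X \<beta> e (obs_X (r, z)) (obs_S n (r, z)) i a $ j $ a) (at 0)"
      unfolding fst_conv snd_conv rowmat_upd
      by (rule has_real_derivative_nth has_vector_derivative_nth correction_derivative_X[OF pdW])+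
  qed
  also have "\<dots> = (\<integral>\<omega>. (\<Sum>a\<in>UNIV. dcorrection_X \<beta> e (obs_X \<omega>) (obs_S n \<omega>) i a $ j $ a) \<partial>Q)"
    by (intro Bochner_Integration.integral_sum[symmetric] integrable_moderate[OF moderate_mat_nth[OF dG]]) simp
  also have "\<dots> = (\<integral>\<omega>. stein_rhs_X e \<omega> $ j $ i \<partial>Q)"
    by (simp only: divergence_correction_X[OF pdW] stein_rhs_X_def)
  finally show ?thesis .
qed

lemma stein_Z:
  assumes e: "e > 0"
  shows "(\<integral>\<omega>. stein_lhs_Z e \<omega> $ j $ i \<partial>Q) = (\<integral>\<omega>. stein_rhs_Z e \<omega> $ j $ i \<partial>Q)"
proof -
  have G': "moderate_mat n {e} G"
    using moderate_mat_subset[OF moderate_G] e by simp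
  have pdW: "pos_def (ridge \<beta> e Y (gram n z))" for Y :: "real^'p^'m" and z
    using pos_def_ridge_gram[OF \<beta> e] .
  define u where "u = (\<lambda>k a e (\<omega> :: ('p, 'm) sample). (obs_X \<omega> *v (V e \<omega> *v snd \<omega> k)) $ i * G e \<omega> $ j $ a)"
  have u: "moderate n {e} (u k a)" if "k < n" for k a
    unfolding u_def
    by (intro moderate_mult moderate_vec_nth moderate_mat_nth moderate_vec_mult moderate_mat_obs_X moderate_V e G' moderate_vec_z that)
  define u' where "u' = (\<lambda>k a e (\<omega> :: ('p, 'm) sample). dproduct_Z \<beta> e (obs_X \<omega>) (obs_S n \<omega>) (snd \<omega> k) i j a)"
  have u': "moderate n {e} (u' k a)" if "k < n" for k a
    unfolding u'_def dproduct_Z_def dridge_inv_Z_def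
    by (intro moderate_diff moderate_mult moderate_vec_nth moderate_mat_nth moderate_vec_mult moderate_mat_obs_X moderate_V e G'
       moderate_vec_z that moderate_vec_add moderate_mat_mult moderate_mat_scaleR moderate_mat_transpose moderate_const
       moderate_mat_minus moderate_mat_add moderate_mat_outer moderate_vec_const)
  have stein_lhs_Z: "stein_lhs_Z e \<omega> $ j $ i = (\<Sum>k<n. \<Sum>a\<in>UNIV. (M *v snd \<omega> k) $ a * u k a e \<omega>)" for \<omega>
  proof -
    have "stein_lhs_Z e \<omega> = (\<Sum>k<n. (G e \<omega> ** M) ** outer (snd \<omega> k) (snd \<omega> k) ** (V e \<omega> ** transpose (obs_X \<omega>)))"
      by (simp add: stein_lhs_Z_def gram_def sum_matrix_mult_left sum_matrix_mult_right matrix_mul_assoc)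
    also have "\<dots> $ j $ i = (\<Sum>k<n. (G e \<omega> *v (M *v snd \<omega> k)) $ j * (obs_X \<omega> *v (V e \<omega> *v snd \<omega> k)) $ i)"
      using transpose_ridge_inv[OF pdW]
      by (simp add: matrix_mul_outer outer_mul_matrix matrix_transpose_mul matrix_vector_mul_assoc)
    also have "\<dots> = (\<Sum>k<n. \<Sum>a\<in>UNIV. (M *v snd \<omega> k) $ a * u k a e \<omega>)"
      by (intro sum.cong refl)
        (simp add: matrix_vector_mult_def[of "G e \<omega>"] u_def sum_distrib_left sum_distrib_right mult_ac)
    finally show ?thesis .
  qed
  have i1: "integrable Q (\<lambda>\<omega>. (M *v snd \<omega> k) $ a * u k a e \<omega>)" if "k < n" for k a
    using integrable_moderate[OF moderate_mult[OF moderate_score_Z[OF that, where A = M and a = a] u[OF that]]] by simp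
  have i2: "integrable Q (u' k a e)" if "k < n" for k a
    by (rule integrable_moderate[OF u'[OF that]]) simp
  have "(\<integral>\<omega>. stein_lhs_Z e \<omega> $ j $ i \<partial>Q) = (\<Sum>k<n. \<Sum>a\<in>UNIV. \<integral>\<omega>. (M *v snd \<omega> k) $ a * u k a e \<omega> \<partial>Q)"
    unfolding stein_lhs_Z using i1
    by (subst Bochner_Integration.integral_sum) (auto intro!: sum.cong Bochner_Integration.integral_sum Bochner_Integration.integrable_sum)
  also have "\<dots> = (\<Sum>k<n. \<Sum>a\<in>UNIV. \<integral>\<omega>. u' k a e \<omega> \<partial>Q)"
  proof (intro sum.cong refl)
    fix k a assume "k \<in> {..<n}"
    then have k: "k < n" by simp
    show "(\<integral>\<omega>. (M *v snd \<omega> k) $ a * u k a e \<omega> \<partial>Q) = (\<integral>\<omega>. u' k a e \<omega> \<partial>Q)"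
    proof (rule stein_Z_component[OF k u[OF k] u'[OF k]])
      fix r :: "'m \<Rightarrow> real^'p" and z :: "nat \<Rightarrow> real^'p"
      define S0 where "S0 = (\<Sum>l\<in>{..<n} - {k}. outer (z l) (z l))"
      have S0: "gram n (z(k := x)) = S0 + outer x x" for x
        by (simp add: gram_upd[OF k] S0_def)
      have S0': "gram n z = S0 + outer (z k) (z k)"
        using S0[of "z k"] by simp
      have "pos_def (ridge \<beta> e (rowmat r) (S0 + outer x x))" for x
        unfolding S0[symmetric] by (rule pdW)
      from derivative_Z[OF this, where i = i and j = j and a = a and z = "z k"]
      show "((\<lambda>t. u k a e (r, z(k := z k + t *\<^sub>R axis a 1))) has_real_derivative u' k a e (r, z)) (at 0)"
        by (simp add: u_def u'_def S0 S0')
    qed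
  qed
  also have "\<dots> = (\<integral>\<omega>. (\<Sum>k<n. \<Sum>a\<in>UNIV. u' k a e \<omega>) \<partial>Q)"
    using i2
    by (subst Bochner_Integration.integral_sum) (auto intro!: sum.cong Bochner_Integration.integral_sum[symmetric] Bochner_Integration.integrable_sum)
  also have "\<dots> = (\<integral>\<omega>. stein_rhs_Z e \<omega> $ j $ i \<partial>Q)"
  proof (rule Bochner_Integration.integral_cong[OF refl])
    fix \<omega> :: "('p, 'm) sample"
    let ?o = "\<lambda>k. outer (snd \<omega> k) (snd \<omega> k)"
    have "(\<Sum>k<n. \<Sum>a\<in>UNIV. u' k a e \<omega>) = (\<Sum>k<n. (1 - trace (V e \<omega> ** ?o k)) * (G e \<omega> ** V e \<omega> ** transpose (obs_X \<omega>)) $ j $ i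
      - (G e \<omega> ** V e \<omega> ** ?o k ** V e \<omega> ** transpose (obs_X \<omega>)) $ j $ i
      + \<beta> * ((U e \<omega> ** (obs_X \<omega> ** V e \<omega> ** ?o k ** V e \<omega> ** transpose (obs_X \<omega>))) $ j $ i
         + trace (U e \<omega>) * (obs_X \<omega> ** V e \<omega> ** ?o k ** V e \<omega> ** transpose (obs_X \<omega>)) $ j $ i))"
      unfolding u'_def by (intro sum.cong refl divergence_Z[OF pdW])
    also have "\<dots> = stein_rhs_Z e \<omega> $ j $ i"
    proof -
      have *: "(\<Sum>k<n. (A ** ?o k ** B) $ j $ i) = (A ** obs_S n \<omega> ** B) $ j $ i" for A :: "real^'p^'m" and B :: "real^'m^'p"
        by (simp add: gram_def sum_matrix_mult_left sum_matrix_mult_right)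
      have t: "(\<Sum>k<n. 1 - trace (V e \<omega> ** ?o k)) = real n - trace (V e \<omega> ** obs_S n \<omega>)"
        by (simp add: gram_def sum_matrix_mult_left trace_sum sum_subtractf)
      show ?thesis
        unfolding stein_rhs_Z_def sum.distrib sum_subtractf sum_distrib_left[symmetric] sum_distrib_right[symmetric] t
        using *[of "G e \<omega> ** V e \<omega>" "V e \<omega> ** transpose (obs_X \<omega>)"] *[of "U e \<omega> ** obs_X \<omega> ** V e \<omega>" "V e \<omega> ** transpose (obs_X \<omega>)"]
          *[of "obs_X \<omega> ** V e \<omega>" "V e \<omega> ** transpose (obs_X \<omega>)"] t
        by (simp add: matrix_mul_assoc sum_subtractf)
    qed
    finally show "(\<Sum>k<n. \<Sum>a\<in>UNIV. u' k a e \<omega>) = stein_rhs_Z e \<omega> $ j $ i" .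
  qed
  finally show ?thesis .
qed

lemma tendsto_V:
  assumes "pos_def (obs_S n \<omega>)"
  shows "(\<lambda>N. V (inverse (real (Suc N))) \<omega>) \<longlonglongrightarrow> V 0 \<omega>"
proof -
  have "(\<lambda>N. ridge \<beta> (inverse (real (Suc N))) (obs_X \<omega>) (obs_S n \<omega>)) \<longlonglongrightarrow> ridge \<beta> 0 (obs_X \<omega>) (obs_S n \<omega>)"
    unfolding ridge_def by (intro tendsto_intros LIMSEQ_inverse_real_of_nat)
  then show ?thesis
    unfolding ridge_inv_def by (rule tendsto_matrix_inv) (intro pos_def_invertible pos_def_ridge_0 \<beta> assms)
qed

text \<open>Almost surely \<open>S\<close> is positive definite, \<open>W\<close> stays invertible at \<open>e = 0\<close>, and both sides of each identity
  converge; the uniform polynomial bounds allow the passage to the limit under the integral.\<close>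

lemma stein_0:
  assumes n: "n \<ge> CARD('p)"
  shows "integrable Q (\<lambda>\<omega>. stein_lhs_X 0 \<omega> $ j $ i)" "integrable Q (\<lambda>\<omega>. stein_rhs_X 0 \<omega> $ j $ i)"
    "integrable Q (\<lambda>\<omega>. stein_lhs_Z 0 \<omega> $ j $ i)" "integrable Q (\<lambda>\<omega>. stein_rhs_Z 0 \<omega> $ j $ i)"
    "(\<integral>\<omega>. stein_lhs_X 0 \<omega> $ j $ i \<partial>Q) = (\<integral>\<omega>. stein_rhs_X 0 \<omega> $ j $ i \<partial>Q)"
    "(\<integral>\<omega>. stein_lhs_Z 0 \<omega> $ j $ i \<partial>Q) = (\<integral>\<omega>. stein_rhs_Z 0 \<omega> $ j $ i \<partial>Q)"
proof -
  note ae = AE_pos_def_obs_S[OF n]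
  have 1: "AE \<omega> in Q. (\<lambda>N. stein_lhs_X (inverse (real (Suc N))) \<omega> $ j $ i) \<longlonglongrightarrow> stein_lhs_X 0 \<omega> $ j $ i"
    using ae by eventually_elim (unfold stein_lhs_X_def correction_def hat_matrix_def, intro tendsto_intros tendsto_V)
  have 2: "AE \<omega> in Q. (\<lambda>N. stein_rhs_X (inverse (real (Suc N))) \<omega> $ j $ i) \<longlonglongrightarrow> stein_rhs_X 0 \<omega> $ j $ i"
    using ae by eventually_elim (unfold stein_rhs_X_def correction_def hat_matrix_def, intro tendsto_intros tendsto_V)
  have 3: "AE \<omega> in Q. (\<lambda>N. stein_lhs_Z (inverse (real (Suc N))) \<omega> $ j $ i) \<longlonglongrightarrow> stein_lhs_Z 0 \<omega> $ j $ i"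
    using ae by eventually_elim (unfold stein_lhs_Z_def correction_def hat_matrix_def, intro tendsto_intros tendsto_V)
  have 4: "AE \<omega> in Q. (\<lambda>N. stein_rhs_Z (inverse (real (Suc N))) \<omega> $ j $ i) \<longlonglongrightarrow> stein_rhs_Z 0 \<omega> $ j $ i"
    using ae by eventually_elim (unfold stein_rhs_Z_def correction_def hat_matrix_def, intro tendsto_intros tendsto_V)
  have m: "(\<lambda>\<omega>. stein_lhs_X 0 \<omega> $ j $ i) \<in> borel_measurable (sample_sets n)"
     "(\<lambda>\<omega>. stein_rhs_X 0 \<omega> $ j $ i) \<in> borel_measurable (sample_sets n)"
     "(\<lambda>\<omega>. stein_lhs_Z 0 \<omega> $ j $ i) \<in> borel_measurable (sample_sets n)"
     "(\<lambda>\<omega>. stein_rhs_Z 0 \<omega> $ j $ i) \<in> borel_measurable (sample_sets n)"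
    unfolding stein_lhs_X_def stein_rhs_X_def stein_lhs_Z_def stein_rhs_Z_def correction_def by measurable
  note L = dominated_limit[OF moderate_mat_nth[OF moderate_stein_lhs_X] 1 m(1)] dominated_limit[OF moderate_mat_nth[OF moderate_stein_rhs_X] 2 m(2)]
    dominated_limit[OF moderate_mat_nth[OF moderate_stein_lhs_Z] 3 m(3)] dominated_limit[OF moderate_mat_nth[OF moderate_stein_rhs_Z] 4 m(4)]
  show "integrable Q (\<lambda>\<omega>. stein_lhs_X 0 \<omega> $ j $ i)" "integrable Q (\<lambda>\<omega>. stein_rhs_X 0 \<omega> $ j $ i)"
    "integrable Q (\<lambda>\<omega>. stein_lhs_Z 0 \<omega> $ j $ i)" "integrable Q (\<lambda>\<omega>. stein_rhs_Z 0 \<omega> $ j $ i)"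
    by (fact L)+
  show "(\<integral>\<omega>. stein_lhs_X 0 \<omega> $ j $ i \<partial>Q) = (\<integral>\<omega>. stein_rhs_X 0 \<omega> $ j $ i \<partial>Q)"
    by (rule LIMSEQ_unique[OF L(2)]) (use L(4) stein_X in simp)
  show "(\<integral>\<omega>. stein_lhs_Z 0 \<omega> $ j $ i \<partial>Q) = (\<integral>\<omega>. stein_rhs_Z 0 \<omega> $ j $ i \<partial>Q)"
    by (rule LIMSEQ_unique[OF L(6)]) (use L(8) stein_Z in simp)
qed

end

lemma matrix_eq_sum_axis: "(A :: real^'n^'m) = (\<Sum>i\<in>UNIV. \<Sum>j\<in>UNIV. (A $ i $ j) *\<^sub>R unit_matrix i j)"
proof -
  have "(\<Sum>j\<in>UNIV. A $ i $ j * (if k = i \<and> l = j then 1 else 0)) = (if k = i then A $ k $ l else 0)" for i k l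
    by (cases "k = i") (simp_all add: if_distrib[of "\<lambda>x. _ * x"] cong: if_cong)
  then show ?thesis
    by (simp add: vec_eq_iff unit_matrix_nth)
qed

lemma
  fixes F :: "'a \<Rightarrow> real^'n^'m"
  assumes "\<And>i j. integrable N (\<lambda>\<omega>. F \<omega> $ i $ j)"
  shows integrable_matrixI: "integrable N F"
    and integral_matrix_nth: "(\<integral>\<omega>. F \<omega> \<partial>N) $ i $ j = (\<integral>\<omega>. F \<omega> $ i $ j \<partial>N)"
proof -
  have "integrable N (\<lambda>\<omega>. \<Sum>i\<in>UNIV. \<Sum>j\<in>UNIV. (F \<omega> $ i $ j) *\<^sub>R (unit_matrix i j :: real^'n^'m))"
    by (intro Bochner_Integration.integrable_sum integrable_scaleR_left assms)
  then show *: "integrable N F"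
    by (simp only: matrix_eq_sum_axis[symmetric])
  have "bounded_linear (\<lambda>A :: real^'n^'m. A $ i $ j)"
    by (intro bounded_linear_compose[OF bounded_linear_vec_nth] bounded_linear_vec_nth)
  from integral_bounded_linear[OF this *] show "(\<integral>\<omega>. F \<omega> \<partial>N) $ i $ j = (\<integral>\<omega>. F \<omega> $ i $ j \<partial>N)"
    by simp
qed

section \<open>Positivity of the gain\<close>

text \<open>With \<open>W = S + \<beta> X\<^sup>T X\<close> one has \<open>I + \<beta> S\<^sup>-\<^sup>1 X\<^sup>T X = S\<^sup>-\<^sup>1 W\<close>, whose inverse is \<open>V S = I - \<beta> V X\<^sup>T X\<close>.\<close>

lemma est_G_eq:
  assumes "\<beta> > 0" "pos_def S"
  shows "est_G \<alpha> \<beta> (X, S) = X - \<alpha> *\<^sub>R correction \<beta> 0 X S" "correction \<beta> 0 X S = X ** ridge_inv \<beta> 0 X S ** S"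
proof -
  note pdW = pos_def_ridge_0[OF assms]
  let ?V = "ridge_inv \<beta> 0 X S" and ?A = "transpose X ** X"
  have W: "ridge \<beta> 0 X S = S + \<beta> *\<^sub>R ?A" by (simp add: ridge_def)
  note S = matrix_inv_mult[OF pos_def_invertible[OF assms(2)]]
  have WV: "(S + \<beta> *\<^sub>R ?A) ** ?V = mat 1" and VW: "?V ** (S + \<beta> *\<^sub>R ?A) = mat 1"
    using ridge_mult_ridge_inv[OF pdW[of X]] unfolding W by auto
  have "mat 1 + \<beta> *\<^sub>R (matrix_inv S ** ?A) = matrix_inv S ** (S + \<beta> *\<^sub>R ?A)"
    by (simp add: matrix_ring S)
  then have "(mat 1 + \<beta> *\<^sub>R (matrix_inv S ** ?A)) ** (?V ** S) = matrix_inv S ** ((S + \<beta> *\<^sub>R ?A) ** ?V) ** S"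
    by (simp only: matrix_mul_assoc)
  also have "\<dots> = mat 1" by (simp only: WV matrix_mul_rid S)
  finally have inv: "matrix_inv (mat 1 + \<beta> *\<^sub>R (matrix_inv S ** ?A)) = ?V ** S"
    by (rule matrix_inv_unique)
  have "?V ** S = ?V ** (S + \<beta> *\<^sub>R ?A) - \<beta> *\<^sub>R (?V ** ?A)"
    by (simp add: matrix_ring)
  then have "?V ** S = mat 1 - \<beta> *\<^sub>R (?V ** ?A)" by (simp only: VW)
  then have "X ** (?V ** S) = correction \<beta> 0 X S"
    by (simp add: correction_def hat_matrix_def matrix_ring matrix_mul_assoc)
  then show "correction \<beta> 0 X S = X ** ?V ** S" "est_G \<alpha> \<beta> (X, S) = X - \<alpha> *\<^sub>R correction \<beta> 0 X S"
    using inv by (simp_all add: est_G_def matrix_mul_assoc)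
qed

text \<open>
  One observation with \<open>S\<close> positive definite, and no regularisation.  Positivity is read off from factorisations
  such as \<open>T = X V S V X\<^sup>T\<close> and \<open>\<Psi> T = (X V S) V (S V X\<^sup>T)\<close>.
\<close>

locale pointwise =
  fixes \<beta> :: real and X :: "real^'p::finite^'m::finite" and S :: "real^'p^'p"
  assumes \<beta>: "\<beta> > 0" and S: "pos_def S"
begin

definition "V = ridge_inv \<beta> 0 X S"
definition "U = hat_matrix \<beta> 0 X S"
definition "\<Psi> = mat 1 - \<beta> *\<^sub>R U"
definition "T = X ** V ** S ** V ** transpose X"

lemma pdW: "pos_def (ridge \<beta> 0 X S)"
  by (rule pos_def_ridge_0[OF \<beta> S])

lemma tV: "transpose V = V"
  unfolding V_def by (rule transpose_ridge_inv[OF pdW])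

lemma tS: "transpose S = S"
  using S by (simp add: pos_def_def)

lemma pos_semidef_S: "pos_semidef S"
  using S unfolding pos_def_def pos_semidef_def by (metis inner_zero_left less_imp_le order_refl)

lemma tU: "transpose U = U"
  using tV by (simp add: U_def hat_matrix_def V_def matrix_transpose_mul matrix_mul_assoc)

lemma t\<Psi>: "transpose \<Psi> = \<Psi>"
  by (simp add: \<Psi>_def transpose_diff transpose_scaleR transpose_mat tU)

lemma XVS: "X ** V ** S = \<Psi> ** X"
  using est_G_eq(2)[OF \<beta> S, of X] by (simp add: V_def correction_def \<Psi>_def U_def matrix_ring)

lemma T_eq: "T = \<Psi> ** U"
  by (simp add: T_def U_def hat_matrix_def matrix_mul_assoc flip: V_def XVS)

lemma \<beta>T: "\<beta> *\<^sub>R T = \<Psi> - \<Psi> ** \<Psi>"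
  unfolding T_eq by (subst (3) \<Psi>_def) (simp add: matrix_ring)

lemma \<Psi>T: "\<Psi> ** T = X ** V ** S ** V ** S ** V ** transpose X"
  by (simp add: T_def matrix_mul_assoc flip: XVS)

lemma VSV_sandwich: "x \<bullet> (T *v x) = (V *v (transpose X *v x)) \<bullet> (S *v (V *v (transpose X *v x)))"
  using inner_transpose_mult[of x "transpose X"] inner_transpose_mult[of _ V]
  by (simp add: T_def matrix_vector_mul_assoc[symmetric] tV)

lemma T_nonneg: "0 \<le> x \<bullet> (T *v x)"
  unfolding VSV_sandwich using pos_semidef_S by (simp add: pos_semidef_def)

lemma \<Psi>T_nonneg: "0 \<le> x \<bullet> ((\<Psi> ** T) *v x)"
proof -
  let ?y = "S *v (V *v (transpose X *v x))"
  have "x \<bullet> ((\<Psi> ** T) *v x) = ?y \<bullet> (V *v ?y)"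
    using inner_transpose_mult[of x "transpose X"] inner_transpose_mult[of _ V] inner_transpose_mult[of _ S]
    by (simp add: \<Psi>T matrix_vector_mul_assoc[symmetric] tV tS)
  also have "\<dots> \<ge> 0"
    unfolding V_def by (rule inner_ridge_inv_nonneg[OF pdW])
  finally show ?thesis .
qed

lemma \<Psi>_quadratic: "x \<bullet> (\<Psi> *v x) = (norm (\<Psi> *v x))\<^sup>2 + \<beta> * (x \<bullet> (T *v x))"
proof -
  have "\<Psi> = \<Psi> ** \<Psi> + \<beta> *\<^sub>R T" by (simp add: \<beta>T)
  then have "x \<bullet> (\<Psi> *v x) = x \<bullet> ((\<Psi> ** \<Psi> + \<beta> *\<^sub>R T) *v x)" by simp
  also have "\<dots> = (norm (\<Psi> *v x))\<^sup>2 + \<beta> * (x \<bullet> (T *v x))"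
    using inner_transpose_mult[of x \<Psi> "\<Psi> *v x"]
    by (simp add: matrix_vector_mult_add_rdistrib matrix_vector_mul_assoc[symmetric] t\<Psi>
       scaleR_matrix_vector_assoc[symmetric] inner_add_right power2_norm_eq_inner)
  finally show ?thesis .
qed

lemma trace_\<Psi>: "trace \<Psi> = real CARD('m) - \<beta> * trace U"
  by (simp add: \<Psi>_def trace_sub trace_scaleR trace_I)

lemma trace_\<Psi>_nonneg: "0 \<le> trace \<Psi>"
  unfolding trace_def diag_nth \<Psi>_quadratic using \<beta> T_nonneg by (intro sum_nonneg add_nonneg_nonneg mult_nonneg_nonneg) auto

lemma trace_VS: "trace (V ** S) = real CARD('p) - \<beta> * trace U"
  using trace_identity[OF pdW] by (simp add: V_def U_def)

lemma \<Psi>_injective: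
  assumes "\<Psi> *v x = 0"
  shows "x = 0"
proof -
  have "x \<bullet> (T *v x) = 0"
    using \<Psi>_quadratic[of x] assms \<beta> by simp
  then have "V *v (transpose X *v x) = 0"
    unfolding VSV_sandwich using S unfolding pos_def_def by (metis less_irrefl)
  then have "U *v x = 0"
    by (simp add: U_def hat_matrix_def V_def matrix_vector_mul_assoc[symmetric])
  then show "x = 0"
    using assms by (simp add: \<Psi>_def matrix_vector_mult_diff_rdistrib scaleR_matrix_vector_assoc[symmetric])
qed

text \<open>The two divergences at \<open>e = 0\<close>, and the integrand of the risk difference.\<close>

definition "div_X = (real CARD('p) - \<beta> * trace U) *\<^sub>R \<Psi> - \<beta> *\<^sub>R (U ** \<Psi>)"
definition "div_Z n = (real n - trace (V ** S)) *\<^sub>R T - \<Psi> ** T + \<beta> *\<^sub>R (U ** T + trace U *\<^sub>R T)"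
definition "R \<alpha> n = \<alpha> *\<^sub>R (div_X + transpose div_X) - \<alpha>\<^sup>2 *\<^sub>R div_Z n"

lemma \<beta>U: "\<beta> *\<^sub>R (U ** B) = B - \<Psi> ** B"
  by (simp add: \<Psi>_def matrix_ring)

lemma div_X_eq: "div_X = (real CARD('p) - \<beta> * trace U - 1) *\<^sub>R \<Psi> + \<Psi> ** \<Psi>"
  by (simp add: div_X_def \<beta>U algebra_simps)

lemma transpose_div_X: "transpose div_X = div_X"
  by (simp add: div_X_eq transpose_add transpose_scaleR matrix_transpose_mul t\<Psi>)

lemma div_Z_eq: "div_Z n = (real n - real CARD('p) + 2 * \<beta> * trace U + 1) *\<^sub>R T - 2 *\<^sub>R (\<Psi> ** T)"
proof -
  have "div_Z n = (real n - trace (V ** S)) *\<^sub>R T - \<Psi> ** T + (\<beta> *\<^sub>R (U ** T) + (\<beta> * trace U) *\<^sub>R T)"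
    by (simp add: div_Z_def scaleR_add_right)
  then show ?thesis
    unfolding trace_VS \<beta>U by (simp add: vec_eq_iff algebra_simps)
qed

lemma R_eq: "R \<alpha> n = (2 * \<alpha>) *\<^sub>R ((real CARD('p) - \<beta> * trace U - 1) *\<^sub>R \<Psi> + \<Psi> ** \<Psi>)
    - \<alpha>\<^sup>2 *\<^sub>R ((real n - real CARD('p) + 2 * \<beta> * trace U + 1) *\<^sub>R T - 2 *\<^sub>R (\<Psi> ** T))"
  unfolding R_def transpose_div_X div_Z_eq[symmetric] unfolding div_X_eq by (simp add: scaleR_2[symmetric])

text \<open>The negative term \<open>\<alpha>\<^sup>2 (n - p + 2 m + 1) T\<close> is absorbed by \<open>2 \<alpha> (p - m - 1) \<Psi>\<close>, since \<open>\<beta> T = \<Psi> - \<Psi>\<^sup>2\<close>; the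
  term \<open>2 \<alpha> \<Psi>\<^sup>2\<close> remains and is positive definite as \<open>\<Psi>\<close> is injective.\<close>

lemma R_positive:
  assumes "\<alpha> > 0" "CARD('p) > CARD('m) + 1"
    and \<alpha>: "\<alpha> * (real n - real CARD('p) + 2 * real CARD('m) + 1) \<le> 2 * (real CARD('p) - real CARD('m) - 1) * \<beta>"
    and "x \<noteq> 0"
  shows "0 < x \<bullet> (R \<alpha> n *v x)"
proof -
  define s where "s = trace \<Psi>"
  define a b t h where "a = x \<bullet> (\<Psi> *v x)" and "b = (norm (\<Psi> *v x))\<^sup>2" and "t = x \<bullet> (T *v x)"
    and "h = x \<bullet> ((\<Psi> ** T) *v x)"
  define c d where "c = real n - real CARD('p) + 2 * real CARD('m) + 1" and "d = real CARD('p) - real CARD('m) - 1"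
  have \<tau>: "\<beta> * trace U = real CARD('m) - s" by (simp add: s_def trace_\<Psi>)
  have bb: "x \<bullet> ((\<Psi> ** \<Psi>) *v x) = b"
    using inner_transpose_mult[of x \<Psi> "\<Psi> *v x"]
    by (simp add: b_def matrix_vector_mul_assoc[symmetric] t\<Psi> power2_norm_eq_inner)
  have s: "s \<ge> 0" and t: "t \<ge> 0" and h: "h \<ge> 0" and a: "a = b + \<beta> * t" and b: "b > 0" and d: "d > 0"
    using trace_\<Psi>_nonneg T_nonneg \<Psi>T_nonneg \<Psi>_quadratic \<Psi>_injective assms(2,4)
    by (auto simp: s_def a_def b_def t_def h_def d_def)
  have "x \<bullet> (R \<alpha> n *v x) = 2 * \<alpha> * ((real CARD('p) - \<beta> * trace U - 1) * a + b)
      - \<alpha>\<^sup>2 * ((real n - real CARD('p) + 2 * (\<beta> * trace U) + 1) * t - 2 * h)"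
    unfolding R_eq a_def t_def h_def bb[symmetric]
    by (simp add: matrix_vector_mult_add_rdistrib matrix_vector_mult_diff_rdistrib
      scaleR_matrix_vector_assoc[symmetric] inner_add_right inner_diff_right)
  also have "\<dots> = 2 * \<alpha> * (d * a + s * a + b) - \<alpha> * (\<alpha> * c) * t + 2 * \<alpha>\<^sup>2 * (s * t + h)"
    unfolding \<tau> by (simp add: c_def d_def algebra_simps power2_eq_square)
  finally have eq: "x \<bullet> (R \<alpha> n *v x) = 2 * \<alpha> * (d * a + s * a + b) - \<alpha> * (\<alpha> * c) * t + 2 * \<alpha>\<^sup>2 * (s * t + h)" .
  have "\<alpha> * (\<alpha> * c) * t \<le> \<alpha> * (2 * d * \<beta>) * t"
    using \<alpha> assms(1) t by (intro mult_right_mono mult_left_mono) (auto simp: c_def d_def)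
  also have "\<dots> = 2 * \<alpha> * (d * a) - 2 * \<alpha> * (d * b)"
    by (simp add: a algebra_simps)
  finally have "\<alpha> * (\<alpha> * c) * t \<le> 2 * \<alpha> * (d * a) - 2 * \<alpha> * (d * b)" .
  moreover have "0 \<le> 2 * \<alpha> * (s * a)" "0 \<le> 2 * \<alpha>\<^sup>2 * (s * t + h)" "0 < 2 * \<alpha> * b" "0 \<le> 2 * \<alpha> * (d * b)"
    using assms(1) s t h b d \<beta> by (auto simp: a)
  ultimately show ?thesis
    unfolding eq by (simp add: algebra_simps)
qed

lemma trace_T: "0 \<le> trace T"
  unfolding trace_def diag_nth by (intro sum_nonneg T_nonneg)

lemma trace_\<Psi>T: "0 \<le> trace (\<Psi> ** T)"
  unfolding trace_def diag_nth by (intro sum_nonneg \<Psi>T_nonneg)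

text \<open>From \<open>V S = V S V W\<close>; this plays for \<open>V S\<close> the part of \<open>\<Psi> - \<beta> T = \<Psi>\<^sup>2\<close>.\<close>

lemma trace_VSVS: "trace (V ** S) - \<beta> * trace T = trace (V ** S ** V ** S)"
proof -
  have "V ** S = V ** S ** (V ** ridge \<beta> 0 X S)"
    using ridge_mult_ridge_inv(2)[OF pdW] by (simp add: V_def)
  also have "\<dots> = V ** S ** V ** S + \<beta> *\<^sub>R (V ** S ** V ** (transpose X ** X))"
    by (simp add: ridge_def matrix_ring matrix_mul_assoc)
  finally have "trace (V ** S) = trace (V ** S ** V ** S) + \<beta> * trace (V ** S ** V ** (transpose X ** X))"
    by (metis trace_add trace_scaleR)
  moreover have "trace (V ** S ** V ** (transpose X ** X)) = trace T"
    using trace_mul_sym[of "V ** S ** V ** transpose X" X] by (simp add: T_def matrix_mul_assoc)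
  ultimately show ?thesis by simp
qed

text \<open>With \<open>q = tr (V S)\<close> and \<open>d = m - p\<close> one has \<open>tr \<Psi> = d + q\<close>, and the terms without \<open>q\<close> and \<open>T\<close> cancel.  The
  negative term is at most \<open>2 \<alpha> (d - 1) \<beta> tr T\<close>, and \<open>\<beta> tr T \<le> q\<close>.  The representation of \<open>S\<close> as a sum of
  outer products gives the signs of \<open>q\<close> and of \<open>tr (V S V S)\<close>.\<close>

lemma trace_R_positive:
  assumes "\<alpha> > 0" "CARD('m) > CARD('p) + 1" "S = gram n z"
    and \<alpha>: "\<alpha> * (real n + real CARD('p) + 1) \<le> 2 * (real CARD('m) - real CARD('p) - 1) * \<beta>"
  shows "0 < trace (R \<alpha> n)"
proof -
  define q t h d where "q = trace (V ** S)" and "t = trace T" and "h = trace (\<Psi> ** T)"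
    and "d = real CARD('m) - real CARD('p)"
  have t: "t \<ge> 0" and h: "h \<ge> 0" and d: "d > 1"
    using trace_T trace_\<Psi>T assms(2) by (auto simp: t_def h_def d_def)
  have qt: "\<beta> * t \<le> q"
  proof -
    have "trace (V ** S ** V ** S) = (\<Sum>k<n. z k \<bullet> ((V ** S ** V) *v z k))"
      unfolding assms(3) by (rule trace_V_gram)
    also have "\<dots> = (\<Sum>k<n. (V *v z k) \<bullet> (S *v (V *v z k)))"
      using inner_transpose_mult[of _ V] by (simp add: matrix_vector_mul_assoc[symmetric] tV)
    also have "\<dots> \<ge> 0"
      using pos_semidef_S by (intro sum_nonneg) (simp add: pos_semidef_def)
    finally show ?thesis
      using trace_VSVS by (simp add: q_def t_def)
  qed
  have q: "q > 0"
  proof -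
    have pV: "pos_def V" unfolding V_def ridge_inv_def by (rule pos_def_matrix_inv[OF pdW])
    have nn: "0 \<le> z k \<bullet> (V *v z k)" for k
      unfolding V_def by (rule inner_ridge_inv_nonneg[OF pdW])
    have qs: "q = (\<Sum>k<n. z k \<bullet> (V *v z k))"
      unfolding q_def assms(3) by (rule trace_V_gram)
    have "q \<noteq> 0"
    proof
      assume "q = 0"
      then have "z k \<bullet> (V *v z k) = 0" if "k < n" for k
        using qs nn that by (simp add: sum_nonneg_eq_0_iff)
      then have "z k = 0" if "k < n" for k
        using pV that unfolding pos_def_def by (metis less_irrefl)
      then have "v \<bullet> (S *v v) = 0" for v
        unfolding assms(3) inner_gram by simp
      then show False
        using S unfolding pos_def_def by (metis axis_eq_0_iff less_irrefl zero_neq_one)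
    qed
    moreover have "q \<ge> 0" unfolding qs by (intro sum_nonneg nn)
    ultimately show ?thesis by simp
  qed
  have \<tau>: "\<beta> * trace U = real CARD('p) - q" by (simp add: q_def trace_VS)
  have p: "trace \<Psi> = d + q" unfolding trace_\<Psi> \<tau> by (simp add: d_def)
  have "trace \<Psi> - trace (\<Psi> ** \<Psi>) = \<beta> * t"
    using arg_cong[OF \<beta>T, of trace] by (simp add: trace_scaleR trace_sub t_def)
  then have pp: "trace (\<Psi> ** \<Psi>) = d + q - \<beta> * t" by (simp add: p)
  have "trace (R \<alpha> n) = 2 * \<alpha> * ((real CARD('p) - \<beta> * trace U - 1) * (d + q) + (d + q - \<beta> * t))
      - \<alpha>\<^sup>2 * ((real n - real CARD('p) + 2 * (\<beta> * trace U) + 1) * t - 2 * h)"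
    unfolding R_eq by (simp add: trace_add trace_sub trace_scaleR p pp t_def h_def)
  also have "\<dots> = 2 * \<alpha> * (q * d + q * q - \<beta> * t) - \<alpha> * (\<alpha> * (real n + real CARD('p) + 1)) * t + 2 * \<alpha>\<^sup>2 * (q * t + h)"
    unfolding \<tau> by (simp add: algebra_simps power2_eq_square)
  finally have eq: "trace (R \<alpha> n) = 2 * \<alpha> * (q * d + q * q - \<beta> * t)
      - \<alpha> * (\<alpha> * (real n + real CARD('p) + 1)) * t + 2 * \<alpha>\<^sup>2 * (q * t + h)" .
  have "\<alpha> * (\<alpha> * (real n + real CARD('p) + 1)) * t \<le> \<alpha> * (2 * (d - 1) * \<beta>) * t"
    using \<alpha> assms(1) t by (intro mult_right_mono mult_left_mono) (auto simp: d_def)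
  moreover have "2 * \<alpha> * (q * d + q * q - \<beta> * t) - \<alpha> * (2 * (d - 1) * \<beta>) * t = 2 * \<alpha> * (d * (q - \<beta> * t)) + 2 * \<alpha> * (q * q)"
    by (simp add: algebra_simps)
  moreover have "0 \<le> 2 * \<alpha> * (d * (q - \<beta> * t))" "0 < 2 * \<alpha> * (q * q)" "0 \<le> 2 * \<alpha>\<^sup>2 * (q * t + h)"
    using assms(1) d q qt t h by auto
  ultimately show ?thesis
    unfolding eq by linarith
qed

end

section \<open>Risks\<close>

lemma transpose_matrix_loss:
  assumes "pos_def \<Sigma>"
  shows "transpose (matrix_loss T \<Theta> \<Sigma>) = matrix_loss T \<Theta> \<Sigma>"
  using pos_def_matrix_inv[OF assms]
  by (simp add: matrix_loss_def matrix_transpose_mul pos_def_def matrix_mul_assoc)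

lemma measurable_est_G: "est_G \<alpha> \<beta> \<in> borel_measurable (borel \<Otimes>\<^sub>M borel)"
  unfolding est_G_def case_prod_beta' by measurable

lemma measurable_est_X: "est_X \<in> borel_measurable (borel \<Otimes>\<^sub>M borel)"
  unfolding est_X_def case_prod_beta' by measurable

lemma measurable_matrix_loss:
  assumes [measurable]: "\<delta> \<in> borel_measurable N"
  shows "(\<lambda>\<omega>. matrix_loss (\<delta> \<omega>) \<Theta> \<Sigma>) \<in> borel_measurable N"
  unfolding matrix_loss_def by measurable

context sampling
begin

definition observation :: "('p, 'm) sample \<Rightarrow> (real^'p^'m) \<times> (real^'p^'p)" where
  "observation \<omega> = (obs_X \<omega>, obs_S n \<omega>)"

lemma measurable_observation: "observation \<in> measurable Q (borel \<Otimes>\<^sub>M borel)"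
  unfolding observation_def[abs_def]
  by (intro measurable_Pair measurable_Q measurable_obs_X measurable_obs_S)

lemma model_eq: "model n \<Theta> \<Sigma> = distr Q (borel \<Otimes>\<^sub>M borel) observation"
proof -
  have 1: "matrix_normal \<Theta> \<Sigma> = distr PX borel rowmat"
    by (simp add: matrix_normal_def PX_def rowmat_def[abs_def])
  have 2: "wishart n \<Sigma> = distr PZ borel (gram n)"
    by (simp add: wishart_def PZ_def gram_def[abs_def] outer_def)
  have m1: "rowmat \<in> borel_measurable PX"
    unfolding rowmat_def[abs_def] by (intro measurable_vec_lambda) measurable
  have m2: "gram n \<in> borel_measurable PZ"
    unfolding gram_def[abs_def]
  proof (intro borel_measurable_sum measurable_outer)
    fix k assume "k \<in> {..<n}"
    then show "(\<lambda>z. z k) \<in> borel_measurable PZ" "(\<lambda>z. z k) \<in> borel_measurable PZ" by measurable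
  qed
  have "integrable PZ (\<lambda>z. growth {..<n} z ^ 0)"
    unfolding PZ_def by (intro integrable_PiM_multi_normal_growth pd) auto
  then interpret Z: finite_measure PZ
    by (intro finite_measureI) (auto simp: integrable_iff_bounded less_top)
  have "finite_measure (distr PZ borel (gram n))"
    by (rule Z.finite_measure_distr[OF m2])
  then have sf: "sigma_finite_measure (distr PZ borel (gram n))"
    by (rule finite_measure.axioms(1))
  show ?thesis
    unfolding model_def 1 2 by (subst pair_measure_distr[OF m1 m2 sf]) (simp add: Q_def observation_def[abs_def] case_prod_beta')
qed

lemma
  fixes L :: "_ \<Rightarrow> 'r::{banach, second_countable_topology}"
  assumes "L \<in> borel_measurable (borel \<Otimes>\<^sub>M borel)"
  shows integrable_model: "integrable (model n \<Theta> \<Sigma>) L \<longleftrightarrow> integrable Q (\<lambda>\<omega>. L (observation \<omega>))"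
    and integral_model: "(\<integral>\<omega>. L \<omega> \<partial>model n \<Theta> \<Sigma>) = (\<integral>\<omega>. L (observation \<omega>) \<partial>Q)"
  unfolding model_eq
  by (rule integrable_distr_eq[OF measurable_observation assms] integral_distr[OF measurable_observation assms])+

lemma emeasure_Q_nonzero:
  assumes "det \<Sigma> > 0"
  shows "emeasure Q (space Q) \<noteq> 0"
proof -
  have nz: "emeasure (multi_normal \<mu> \<Sigma>) UNIV \<noteq> 0" for \<mu>
  proof
    assume "emeasure (multi_normal \<mu> \<Sigma>) UNIV = 0"
    then have "AE x in lborel. ennreal (gaussian_kernel \<mu> \<Sigma> x) = 0"
      unfolding multi_normal_eq by (simp add: emeasure_density nn_integral_0_iff_AE)
    moreover have "gaussian_kernel \<mu> \<Sigma> x \<noteq> 0" for x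
      using assms by (simp add: gaussian_kernel_def max_def)
    ultimately have "AE x in (lborel :: (real^'p) measure). False"
      by simp
    then have "emeasure (lborel :: (real^'p) measure) (space lborel) = 0"
      by (simp add: AE_iff_null null_sets_def)
    then show False by simp
  qed
  have X: "emeasure PX (space PX) \<noteq> 0"
  proof -
    have "emeasure PX (Pi\<^sub>E UNIV (\<lambda>_. UNIV)) = (\<Prod>i\<in>UNIV. emeasure (multi_normal (\<Theta> $ i) \<Sigma>) UNIV)"
      unfolding PX_def by (rule X.emeasure_PiM) auto
    then show ?thesis using nz by (simp add: PX_def space_PiM)
  qed
  have Z: "emeasure PZ (space PZ) \<noteq> 0"
  proof -
    have "emeasure PZ (Pi\<^sub>E {..<n} (\<lambda>_. UNIV)) = (\<Prod>i\<in>{..<n}. emeasure (multi_normal 0 \<Sigma>) UNIV)"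
      unfolding PZ_def by (rule Z.emeasure_PiM) auto
    then show ?thesis using nz by (simp add: PZ_def space_PiM)
  qed
  have "emeasure Q (space Q) = emeasure PX (space PX) * emeasure PZ (space PZ)"
    unfolding Q_def space_pair_measure by (rule P.M2.emeasure_pair_measure_Times) auto
  then show ?thesis using X Z by simp
qed

lemma integral_pos:
  fixes f :: "_ \<Rightarrow> real"
  assumes "det \<Sigma> > 0" "integrable Q f" "AE \<omega> in Q. f \<omega> > 0"
  shows "(\<integral>\<omega>. f \<omega> \<partial>Q) > 0"
proof -
  have nn: "AE \<omega> in Q. 0 \<le> f \<omega>"
    using assms(3) by eventually_elim simp
  have "(\<integral>\<omega>. f \<omega> \<partial>Q) \<noteq> 0"
  proof
    assume "(\<integral>\<omega>. f \<omega> \<partial>Q) = 0"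
    then have "AE \<omega> in Q. f \<omega> = 0"
      using integral_nonneg_eq_0_iff_AE[OF assms(2) nn] by simp
    with assms(3) have "AE \<omega> in Q. False" by eventually_elim simp
    then show False
      using emeasure_Q_nonzero[OF assms(1)] by (simp add: AE_iff_null null_sets_def)
  qed
  moreover have "(\<integral>\<omega>. f \<omega> \<partial>Q) \<ge> 0"
    by (rule integral_nonneg_AE[OF nn])
  ultimately show ?thesis by simp
qed

end

context regularised
begin

definition "gain \<alpha> \<omega> = \<alpha> *\<^sub>R (stein_rhs_X 0 \<omega> + transpose (stein_rhs_X 0 \<omega>)) - \<alpha>\<^sup>2 *\<^sub>R stein_rhs_Z 0 \<omega>"

lemma gain_eq:
  assumes "pos_def (obs_S n \<omega>)"
  shows "gain \<alpha> \<omega> = pointwise.R \<beta> (obs_X \<omega>) (obs_S n \<omega>) \<alpha> n"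
proof -
  interpret p: pointwise \<beta> "obs_X \<omega>" "obs_S n \<omega>"
    using \<beta> assms by unfold_locales
  have G: "G 0 \<omega> = p.\<Psi> ** obs_X \<omega>"
    by (simp add: correction_def p.\<Psi>_def p.U_def matrix_ring)
  have "p.\<Psi> ** obs_X \<omega> ** V 0 \<omega> ** transpose (obs_X \<omega>) = T 0 \<omega>"
    by (simp add: p.V_def flip: p.XVS)
  then show ?thesis
    unfolding gain_def p.R_def stein_rhs_X_def stein_rhs_Z_def p.div_X_def p.div_Z_def p.\<Psi>_def[symmetric] p.U_def[symmetric] G
    by (simp add: p.V_def[symmetric] p.T_def matrix_mul_assoc p.U_def)
qed

text \<open>The square is expanded; the last term is \<open>G M G\<^sup>T\<close> because \<open>G = X V S\<close>.\<close>

lemma loss_decomposition: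
  assumes "pos_def (obs_S n \<omega>)"
  shows "matrix_loss (est_G \<alpha> \<beta> (observation \<omega>)) \<Theta> \<Sigma> = matrix_loss (est_X (observation \<omega>)) \<Theta> \<Sigma>
    - \<alpha> *\<^sub>R (stein_lhs_X 0 \<omega> + transpose (stein_lhs_X 0 \<omega>)) + \<alpha>\<^sup>2 *\<^sub>R stein_lhs_Z 0 \<omega>"
proof -
  interpret p: pointwise \<beta> "obs_X \<omega>" "obs_S n \<omega>"
    using \<beta> assms by unfold_locales
  have tM: "transpose M = M"
    using pos_def_matrix_inv[OF pd] by (simp add: pos_def_def)
  have "obs_S n \<omega> ** V 0 \<omega> ** transpose (obs_X \<omega>) = transpose (G 0 \<omega>)"
    using est_G_eq(2)[OF \<beta> assms, of "obs_X \<omega>"] p.tS p.tV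
    by (simp add: matrix_transpose_mul p.V_def matrix_mul_assoc)
  then have stein_lhs_Z: "stein_lhs_Z 0 \<omega> = G 0 \<omega> ** M ** transpose (G 0 \<omega>)"
    by (simp add: stein_lhs_Z_def matrix_mul_assoc[symmetric])
  define D where "D = obs_X \<omega> - \<Theta>"
  have D: "obs_X \<omega> - \<alpha> *\<^sub>R G 0 \<omega> - \<Theta> = D - \<alpha> *\<^sub>R G 0 \<omega>"
    by (simp add: D_def)
  show ?thesis
    unfolding stein_lhs_Z stein_lhs_X_def observation_def est_G_eq(1)[OF \<beta> assms] matrix_loss_def D
    by (simp add: est_X_def D_def[symmetric] transpose_diff transpose_scaleR matrix_ring matrix_transpose_mul tM matrix_mul_assoc
       algebra_simps power2_eq_square)
qed

text \<open>The loss of the estimator agrees almost surely with a combination of integrable functions, and the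
  integration by parts identities replace its expectation by that of the gain.\<close>

lemma risk_facts:
  assumes n: "n \<ge> CARD('p)"
  shows integrable_loss_X: "integrable (model n \<Theta> \<Sigma>) (\<lambda>\<omega>. matrix_loss (est_X \<omega>) \<Theta> \<Sigma>)"
    and integrable_loss_G: "integrable (model n \<Theta> \<Sigma>) (\<lambda>\<omega>. matrix_loss (est_G \<alpha> \<beta> \<omega>) \<Theta> \<Sigma>)"
    and integrable_gain: "integrable Q (\<lambda>\<omega>. gain \<alpha> \<omega> $ i $ j)"
    and risk_difference: "(risk matrix_loss n est_X \<Theta> \<Sigma> - risk matrix_loss n (est_G \<alpha> \<beta>) \<Theta> \<Sigma>) $ i $ j
      = (\<integral>\<omega>. gain \<alpha> \<omega> $ i $ j \<partial>Q)"
proof -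
  let ?lX = "\<lambda>\<omega>. matrix_loss (est_X (observation \<omega>)) \<Theta> \<Sigma>" and ?lG = "\<lambda>\<omega>. matrix_loss (est_G \<alpha> \<beta> (observation \<omega>)) \<Theta> \<Sigma>"
  note mX = measurable_matrix_loss[OF measurable_est_X, where \<Theta> = \<Theta> and \<Sigma> = \<Sigma>]
  note mG = measurable_matrix_loss[OF measurable_est_G[of \<alpha> \<beta>], where \<Theta> = \<Theta> and \<Sigma> = \<Sigma>]
  note st = stein_0[OF n]
  have iX: "integrable Q (\<lambda>\<omega>. ?lX \<omega> $ i $ j)" for i j
  proof -
    have "moderate_mat n {0} (\<lambda>e (\<omega> :: ('p, 'm) sample). matrix_loss (obs_X \<omega>) \<Theta> \<Sigma>)"
      unfolding matrix_loss_def
      by (intro moderate_mat_diff moderate_mat_mult moderate_mat_transpose moderate_mat_obs_X moderate_mat_const)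
    from integrable_moderate[OF moderate_mat_nth[OF this]] show ?thesis
      by (simp add: est_X_def observation_def)
  qed
  let ?d = "\<lambda>\<omega> i j. ?lX \<omega> $ i $ j - \<alpha> * (stein_lhs_X 0 \<omega> $ i $ j + stein_lhs_X 0 \<omega> $ j $ i) + \<alpha>\<^sup>2 * stein_lhs_Z 0 \<omega> $ i $ j"
  have id: "integrable Q (\<lambda>\<omega>. ?d \<omega> i j)" for i j
    using iX st by simp
  have mG': "(\<lambda>\<omega>. ?lG \<omega> $ i $ j) \<in> borel_measurable Q" for i j
    by (intro measurable_vec_nth measurable_compose[OF measurable_observation mG])
  have ae: "AE \<omega> in Q. ?d \<omega> i j = ?lG \<omega> $ i $ j" for i j
    using AE_pos_def_obs_S[OF n] by eventually_elim (simp add: loss_decomposition transpose_def)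
  have iG: "integrable Q (\<lambda>\<omega>. ?lG \<omega> $ i $ j)" for i j
    using integrable_cong_AE_imp[OF id mG' ae] .
  show "integrable (model n \<Theta> \<Sigma>) (\<lambda>\<omega>. matrix_loss (est_X \<omega>) \<Theta> \<Sigma>)"
    by (subst integrable_model[OF mX]) (rule integrable_matrixI[OF iX])
  show "integrable (model n \<Theta> \<Sigma>) (\<lambda>\<omega>. matrix_loss (est_G \<alpha> \<beta> \<omega>) \<Theta> \<Sigma>)"
    by (subst integrable_model[OF mG]) (rule integrable_matrixI[OF iG])
  show ig: "integrable Q (\<lambda>\<omega>. gain \<alpha> \<omega> $ i $ j)"
    using st by (simp add: gain_def transpose_def)
  have "(\<integral>\<omega>. ?lG \<omega> $ i $ j \<partial>Q) = (\<integral>\<omega>. ?d \<omega> i j \<partial>Q)"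
    by (rule integral_cong_AE[OF mG' borel_measurable_integrable[OF id]]) (use ae[of i j] in eventually_elim, simp)
  also have "\<dots> = (\<integral>\<omega>. ?lX \<omega> $ i $ j \<partial>Q) - (\<integral>\<omega>. gain \<alpha> \<omega> $ i $ j \<partial>Q)"
    using iX st by (simp add: gain_def transpose_def)
  finally show "(risk matrix_loss n est_X \<Theta> \<Sigma> - risk matrix_loss n (est_G \<alpha> \<beta>) \<Theta> \<Sigma>) $ i $ j = (\<integral>\<omega>. gain \<alpha> \<omega> $ i $ j \<partial>Q)"
    unfolding risk_def integral_model[OF mX] integral_model[OF mG]
    by (simp add: integral_matrix_nth[OF iX] integral_matrix_nth[OF iG])
qed

lemma risk_difference_quadratic:
  assumes n: "n \<ge> CARD('p)"
  shows "integrable Q (\<lambda>\<omega>. x \<bullet> (gain \<alpha> \<omega> *v x))"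
    "x \<bullet> ((risk matrix_loss n est_X \<Theta> \<Sigma> - risk matrix_loss n (est_G \<alpha> \<beta>) \<Theta> \<Sigma>) *v x) = (\<integral>\<omega>. x \<bullet> (gain \<alpha> \<omega> *v x) \<partial>Q)"
proof -
  have q: "x \<bullet> (A *v x) = (\<Sum>i\<in>UNIV. \<Sum>j\<in>UNIV. x $ i * (A $ i $ j * x $ j))" for A :: "real^'m^'m"
    by (simp add: inner_vec_def matrix_vector_mult_def sum_distrib_left)
  show "integrable Q (\<lambda>\<omega>. x \<bullet> (gain \<alpha> \<omega> *v x))"
    unfolding q
    by (intro Bochner_Integration.integrable_sum integrable_mult_right integrable_mult_left integrable_gain[OF n])
  show "x \<bullet> ((risk matrix_loss n est_X \<Theta> \<Sigma> - risk matrix_loss n (est_G \<alpha> \<beta>) \<Theta> \<Sigma>) *v x) = (\<integral>\<omega>. x \<bullet> (gain \<alpha> \<omega> *v x) \<partial>Q)"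
    unfolding q risk_difference[OF n] using integrable_gain[OF n]
    by (subst Bochner_Integration.integral_sum) (auto intro!: sum.cong Bochner_Integration.integrable_sum)
qed

lemma risk_difference_trace:
  assumes n: "n \<ge> CARD('p)"
  shows "integrable Q (\<lambda>\<omega>. trace (gain \<alpha> \<omega>))"
    "trace (risk matrix_loss n est_X \<Theta> \<Sigma> - risk matrix_loss n (est_G \<alpha> \<beta>) \<Theta> \<Sigma>) = (\<integral>\<omega>. trace (gain \<alpha> \<omega>) \<partial>Q)"
  unfolding trace_def risk_difference[OF n] using integrable_gain[OF n]
  by (auto intro!: Bochner_Integration.integrable_sum simp: Bochner_Integration.integral_sum)

lemma risk_symmetric:
  assumes "integrable (model n \<Theta> \<Sigma>) (\<lambda>\<omega>. matrix_loss (\<delta> \<omega>) \<Theta> \<Sigma>)"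
  shows "transpose (risk matrix_loss n \<delta> \<Theta> \<Sigma>) = risk matrix_loss n \<delta> \<Theta> \<Sigma>"
  unfolding risk_def using integral_bounded_linear[OF bounded_linear_transpose assms]
  by (simp add: transpose_matrix_loss[OF pd])

lemma scalar_risk:
  assumes "integrable (model n \<Theta> \<Sigma>) (\<lambda>\<omega>. matrix_loss (\<delta> \<omega>) \<Theta> \<Sigma>)"
  shows "integrable (model n \<Theta> \<Sigma>) (\<lambda>\<omega>. scalar_loss (\<delta> \<omega>) \<Theta> \<Sigma>)"
    "risk scalar_loss n \<delta> \<Theta> \<Sigma> = trace (risk matrix_loss n \<delta> \<Theta> \<Sigma>)"
proof -
  have eq: "scalar_loss T \<Theta> \<Sigma> = trace (matrix_loss T \<Theta> \<Sigma>)" for T :: "real^'p^'m"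
    by (simp add: scalar_loss_def matrix_loss_def)
  show "integrable (model n \<Theta> \<Sigma>) (\<lambda>\<omega>. scalar_loss (\<delta> \<omega>) \<Theta> \<Sigma>)"
    unfolding eq by (rule integrable_bounded_linear[OF bounded_linear_trace assms])
  show "risk scalar_loss n \<delta> \<Theta> \<Sigma> = trace (risk matrix_loss n \<delta> \<Theta> \<Sigma>)"
    unfolding risk_def eq by (rule integral_bounded_linear[OF bounded_linear_trace assms])
qed

lemma AE_gain_positive:
  assumes n: "n \<ge> CARD('p)" and "\<alpha> > 0" "CARD('p) > CARD('m) + 1"
    and "\<alpha> * (real n - real CARD('p) + 2 * real CARD('m) + 1) \<le> 2 * (real CARD('p) - real CARD('m) - 1) * \<beta>"
  shows "AE \<omega> in Q. \<forall>x. x \<noteq> 0 \<longrightarrow> 0 < x \<bullet> (gain \<alpha> \<omega> *v x)"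
  using AE_pos_def_obs_S[OF n]
proof eventually_elim
  case (elim \<omega>)
  interpret p: pointwise \<beta> "obs_X \<omega>" "obs_S n \<omega>"
    using \<beta> elim by unfold_locales
  show ?case
    using p.R_positive[OF assms(2-4)] by (simp add: gain_eq[OF elim])
qed

lemma AE_trace_gain_positive:
  assumes n: "n \<ge> CARD('p)" and "\<alpha> > 0" "\<bar>real CARD('p) - real CARD('m)\<bar> > 1"
    and \<alpha>: "\<alpha> * (real n - real CARD('p) + 2 * real (min CARD('m) CARD('p)) + 1)
      \<le> 2 * (\<bar>real CARD('p) - real CARD('m)\<bar> - 1) * \<beta>"
  shows "AE \<omega> in Q. 0 < trace (gain \<alpha> \<omega>)"
proof (cases "CARD('p) > CARD('m) + 1")
  case True
  then have "\<alpha> * (real n - real CARD('p) + 2 * real CARD('m) + 1) \<le> 2 * (real CARD('p) - real CARD('m) - 1) * \<beta>"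
    using \<alpha> by (simp add: min_def)
  from AE_gain_positive[OF n assms(2) True this] show ?thesis
  proof eventually_elim
    case (elim \<omega>)
    show ?case
      using elim unfolding trace_def diag_nth by (auto intro!: sum_pos simp: axis_eq_0_iff)
  qed
next
  case False
  then have pm: "CARD('m) > CARD('p) + 1"
    using assms(3) by linarith
  then have "\<alpha> * (real n + real CARD('p) + 1) \<le> 2 * (real CARD('m) - real CARD('p) - 1) * \<beta>"
    using \<alpha> by (simp add: min_def add_ac)
  note * = this
  show ?thesis
    using AE_pos_def_obs_S[OF n]
  proof eventually_elim
    case (elim \<omega>)
    interpret p: pointwise \<beta> "obs_X \<omega>" "obs_S n \<omega>"
      using \<beta> elim by unfold_locales
    show ?case
      using p.trace_R_positive[OF assms(2) pm refl *] by (simp add: gain_eq[OF elim])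
  qed
qed

end

theorem theorem4p1:
  fixes \<alpha> \<beta> :: real and n :: nat
  assumes "\<alpha> > 0" and "\<beta> > 0"
  shows
    "(CARD('p) > CARD('m) + 1 \<and> n \<ge> CARD('p) \<and>
      \<alpha> \<le> 2 * (real CARD('p) - real CARD('m) - 1) * \<beta>
             / (real n - real CARD('p) + 2 * real CARD('m) + 1)
      \<longrightarrow> dominates_matrix matrix_loss n (est_G \<alpha> \<beta>)
            (est_X :: ('p::finite, 'm::finite) estimator)) \<and>
     (\<bar>real CARD('p) - real CARD('m)\<bar> > 1 \<and> n \<ge> CARD('p) \<and>
      \<alpha> \<le> 2 * (\<bar>real CARD('p) - real CARD('m)\<bar> - 1) * \<beta>
             / (real n - real CARD('p) + 2 * real (min CARD('m) CARD('p)) + 1)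
      \<longrightarrow> dominates_scalar scalar_loss n (est_G \<alpha> \<beta>)
            (est_X :: ('p::finite, 'm::finite) estimator))"
proof (intro conjI impI; elim conjE)
  assume pm: "CARD('p) > CARD('m) + 1" and n: "n \<ge> CARD('p)"
    and \<alpha>: "\<alpha> \<le> 2 * (real CARD('p) - real CARD('m) - 1) * \<beta>
             / (real n - real CARD('p) + 2 * real CARD('m) + 1)"
  have \<alpha>': "\<alpha> * (real n - real CARD('p) + 2 * real CARD('m) + 1) \<le> 2 * (real CARD('p) - real CARD('m) - 1) * \<beta>"
    using \<alpha> n by (subst (asm) pos_le_divide_eq) auto
  have loc: "regularised \<Sigma> \<beta>" if "pos_def \<Sigma>" for \<Sigma> :: "real^'p^'p"
    using that assms(2) by unfold_locales
  show "dominates_matrix matrix_loss n (est_G \<alpha> \<beta>) (est_X :: ('p, 'm) estimator)"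
    unfolding dominates_matrix_def has_risk_def
  proof (intro conjI allI impI)
    fix \<Theta> :: "real^'p^'m" and \<Sigma> :: "real^'p^'p" assume pd: "pos_def \<Sigma>"
    interpret regularised n \<Theta> \<Sigma> \<beta> by (rule loc[OF pd])
    note i = integrable_loss_X[OF n] integrable_loss_G[OF n]
    show "integrable (model n \<Theta> \<Sigma>) (\<lambda>\<omega>. matrix_loss (est_G \<alpha> \<beta> \<omega>) \<Theta> \<Sigma>)"
      "integrable (model n \<Theta> \<Sigma>) (\<lambda>\<omega>. matrix_loss (est_X \<omega>) \<Theta> \<Sigma>)" by (rule i)+
    show "pos_semidef (risk matrix_loss n est_X \<Theta> \<Sigma> - risk matrix_loss n (est_G \<alpha> \<beta>) \<Theta> \<Sigma>)"
      unfolding pos_semidef_def risk_difference_quadratic(2)[OF n]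
    proof (intro conjI allI integral_nonneg_AE)
      show "transpose (risk matrix_loss n est_X \<Theta> \<Sigma> - risk matrix_loss n (est_G \<alpha> \<beta>) \<Theta> \<Sigma>)
          = risk matrix_loss n est_X \<Theta> \<Sigma> - risk matrix_loss n (est_G \<alpha> \<beta>) \<Theta> \<Sigma>"
        unfolding transpose_diff risk_symmetric[OF i(1)] risk_symmetric[OF i(2)] ..
      show "AE \<omega> in Q. 0 \<le> x \<bullet> (gain \<alpha> \<omega> *v x)" for x
        using AE_gain_positive[OF n assms(1) pm \<alpha>'] by eventually_elim (cases "x = 0"; auto intro: less_imp_le)
    qed
  next
    interpret regularised n "0 :: real^'p^'m" "mat 1" \<beta> by (rule loc[OF pos_def_mat_1])
    define x :: "real^'m" where "x = axis undefined 1"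
    have x: "x \<noteq> 0" by (simp add: x_def axis_eq_0_iff)
    have "AE \<omega> in Q. 0 < x \<bullet> (gain \<alpha> \<omega> *v x)"
      using AE_gain_positive[OF n assms(1) pm \<alpha>'] by eventually_elim (use x in auto)
    then have "0 < (\<integral>\<omega>. x \<bullet> (gain \<alpha> \<omega> *v x) \<partial>Q)"
      by (intro integral_pos risk_difference_quadratic(1)[OF n]) auto
    then have "risk matrix_loss n est_X (0 :: real^'p^'m) (mat 1) - risk matrix_loss n (est_G \<alpha> \<beta>) (0 :: real^'p^'m) (mat 1) \<noteq> 0"
      unfolding risk_difference_quadratic(2)[OF n, symmetric]
      by auto
    then show "\<exists>(\<Theta> :: real^'p^'m) \<Sigma>. pos_def \<Sigma> \<and> risk matrix_loss n est_X \<Theta> \<Sigma> - risk matrix_loss n (est_G \<alpha> \<beta>) \<Theta> \<Sigma> \<noteq> 0"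
      using pos_def_mat_1 by blast
  qed
next
  assume pm: "\<bar>real CARD('p) - real CARD('m)\<bar> > 1" and n: "n \<ge> CARD('p)"
    and \<alpha>: "\<alpha> \<le> 2 * (\<bar>real CARD('p) - real CARD('m)\<bar> - 1) * \<beta>
             / (real n - real CARD('p) + 2 * real (min CARD('m) CARD('p)) + 1)"
  have "0 < real n - real CARD('p) + 2 * real (min CARD('m) CARD('p)) + 1"
    using n by (simp add: add_nonneg_pos)
  then have \<alpha>': "\<alpha> * (real n - real CARD('p) + 2 * real (min CARD('m) CARD('p)) + 1)
      \<le> 2 * (\<bar>real CARD('p) - real CARD('m)\<bar> - 1) * \<beta>"
    using \<alpha> by (simp only: pos_le_divide_eq)
  have loc: "regularised \<Sigma> \<beta>" if "pos_def \<Sigma>" for \<Sigma> :: "real^'p^'p"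
    using that assms(2) by unfold_locales
  show "dominates_scalar scalar_loss n (est_G \<alpha> \<beta>) (est_X :: ('p, 'm) estimator)"
    unfolding dominates_scalar_def has_risk_def
  proof (intro conjI allI impI)
    fix \<Theta> :: "real^'p^'m" and \<Sigma> :: "real^'p^'p" assume pd: "pos_def \<Sigma>"
    interpret regularised n \<Theta> \<Sigma> \<beta> by (rule loc[OF pd])
    note i = scalar_risk[OF integrable_loss_X[OF n]] scalar_risk[OF integrable_loss_G[OF n]]
    show "integrable (model n \<Theta> \<Sigma>) (\<lambda>\<omega>. scalar_loss (est_G \<alpha> \<beta> \<omega>) \<Theta> \<Sigma>)"
      "integrable (model n \<Theta> \<Sigma>) (\<lambda>\<omega>. scalar_loss (est_X \<omega>) \<Theta> \<Sigma>)" by (rule i)+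
    have "AE \<omega> in Q. 0 \<le> trace (gain \<alpha> \<omega>)"
      using AE_trace_gain_positive[OF n assms(1) pm \<alpha>'] by eventually_elim simp
    then have "0 \<le> (\<integral>\<omega>. trace (gain \<alpha> \<omega>) \<partial>Q)"
      by (rule integral_nonneg_AE)
    then show "risk scalar_loss n (est_G \<alpha> \<beta>) \<Theta> \<Sigma> \<le> risk scalar_loss n est_X \<Theta> \<Sigma>"
      unfolding i risk_difference_trace(2)[OF n, symmetric] by (simp add: trace_sub)
  next
    interpret regularised n "0 :: real^'p^'m" "mat 1" \<beta> by (rule loc[OF pos_def_mat_1])
    note i = scalar_risk[OF integrable_loss_X[OF n]] scalar_risk[OF integrable_loss_G[OF n]]
    have "0 < (\<integral>\<omega>. trace (gain \<alpha> \<omega>) \<partial>Q)"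
      by (intro integral_pos risk_difference_trace(1)[OF n] AE_trace_gain_positive[OF n assms(1) pm \<alpha>']) auto
    then have "risk scalar_loss n (est_G \<alpha> \<beta>) (0 :: real^'p^'m) (mat 1) < risk scalar_loss n est_X (0 :: real^'p^'m) (mat 1)"
      unfolding i risk_difference_trace(2)[OF n, symmetric] by (simp add: trace_sub)
    then show "\<exists>(\<Theta> :: real^'p^'m) \<Sigma>. pos_def \<Sigma> \<and> risk scalar_loss n (est_G \<alpha> \<beta>) \<Theta> \<Sigma> < risk scalar_loss n est_X \<Theta> \<Sigma>"
      using pos_def_mat_1 by blast
  qed
qed

end
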